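(* Let $\psi$ be an approximating function and let $\mathcal{Q}\subset\mathbb{R}^2$ be a non-degenerate rational quadric. Let $\mathcal{Q}(\psi):=\mathcal{Q}\cap\mathcal{S}_2(\psi)$ be the set of simultaneously $\psi$-approximable points lying on $\mathcal{Q}$, and let $|\cdot|_{\mathcal{Q}}$ denote the induced one-dimensional Lebesgue measure on $\mathcal{Q}$. Then $$|\mathcal{Q}(\psi)|_{\mathcal{Q}}=0\quad\text{if }\ \sum_{h=1}^\infty\psi(h)^2<\infty,$$ and $\mathcal{Q}(\psi)$ has full measure in $\mathcal{Q}$, i.e. $|\mathcal{Q}\setminus\mathcal{Q}(\psi)|_{\mathcal{Q}}=0$, if $\sum_{h=1}^\infty\psi(h)^2=\infty$.
   Context: An approximating function is a decreasing function $\psi:\mathbb{R}^+\to\mathbb{R}^+$. For $x\in\mathbb{R}$, $\|x\|=\min\{|x-m|:m\in\mathbb{Z}\}$. $\mathcal{S}_2(\psi)$ is the set of simultaneously $\psi$-approximable points, i.e. of $(y_1,y_2)\in\mathbb{R}^2$ for which there are infinitely many $q\in\mathbb{N}$ with $\max(\|qy_1\|,\|qy_2\|)<\psi(q)$. A non-degenerate rational quadric is the image, under a rational affine transformation of the plane (an invertible affine map with rational coefficients), of one of: the unit circle $\{x_1^2+x_2^2=1\}$, the hyperbola $\{x_1^2-x_2^2=1\}$, or the parabola $\{x_2=x_1^2\}$. *)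

theory Defs
  imports "HOL-Analysis.Analysis"
begin

definition approximating_function :: "(real \<Rightarrow> real) \<Rightarrow> bool" where
  "approximating_function \<psi> \<longleftrightarrow> (\<forall>x>0. \<psi> x > 0) \<and> antimono_on {0<..} \<psi>"

definition dist_nearest_int :: "real \<Rightarrow> real" where
  "dist_nearest_int x = infdist x \<int>"

definition simul_approximable :: "(real \<Rightarrow> real) \<Rightarrow> (real^2) set" where
  "simul_approximable \<psi> =
     {y. infinite {q::nat. q \<ge> 1 \<and>
        max (dist_nearest_int (real q * y$1)) (dist_nearest_int (real q * y$2)) < \<psi> (real q)}}"

definition unit_circle :: "(real^2) set" where
  "unit_circle = {x. (x$1)\<^sup>2 + (x$2)\<^sup>2 = 1}"

definition unit_hyperbola :: "(real^2) set" where
  "unit_hyperbola = {x. (x$1)\<^sup>2 - (x$2)\<^sup>2 = 1}"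

definition unit_parabola :: "(real^2) set" where
  "unit_parabola = {x. x$2 = (x$1)\<^sup>2}"

definition rational_affine :: "(real^2 \<Rightarrow> real^2) \<Rightarrow> bool" where
  "rational_affine T \<longleftrightarrow>
     (\<exists>A::real^2^2. \<exists>b::real^2. invertible A \<and> (\<forall>i j. A$i$j \<in> \<rat>) \<and> (\<forall>i. b$i \<in> \<rat>) \<and>
        T = (\<lambda>x. A *v x + b))"

definition nondegenerate_rational_quadric :: "(real^2) set \<Rightarrow> bool" where
  "nondegenerate_rational_quadric Q \<longleftrightarrow>
     (\<exists>T C. rational_affine T \<and> C \<in> {unit_circle, unit_hyperbola, unit_parabola} \<and> Q = T ` C)"

text \<open>
  One-dimensional Hausdorff (outer) measure. With the normalisation by diameters it is Lebesgue
  outer measure on the line and arc length on rectifiable simple curves. The covering sets are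
  required to be bounded because \<^const>\<open>diameter\<close> is an unspecified real on unbounded sets;
  as they may be empty, finite covers are included.
\<close>

definition hausdorff1_pre :: "real \<Rightarrow> 'a::metric_space set \<Rightarrow> ennreal" where
  "hausdorff1_pre \<delta> A =
     (INF U \<in> {U :: nat \<Rightarrow> 'a set. A \<subseteq> (\<Union>i. U i) \<and> (\<forall>i. bounded (U i) \<and> diameter (U i) \<le> \<delta>)}.
        \<Sum>i. ennreal (diameter (U i)))"

definition hausdorff1 :: "'a::metric_space set \<Rightarrow> ennreal" where
  "hausdorff1 A = (SUP \<delta>\<in>{0<..}. hausdorff1_pre \<delta> A)"

text \<open>
  The Lebesgue measure induced on a plane curve, i.e. arc length, is the one-dimensional
  Hausdorff measure restricted to the curve. As an outer measure it is defined on all sets,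
  with value zero exactly on the null sets of the completed measure.
\<close>

definition induced_measure :: "(real^2) set \<Rightarrow> (real^2) set \<Rightarrow> ennreal" where
  "induced_measure Q A = hausdorff1 (A \<inter> Q)"

definition approximable_on :: "(real^2) set \<Rightarrow> (real \<Rightarrow> real) \<Rightarrow> (real^2) set" where
  "approximable_on Q \<psi> = Q \<inter> simul_approximable \<psi>"

end

theory Submission
  imports Defs "HOL-Real_Asymp.Real_Asymp"
begin

text \<open>
  The conics are rational projective images of the parabola \<open>(1 : t : t\<^sup>2)\<close>, and such maps preserve
  approximability up to constants, so only the parabola matters. There a rational point
  \<open>(p/q, r/q)\<close> near the curve is an integer triple with \<open>p\<^sup>2 - q r\<close> small, i.e. a binary quadratic
  form of small discriminant.

  Counting: approximate \<open>p/q\<close> by a fraction \<open>a/b\<close> (Dirichlet). The values \<open>A = q a\<^sup>2 - 2 p a b + r b\<^sup>2\<close>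
  and \<open>q a - p b\<close> of the form at \<open>(a, b)\<close> are small, determine \<open>q\<close> modulo \<open>b\<^sup>2\<close>, and satisfy
  \<open>q A = (q a - p b)\<^sup>2 - (p\<^sup>2 - q r) b\<^sup>2\<close>; summing over \<open>A\<close>, \<open>a\<close>, \<open>b\<close> gives the sharp order of magnitude.
  Convergence then is Borel--Cantelli.

  Divergence: by the pigeonhole principle every \<open>t\<close> is close to a rational point near the curve with
  \<open>q \<le> N\<close>, and by the counting bound \<open>q\<close> is comparable to \<open>N\<close> for most \<open>t\<close>. Choosing one such
  point in each cell of a suitable grid makes the target sets at different levels quasi-independent,
  so their limsup fills a fixed proportion of every interval, hence almost everything.
\<close>

section \<open>Counting rational points near the parabola\<close>

text \<open>Put N = 4096^n and E = 2^n, so N = E^12. In a block with q of size N, p/q in an interval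
  of length w and |p^2 - q r| <= K, the expected number of triples is of order w K N. Covering with
  intervals of radius about \<open>\<psi>\<close>/N uses K about \<open>\<psi>\<close> N, and
  convergence forces \<open>\<psi>\<close> = o(N^(-1/2)). So K is at most N^(1/2) = E^6, and an
  error (n+1) E^17 in the count costs only (n+1) 2^(-n): an upper bound with a power saving at K =
  N^(1/2) suffices. The Dirichlet denominators are cut at b <= E^4 = N^(1/3). A cut-off N^c leaves
  errors near N^(2-2c) and K^(3/2) N^(2c), both below N^(3/2) exactly for 1/4 < c < 3/8. The base
  4096 = 2^12 makes N^(1/2), N^(1/3) and N^(1/4) powers of E. For divergence the main term is used
  with its constant: discarding the three lowest blocks below N gains 4096^3 = 2^36, enough to beat
  that constant. The proportion of an interval that is finally filled must not depend on the
  interval, although the functions and the starting level do; this is why blocks of levels with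
  total mass between 1 and 2 are used.\<close>

lemma card_congruent_ints:
  fixes S :: "int set" and m :: int and L :: real
  assumes m: "m > 0"
    and dv: "\<And>x y. x \<in> S \<Longrightarrow> y \<in> S \<Longrightarrow> m dvd x - y"
    and L: "\<And>x y. x \<in> S \<Longrightarrow> y \<in> S \<Longrightarrow> of_int (x - y) \<le> L"
  shows "finite S" and "L \<ge> 0 \<Longrightarrow> real (card S) \<le> L / of_int m + 1"
proof -
  show fin: "finite S"
  proof (cases "S = {}")
    case False
    then obtain x0 where x0: "x0 \<in> S" by blast
    have "S \<subseteq> {x0 - \<lceil>L\<rceil>..x0 + \<lceil>L\<rceil>}"
    proof
      fix x assume x: "x \<in> S"
      from L[OF x x0] L[OF x0 x] show "x \<in> {x0 - \<lceil>L\<rceil>..x0 + \<lceil>L\<rceil>}"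
        by (auto, linarith+)
    qed
    then show ?thesis by (rule finite_subset) auto
  qed auto
  assume L0: "L \<ge> 0"
  show "real (card S) \<le> L / of_int m + 1"
  proof (cases "S = {}")
    case True then show ?thesis using L0 m by simp
  next
    case False
    define a where "a = Min S"
    have a: "a \<in> S" "\<And>x. x \<in> S \<Longrightarrow> a \<le> x"
      using fin False by (auto simp: a_def)
    have "inj_on (\<lambda>x. (x - a) div m) S"
    proof (rule inj_onI)
      fix x y assume xy: "x \<in> S" "y \<in> S" "(x - a) div m = (y - a) div m"
      have "m dvd x - a" "m dvd y - a" using dv a xy by auto
      then show "x = y" using xy(3) by (metis diff_add_cancel dvd_div_mult_self)
    qed
    moreover have "(\<lambda>x. (x - a) div m) ` S \<subseteq> {0..\<lfloor>L / of_int m\<rfloor>}"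
    proof
      fix z assume "z \<in> (\<lambda>x. (x - a) div m) ` S"
      then obtain x where x: "x \<in> S" "z = (x - a) div m" by blast
      have e: "z * m = x - a" using x dv[OF x(1) a(1)] by simp
      have "of_int (z * m) \<le> L" using L[OF x(1) a(1)] e by simp
      then have "of_int z \<le> L / of_int m" using m by (simp add: field_simps)
      moreover have "z \<ge> 0" using x a(2)[OF x(1)] m by (simp add: pos_imp_zdiv_nonneg_iff)
      ultimately show "z \<in> {0..\<lfloor>L / of_int m\<rfloor>}" by (simp add: le_floor_iff)
    qed
    ultimately have "card S \<le> card {0..\<lfloor>L / of_int m\<rfloor>}"
      by (metis card_image card_mono finite_atLeastAtMost_int)
    also have "\<dots> = nat (\<lfloor>L / of_int m\<rfloor> + 1)" by simp
    finally have "real (card S) \<le> real_of_int (\<lfloor>L / of_int m\<rfloor> + 1)"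
      using L0 m by (simp add: of_nat_nat zero_le_floor le_nat_iff)
    then show ?thesis by linarith
  qed
qed

lemma card_le_sum_fibres:
  fixes c :: "'b \<Rightarrow> real"
  assumes T: "finite T" "f ` S \<subseteq> T"
    and fib: "\<And>y. y \<in> T \<Longrightarrow> finite {x\<in>S. f x = y} \<and> real (card {x\<in>S. f x = y}) \<le> c y"
  shows "finite S \<and> real (card S) \<le> (\<Sum>y\<in>T. c y)"
proof -
  have S: "S = (\<Union>y\<in>T. {x\<in>S. f x = y})" using T by auto
  have fin: "finite S" by (subst S) (use T fib in auto)
  have "card S \<le> (\<Sum>y\<in>T. card {x\<in>S. f x = y})"
    by (subst S) (rule card_UN_le[OF T(1)])
  then have "real (card S) \<le> (\<Sum>y\<in>T. real (card {x\<in>S. f x = y}))"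
    by (metis of_nat_le_iff of_nat_sum)
  also have "\<dots> \<le> (\<Sum>y\<in>T. c y)" by (rule sum_mono) (use fib in auto)
  finally show ?thesis using fin by blast
qed

text \<open>The triple is the form q X^2 - 2 p X Y + r Y^2, and q a - p b is half its X-derivative
  at (a, b). Since a (q a - p b) is congruent to the value A modulo b, the quantity q a - p b lies
  in one class modulo b. Once it is fixed, q lies in one class modulo b^2 and determines p and r.
  The two factors of the bound count these two choices.\<close>

lemma card_triples_fixed_value:
  fixes S :: "(int \<times> int \<times> int) set" and a b A :: int and X Z :: real
  assumes b: "b > 0" "coprime a b"
    and A: "\<And>q p r. (q, p, r) \<in> S \<Longrightarrow> q * a\<^sup>2 - 2 * p * a * b + r * b\<^sup>2 = A"
    and X: "X \<ge> 0" "\<And>q p r. (q, p, r) \<in> S \<Longrightarrow> \<bar>of_int (q * a - p * b)\<bar> \<le> X"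
    and Z: "Z \<ge> 0" "\<And>q p r q' p' r'. (q, p, r) \<in> S \<Longrightarrow> (q', p', r') \<in> S \<Longrightarrow>
       q * a - p * b = q' * a - p' * b \<Longrightarrow> of_int (q - q') \<le> Z"
  shows "finite S \<and> real (card S) \<le> (2 * X / of_int b + 1) * (Z / (of_int b)\<^sup>2 + 1)"
proof -
  define f where "f = (\<lambda>(q, p, r::int). q * a - p * b)"
  define T where "T = f ` S"
  have dT: "b dvd x - y" if xy: "x \<in> T" "y \<in> T" for x y
  proof -
    from xy(1) obtain q p r where 1: "(q, p, r) \<in> S" "x = q * a - p * b"
      by (auto simp: T_def f_def)
    from xy(2) obtain q' p' r' where 2: "(q', p', r') \<in> S" "y = q' * a - p' * b"
      by (auto simp: T_def f_def)
    have "a * x = A + b * (p * a - r * b)"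
      unfolding A[OF 1(1), symmetric] 1(2) by (simp add: algebra_simps power2_eq_square)
    moreover have "a * y = A + b * (p' * a - r' * b)"
      unfolding A[OF 2(1), symmetric] 2(2) by (simp add: algebra_simps power2_eq_square)
    ultimately have "a * (x - y) = b * ((p * a - r * b) - (p' * a - r' * b))"
      by (simp add: algebra_simps)
    then have "b dvd a * (x - y)" by simp
    then show ?thesis using b(2) by (simp add: coprime_commute coprime_dvd_mult_right_iff)
  qed
  have LT: "of_int (x - y) \<le> 2 * X" if xy: "x \<in> T" "y \<in> T" for x y
  proof -
    have "\<bar>of_int x\<bar> \<le> X" "\<bar>of_int y\<bar> \<le> X" using xy X(2) unfolding T_def f_def by fastforce+
    then show ?thesis unfolding of_int_diff by linarith
  qed
  have finT: "finite T" by (rule card_congruent_ints(1)[OF b(1) dT LT])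
  have cT: "real (card T) \<le> 2 * X / of_int b + 1"
    by (rule card_congruent_ints(2)[OF b(1) dT LT]) (use X in auto)
  have fib: "finite {x\<in>S. f x = y} \<and> real (card {x\<in>S. f x = y}) \<le> Z / (of_int b)\<^sup>2 + 1"
    if y: "y \<in> T" for y
  proof -
    define U where "U = {x\<in>S. f x = y}"
    have inj: "inj_on fst U"
    proof (rule inj_onI)
      fix s t assume st: "s \<in> U" "t \<in> U" "fst s = fst t"
      obtain q p r q' p' r' where s: "s = (q, p, r)" and t: "t = (q', p', r')"
        by (metis prod_cases3)
      have 1: "(q, p, r) \<in> U" and 2: "(q', p', r') \<in> U" and e: "q = q'" using st s t by auto
      have "q * a - p * b = y" "q' * a - p' * b = y" using 1 2 by (simp_all add: U_def f_def)
      then have "q * a - p * b = q' * a - p' * b" by simp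
      then have "p * b = p' * b" using e by simp
      then have p: "p = p'" using b by simp
      have "q * a\<^sup>2 - 2 * p * a * b + r * b\<^sup>2 = A" "q' * a\<^sup>2 - 2 * p' * a * b + r' * b\<^sup>2 = A"
        using A 1 2 by (auto simp: U_def)
      then have "q * a\<^sup>2 - 2 * p * a * b + r * b\<^sup>2 = q * a\<^sup>2 - 2 * p * a * b + r' * b\<^sup>2"
        using e p by simp
      then have "r * b\<^sup>2 = r' * b\<^sup>2" by (simp only: add_left_cancel)
      then show "s = t" using p e b s t by simp
    qed
    have dv: "b\<^sup>2 dvd u - v" if uv: "u \<in> fst ` U" "v \<in> fst ` U" for u v
    proof -
      from uv(1) obtain p r where 1: "(u, p, r) \<in> U" by auto
      from uv(2) obtain p' r' where 2: "(v, p', r') \<in> U" by auto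
      have "u * a - p * b = y" "v * a - p' * b = y" using 1 2 by (simp_all add: U_def f_def)
      then have e1: "(u - v) * a = (p - p') * b" by (simp add: left_diff_distrib)
      then have "b dvd (u - v) * a" by simp
      then have "b dvd u - v" using b(2) by (simp add: coprime_commute coprime_dvd_mult_left_iff)
      then obtain e where e: "u - v = b * e" by (auto elim: dvdE)
      have "(p - p') = e * a" using e1 e b by simp
      moreover have "(u - v) * a\<^sup>2 - 2 * (p - p') * a * b + (r - r') * b\<^sup>2 = 0"
      proof -
        have "u * a\<^sup>2 - 2 * p * a * b + r * b\<^sup>2 = A" "v * a\<^sup>2 - 2 * p' * a * b + r' * b\<^sup>2 = A"
          using A 1 2 by (auto simp: U_def)
        then show ?thesis by (simp add: algebra_simps)
      qed
      \<comment> \<open>With u - v = b e and p - p' = e a, equality of the two values at (a, b)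
        leaves (r - r') b = e a^2; this provides the second factor b of the modulus.\<close>
      ultimately have "b * ((r - r') * b) = b * (e * a\<^sup>2)" using e by algebra
      then have "(r - r') * b = e * a\<^sup>2" using b by simp
      then have "b dvd e * a\<^sup>2" by (metis dvd_triv_right)
      then have "b dvd e" using b(2) by (simp add: coprime_commute coprime_dvd_mult_left_iff)
      then show ?thesis using e by (simp add: power2_eq_square)
    qed
    have L: "of_int (u - v) \<le> Z" if "u \<in> fst ` U" "v \<in> fst ` U" for u v
    proof -
      from that(1) obtain p r where 1: "(u, p, r) \<in> U" by auto
      from that(2) obtain p' r' where 2: "(v, p', r') \<in> U" by auto
      show ?thesis by (rule Z(2)[of u p r v p' r']) (use 1 2 in \<open>simp_all add: U_def f_def\<close>)
    qed
    have b2: "b\<^sup>2 > 0" using b by simp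
    have "finite (fst ` U)" by (rule card_congruent_ints(1)[OF b2 dv L])
    moreover have "real (card (fst ` U)) \<le> Z / of_int (b\<^sup>2) + 1"
      by (rule card_congruent_ints(2)[OF b2 dv L Z(1)])
    ultimately show ?thesis using inj unfolding U_def[symmetric]
      by (auto simp: finite_image_iff card_image)
  qed
  have "finite S \<and> real (card S) \<le> (\<Sum>y\<in>T. Z / (of_int b)\<^sup>2 + 1)"
    by (rule card_le_sum_fibres[OF finT _ fib]) (auto simp: T_def)
  moreover have "(\<Sum>y\<in>T. Z / (of_int b)\<^sup>2 + 1) = real (card T) * (Z / (of_int b)\<^sup>2 + 1)"
    by simp
  moreover have "\<dots> \<le> (2 * X / of_int b + 1) * (Z / (of_int b)\<^sup>2 + 1)"
    by (rule mult_right_mono[OF cT]) (use Z in auto)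
  ultimately show ?thesis by linarith
qed

lemma sqrt_bound_from_quadratic:
  fixes x y z :: real
  assumes "x\<^sup>2 \<le> y\<^sup>2 + z\<^sup>2" "y \<ge> 0" "z \<ge> 0"
  shows "\<bar>x\<bar> \<le> y + z"
proof -
  have "x\<^sup>2 \<le> (y + z)\<^sup>2" using assms mult_nonneg_nonneg[of y z] unfolding power2_sum by linarith
  then show ?thesis using assms abs_le_square_iff[of x "y + z"] by simp
qed

text \<open>With x = q a - p b and D = p^2 - q r, the value A satisfies q A = x^2 - D b^2. Hence |x|
  <= sqrt(H M |A|) + sqrt K b, and for fixed x and nonzero A two values of q differ by at most 2 K
  b^2 / |A|. For A = 0 the latter restriction disappears and only the size of q remains: this is the
  separate first term. The factor 2 before the sum accounts for both signs of A.\<close>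

lemma card_arc:
  fixes S :: "(int \<times> int \<times> int) set" and a b :: int and M K H :: real and n :: nat
  assumes b: "b > 0" "coprime a b" and M: "M > 0" "H > 0" and K: "K \<ge> 0"
    and S: "\<And>q p r. (q, p, r) \<in> S \<Longrightarrow> M \<le> of_int q \<and> of_int q \<le> H * M \<and>
        \<bar>of_int (p\<^sup>2 - q * r)\<bar> \<le> K \<and> \<bar>q * a\<^sup>2 - 2 * p * a * b + r * b\<^sup>2\<bar> \<le> int n"
  shows "finite S \<and> real (card S) \<le> (2 * sqrt K + 1) * (H * M / (of_int b)\<^sup>2 + 1)
     + 2 * (\<Sum>A=1..n. (2 * sqrt (H * M * real A) / of_int b + 2 * sqrt K + 1) * (2 * K / real A + 1))"
proof -
  define f where "f = (\<lambda>(q, p, r). q * a\<^sup>2 - 2 * p * a * b + r * b\<^sup>2)"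
  have key: "real_of_int (q * A) = (of_int (q * a - p * b))\<^sup>2 - of_int (p\<^sup>2 - q * r) * (of_int b)\<^sup>2"
    if "f (q, p, r) = A" for q p r A
  proof -
    have "q * A = (q * a - p * b)\<^sup>2 - (p\<^sup>2 - q * r) * b\<^sup>2"
      unfolding that[symmetric] f_def by (simp add: algebra_simps power2_eq_square)
    then show ?thesis by (metis of_int_diff of_int_mult of_int_power)
  qed
  define c where "c = (\<lambda>A::int. if A = 0 then (2 * sqrt K + 1) * (H * M / (of_int b)\<^sup>2 + 1)
     else (2 * sqrt (H * M * \<bar>of_int A\<bar>) / of_int b + 2 * sqrt K + 1) * (2 * K / \<bar>of_int A\<bar> + 1))"
  have kb: "\<bar>of_int (p\<^sup>2 - q * r) * (of_int b)\<^sup>2\<bar> \<le> K * (of_int b)\<^sup>2" if "(q, p, r) \<in> S" for q p r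
  proof -
    have "\<bar>of_int (p\<^sup>2 - q * r) * (of_int b)\<^sup>2\<bar> = \<bar>real_of_int (p\<^sup>2 - q * r)\<bar> * (of_int b)\<^sup>2"
      by (simp add: abs_mult)
    also have "\<dots> \<le> K * (of_int b)\<^sup>2" by (rule mult_right_mono) (use S[OF that] in auto)
    finally show ?thesis .
  qed
  have fib: "finite {x\<in>S. f x = A} \<and> real (card {x\<in>S. f x = A}) \<le> c A" for A
  proof (cases "A = 0")
    case True
    have "finite {x\<in>S. f x = A} \<and> real (card {x\<in>S. f x = A}) \<le>
       (2 * (sqrt K * of_int b) / of_int b + 1) * (H * M / (of_int b)\<^sup>2 + 1)"
    proof (rule card_triples_fixed_value[OF b, where A=A])
      show "q * a\<^sup>2 - 2 * p * a * b + r * b\<^sup>2 = A" if "(q, p, r) \<in> {x\<in>S. f x = A}" for q p r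
        using that by (simp add: f_def)
      show "0 \<le> sqrt K * of_int b" "0 \<le> H * M" using b K M by auto
      show "\<bar>of_int (q * a - p * b)\<bar> \<le> sqrt K * real_of_int b" if "(q, p, r) \<in> {x\<in>S. f x = A}" for q p r
      proof -
        have "(real_of_int (q * a - p * b))\<^sup>2 \<le> (sqrt K * of_int b)\<^sup>2 + 0\<^sup>2"
        proof -
          have "(real_of_int (q * a - p * b))\<^sup>2 = of_int (p\<^sup>2 - q * r) * (of_int b)\<^sup>2"
            using key[of q p r A] that True by simp
          also have "\<dots> \<le> K * (of_int b)\<^sup>2" using kb[of q p r] that abs_le_D1 by blast
          finally show ?thesis using K by (simp add: power_mult_distrib)
        qed
        then have "\<bar>real_of_int (q * a - p * b)\<bar> \<le> sqrt K * of_int b + 0"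
          by (rule sqrt_bound_from_quadratic) (use b K in auto)
        then show ?thesis by (simp only: add_0_right)
      qed
      show "of_int (q - q') \<le> H * M" if "(q, p, r) \<in> {x\<in>S. f x = A}" "(q', p', r') \<in> {x\<in>S. f x = A}"
        for q p r q' p' r' :: int
      proof -
        have "real_of_int q \<le> H * M" using S that(1) by blast
        moreover have "M \<le> real_of_int q'" using S that(2) by blast
        ultimately show ?thesis using M unfolding of_int_diff by linarith
      qed
    qed
    then show ?thesis using True b by (simp add: c_def)
  next
    case False
    let ?A = "\<bar>real_of_int A\<bar>"
    have A: "?A > 0" using False by simp
    have "finite {x\<in>S. f x = A} \<and> real (card {x\<in>S. f x = A}) \<le>
       (2 * (sqrt (H * M * ?A) + sqrt K * of_int b) / of_int b + 1) * ((2 * K * (of_int b)\<^sup>2 / ?A) / (of_int b)\<^sup>2 + 1)"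
    proof (rule card_triples_fixed_value[OF b, where A=A])
      show "q * a\<^sup>2 - 2 * p * a * b + r * b\<^sup>2 = A" if "(q, p, r) \<in> {x\<in>S. f x = A}" for q p r
        using that by (simp add: f_def)
      show "0 \<le> sqrt (H * M * ?A) + sqrt K * of_int b" "0 \<le> 2 * K * (of_int b)\<^sup>2 / ?A"
        using b K M by auto
      show "\<bar>of_int (q * a - p * b)\<bar> \<le> sqrt (H * M * ?A) + sqrt K * of_int b"
        if "(q, p, r) \<in> {x\<in>S. f x = A}" for q p r
      proof -
        have q: "M \<le> of_int q" "of_int q \<le> H * M" using S[of q p r] that by auto
        have "real_of_int (q * A) \<le> of_int q * ?A" using q M by (simp add: mult_left_mono)
        also have "\<dots> \<le> H * M * ?A" using q by (intro mult_right_mono) auto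
        finally have "real_of_int (q * A) \<le> H * M * ?A" .
        moreover have "of_int (p\<^sup>2 - q * r) * (of_int b)\<^sup>2 \<le> K * (of_int b)\<^sup>2"
          using kb[of q p r] that abs_le_D1 by blast
        moreover have "real_of_int (q * A) = (of_int (q * a - p * b))\<^sup>2 - of_int (p\<^sup>2 - q * r) * (of_int b)\<^sup>2"
          using key that by blast
        ultimately have "(real_of_int (q * a - p * b))\<^sup>2 \<le> H * M * ?A + K * (of_int b)\<^sup>2"
          by linarith
        then have "(real_of_int (q * a - p * b))\<^sup>2 \<le> (sqrt (H * M * ?A))\<^sup>2 + (sqrt K * of_int b)\<^sup>2"
          using K M by (simp add: power_mult_distrib)
        then show ?thesis by (rule sqrt_bound_from_quadratic) (use b K M in auto)
      qed
      show "of_int (q - q') \<le> 2 * K * (of_int b)\<^sup>2 / ?A"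
        if 1: "(q, p, r) \<in> {x\<in>S. f x = A}" and 2: "(q', p', r') \<in> {x\<in>S. f x = A}"
          and e: "q * a - p * b = q' * a - p' * b"
        for q p r q' p' r' :: int
      proof -
        have "\<bar>real_of_int (q * A) - of_int (q' * A)\<bar> \<le> 2 * (K * (of_int b)\<^sup>2)"
        proof -
          have "real_of_int (q * A) = (of_int (q * a - p * b))\<^sup>2 - of_int (p\<^sup>2 - q * r) * (of_int b)\<^sup>2"
            "real_of_int (q' * A) = (of_int (q' * a - p' * b))\<^sup>2 - of_int (p'\<^sup>2 - q' * r') * (of_int b)\<^sup>2"
            by (rule key, use 1 2 in simp)+
          moreover have "\<bar>of_int (p\<^sup>2 - q * r) * (of_int b)\<^sup>2\<bar> \<le> K * (of_int b)\<^sup>2"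
            "\<bar>of_int (p'\<^sup>2 - q' * r') * (of_int b)\<^sup>2\<bar> \<le> K * (of_int b)\<^sup>2"
            using kb 1 2 by blast+
          ultimately show ?thesis unfolding e by linarith
        qed
        moreover have "\<bar>real_of_int (q * A) - of_int (q' * A)\<bar> = \<bar>of_int (q - q')\<bar> * ?A"
          by (simp add: abs_mult[symmetric] algebra_simps)
        ultimately have "\<bar>of_int (q - q')\<bar> \<le> 2 * K * (of_int b)\<^sup>2 / ?A" using A by (simp add: field_simps)
        then show ?thesis by linarith
      qed
    qed
    then show ?thesis using False b by (simp add: c_def add_divide_distrib)
  qed
  have "f ` S \<subseteq> {-int n..int n}" using S unfolding f_def by fastforce
  from card_le_sum_fibres[OF _ this, of c] fib
  have "finite S \<and> real (card S) \<le> (\<Sum>A\<in>{-int n..int n}. c A)" by auto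
  moreover have "(\<Sum>A\<in>{-int n..int n}. c A) = c 0 + 2 * (\<Sum>A=1..n. c (int A))"
  proof (induction n)
    case (Suc n)
    have "{- int (Suc n)..int (Suc n)} = insert (- int (Suc n)) (insert (int (Suc n)) {-int n..int n})"
      by auto
    then have "(\<Sum>A\<in>{- int (Suc n)..int (Suc n)}. c A) = c (- int (Suc n)) + c (int (Suc n)) + (\<Sum>A\<in>{-int n..int n}. c A)"
      by simp
    moreover have "c (- int (Suc n)) = c (int (Suc n))" by (simp add: c_def add.commute)
    ultimately show ?case using Suc by simp
  qed simp
  moreover have "(\<Sum>A=1..n. c (int A)) = (\<Sum>A=1..n. (2 * sqrt (H * M * real A) / of_int b + 2 * sqrt K + 1) * (2 * K / real A + 1))"
    by (rule sum.cong) (auto simp: c_def)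
  ultimately show ?thesis by (simp add: c_def)
qed

section \<open>Summation of the counts over values, numerators and denominators\<close>

lemma sum_inverse_sqrt_le: "(\<Sum>A=1..n. 1 / sqrt (real A)) \<le> 2 * sqrt (real n)"
proof (induction n)
  case (Suc n)
  have "1 / sqrt (real (Suc n)) \<le> 2 * (sqrt (real (Suc n)) - sqrt (real n))"
  proof -
    let ?u = "sqrt (real (Suc n))" and ?v = "sqrt (real n)"
    have u: "?u > 0" "?v \<ge> 0" "?v \<le> ?u" by auto
    have "?u * ?u - ?v * ?v = 1" by simp
    then have "1 = (?u - ?v) * (?u + ?v)" by (simp add: algebra_simps)
    also have "\<dots> \<le> (?u - ?v) * (2 * ?u)" using u by (intro mult_left_mono) auto
    finally show ?thesis using u by (simp add: field_simps)
  qed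
  then show ?case using Suc by simp
qed simp

lemma sum_sqrt_le: "(\<Sum>A=1..n. sqrt (real A)) \<le> real n * sqrt (real n)"
proof -
  have "(\<Sum>A=1..n. sqrt (real A)) \<le> (\<Sum>A=1..n. sqrt (real n))" by (rule sum_mono) auto
  then show ?thesis by simp
qed

text \<open>Each dyadic block contributes at most 1. The ranges of A and b in the count end at
  powers of two so that harmonic sums cost a factor linear in n.\<close>

lemma sum_inverse_le: "(\<Sum>A=1..2^k. 1 / real A) \<le> real k + 1"
proof (induction k)
  case (Suc k)
  have "{1..2^Suc k} = {1..2^k} \<union> {2^k+1..2^Suc k::nat}" by auto
  then have "(\<Sum>A=1..2^Suc k. 1 / real A) = (\<Sum>A=1..2^k. 1 / real A) + (\<Sum>A=2^k+1..2^Suc k. 1 / real A)"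
    by (metis (no_types, lifting) add.commute le_add2 mult_2 power_Suc sum.ub_add_nat)
  also have "(\<Sum>A=2^k+1..2^Suc k. 1 / real A) \<le> (\<Sum>A=2^k+1..2^Suc k::nat. 1 / 2^k)"
  proof (rule sum_mono)
    fix A :: nat assume "A \<in> {2^k+1..2^Suc k}"
    then have "2^k \<le> A" by simp
    then have "(2::real)^k \<le> real A" by (metis of_nat_le_iff of_nat_numeral of_nat_power)
    then show "1 / real A \<le> 1 / 2^k" by (intro frac_le) auto
  qed
  also have "\<dots> = 1" by simp
  finally show ?case using Suc by simp
qed simp

lemma sum_le_square: "(\<Sum>b=1..n. real b) \<le> (real n)\<^sup>2"
proof -
  have "(\<Sum>b=1..n. real b) \<le> (\<Sum>b=1..n. real n)" by (rule sum_mono) auto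
  then show ?thesis by (simp add: power2_eq_square)
qed

text \<open>Only the sum of K / sqrt A has to stay linear in K; it becomes the main term
  \<open>2^17 * K * E^8 / b\<close>. All other terms are errors, in which K is replaced by E^6 and
  sqrt K by E^3. The upper limit of A is 2^14 E^4, and 4096 E^12 is the upper end of the block of
  q.\<close>

lemma arc_bound:
  fixes n b :: nat and K E :: real
  assumes b: "b \<ge> 1" and K: "0 \<le> K" "K \<le> E^6" and E: "E = 2^n"
  shows "(2 * sqrt K + 1) * (4096 * E^12 / (real b)\<^sup>2 + 1)
     + 2 * (\<Sum>A=1..2^(4*n+14). (2 * sqrt (4096 * E^12 * real A) / real b + 2 * sqrt K + 1) * (2 * K / real A + 1))
     \<le> 2^17 * K * E^8 / b + (2^29 * E^12 / b + 100000 * (real n + 1) * E^9 + 12288 * E^15 / (real b)\<^sup>2 + 3 * E^3)"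
proof -
  let ?t = "\<lambda>A::nat. (2 * sqrt (4096 * E^12 * real A) / real b + 2 * sqrt K + 1) * (2 * K / real A + 1)"
  let ?m = "2^(4*n+14) :: nat"
  have E1: "E \<ge> 1" unfolding E by simp
  have b0: "real b > 0" using b by simp
  have s: "sqrt K \<le> E^3" by (rule real_le_lsqrt) (use K E1 in \<open>simp_all flip: power_mult\<close>)
  have E31: "E^3 \<ge> 1" using E1 by simp
  have s3: "2 * sqrt K + 1 \<le> 3 * E^3" using s E31 by linarith
  have m: "real ?m = 2^14 * E^4" unfolding E by (simp add: power_add power_mult[symmetric] mult.commute)
  have "real ?m = (128 * E\<^sup>2)\<^sup>2" unfolding m by (simp add: power_mult_distrib)
  then have sm: "sqrt (real ?m) = 128 * E\<^sup>2" using E1 by (intro real_sqrt_unique) auto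
  have sA: "sqrt (4096 * E^12 * real A) = 64 * E^6 * sqrt (real A)" for A
  proof -
    have "4096 * E^12 * real A = (64 * E^6)\<^sup>2 * real A" by (simp add: power_mult_distrib)
    then show ?thesis unfolding \<open>4096 * E^12 * real A = _\<close> real_sqrt_mult real_sqrt_abs using E1 by simp
  qed
  have split: "?t A
     = (256 * E^6 * K / b) * (1 / sqrt (real A)) + (128 * E^6 / b) * sqrt (real A)
       + ((2 * sqrt K + 1) * 2 * K) * (1 / real A) + (2 * sqrt K + 1)" if "A \<in> {1..?m}" for A
  proof -
    have "1 / sqrt (real A) = sqrt (real A) / real A" using that
      by (simp add: field_simps)
    then show ?thesis unfolding sA using b0 that by (simp add: field_simps)
  qed
  have "(\<Sum>A=1..?m. ?t A)
    = (256 * E^6 * K / b) * (\<Sum>A=1..?m. 1 / sqrt (real A)) + (128 * E^6 / b) * (\<Sum>A=1..?m. sqrt (real A))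
       + ((2 * sqrt K + 1) * 2 * K) * (\<Sum>A=1..?m. 1 / real A) + (2 * sqrt K + 1) * real ?m"
    by (subst sum.cong[OF refl split], assumption) (simp only: sum.distrib sum_distrib_left[symmetric], simp add: algebra_simps)
  also have "\<dots> \<le> (256 * E^6 * K / b) * (2 * (128 * E\<^sup>2)) + (128 * E^6 / b) * (2^14 * E^4 * (128 * E\<^sup>2))
       + (3 * E^3 * 2 * E^6) * (real (4*n+14) + 1) + 3 * E^3 * (2^14 * E^4)"
  proof (intro add_mono mult_left_mono mult_mono)
    show "(\<Sum>A=1..?m. 1 / sqrt (real A)) \<le> 2 * (128 * E\<^sup>2)" using sum_inverse_sqrt_le[of ?m] sm by simp
    show "(\<Sum>A=1..?m. sqrt (real A)) \<le> 2^14 * E^4 * (128 * E\<^sup>2)" using sum_sqrt_le[of ?m] sm m by simp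
    show "(\<Sum>A=1..?m. 1 / real A) \<le> real (4*n+14) + 1" by (rule sum_inverse_le)
    show "real ?m \<le> 2^14 * E^4" using m by simp
  qed (use s3 E1 K b0 in \<open>auto intro!: sum_nonneg\<close>)
  also have "\<dots> = 2^16 * K * E^8 / b + 2^28 * E^12 / b + (24 * real n + 90) * E^9 + 49152 * E^7"
    by (simp add: field_simps eval_nat_numeral)
  also have "\<dots> \<le> 2^16 * K * E^8 / b + 2^28 * E^12 / b + 50000 * (real n + 1) * E^9"
  proof -
    have "E^7 \<le> E^9" using E1 by (intro power_increasing) auto
    then have "(24 * real n + 90) * E^9 + 49152 * E^7 \<le> (24 * real n + 90) * E^9 + 49152 * E^9" by simp
    also have "\<dots> = (24 * real n + 49242) * E^9" by (simp add: algebra_simps)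
    also have "\<dots> \<le> (50000 * (real n + 1)) * E^9" by (rule mult_right_mono) (use E1 in auto)
    finally show ?thesis by linarith
  qed
  finally have 1: "(\<Sum>A=1..?m. ?t A)
     \<le> 2^16 * K * E^8 / b + 2^28 * E^12 / b + 50000 * (real n + 1) * E^9" .
  have "(2 * sqrt K + 1) * (4096 * E^12 / (real b)\<^sup>2 + 1) \<le> 3 * E^3 * (4096 * E^12 / (real b)\<^sup>2 + 1)"
    using s3 E1 by (intro mult_right_mono) auto
  also have "\<dots> = 12288 * E^15 / (real b)\<^sup>2 + 3 * E^3" by (simp add: field_simps eval_nat_numeral)
  finally have 0: "(2 * sqrt K + 1) * (4096 * E^12 / (real b)\<^sup>2 + 1) \<le> 12288 * E^15 / (real b)\<^sup>2 + 3 * E^3" .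
  have "2 * (2^16 * K * E^8 / b + 2^28 * E^12 / b + 50000 * (real n + 1) * E^9)
     = 2^17 * K * E^8 / b + 2^29 * E^12 / b + 100000 * (real n + 1) * E^9" by (simp add: algebra_simps)
  note eq = this
  have "(2 * sqrt K + 1) * (4096 * E^12 / (real b)\<^sup>2 + 1) + 2 * (\<Sum>A=1..?m. ?t A)
    \<le> (12288 * E^15 / (real b)\<^sup>2 + 3 * E^3) + 2 * (2^16 * K * E^8 / b + 2^28 * E^12 / b + 50000 * (real n + 1) * E^9)"
    by (intro add_mono[OF 0] mult_left_mono[OF 1]) simp
  then show ?thesis unfolding eq by (simp only: add_ac)
qed

lemma arc_term_expansion:
  fixes b w c X Y Z V :: real
  assumes "b > 0"
  shows "(b * w + 3) * (c / b) + 3 * (1 + w) * b * (X / b + Y + Z / b\<^sup>2 + V)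
    = c * w + (3 * c) * (1 / b) + 3 * (1 + w) * X + 3 * (1 + w) * (Y + V) * b + 3 * (1 + w) * Z * (1 / b)"
proof -
  define t where "t = 1 / b"
  have "(b * w + 3) * (c / b) = c * w + 3 * c * t" using assms by (simp add: t_def field_simps)
  moreover have "b * (X / b + Y + Z / b\<^sup>2 + V) = X + (Y + V) * b + Z * t"
    using assms by (simp add: t_def distrib_left distrib_right power2_eq_square)
  then have "3 * (1 + w) * b * (X / b + Y + Z / b\<^sup>2 + V) = 3 * (1 + w) * (X + (Y + V) * b + Z * t)"
    by (simp only: mult.assoc)
  ultimately show ?thesis unfolding t_def[symmetric] by (simp only:) (simp add: algebra_simps)
qed

text \<open>A denominator b has at most b w + 3 numerators. The part b w cancels the 1/b of the main
  term, so E^4 denominators yield w K E^12. The largest error is E^9 (n+1) against the sum of all b,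
  at most E^8: hence E^17.\<close>

lemma sum_arcs_bound:
  fixes n :: nat and K E w :: real
  assumes K: "0 \<le> K" "K \<le> E^6" and E: "E = 2^n" and w: "w \<ge> 0"
  shows "(\<Sum>b=1..2^(4*n). (real b * w + 3) *
      (2^17 * K * E^8 / b + (2^29 * E^12 / b + 100000 * (real n + 1) * E^9 + 12288 * E^15 / (real b)\<^sup>2 + 3 * E^3)))
     \<le> 2^17 * w * K * E^12 + 2^31 * (1 + w) * (real n + 1) * E^17"
proof -
  let ?B = "2^(4*n) :: nat"
  have E1: "E \<ge> 1" unfolding E by simp
  have B: "real ?B = E^4" unfolding E by (simp add: power_mult[symmetric] mult.commute)
  have inv: "(\<Sum>b=1..?B. 1 / real b) \<le> 4 * real n + 1" using sum_inverse_le[of "4*n"] by simp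
  have sq: "(\<Sum>b=1..?B. real b) \<le> E^8" using sum_le_square[of ?B] unfolding B by (simp flip: power_mult)
  have "(real b * w + 3) * (2^17 * K * E^8 / b + (2^29 * E^12 / b + 100000 * (real n + 1) * E^9 + 12288 * E^15 / (real b)\<^sup>2 + 3 * E^3))
     \<le> 2^17 * K * E^8 * w + (3 * (2^17 * K * E^8)) * (1 / real b)
        + 3 * (1 + w) * (2^29 * E^12) + 3 * (1 + w) * (100000 * (real n + 1) * E^9 + 3 * E^3) * real b
        + 3 * (1 + w) * (12288 * E^15) * (1 / real b)" if b: "b \<in> {1..?B}" for b
  proof -
    have b1: "real b \<ge> 1" using b by simp
    have le: "real b * w + 3 \<le> 3 * (1 + w) * real b"
    proof -
      have "w * real b \<ge> 0" using w by simp
      moreover have "3 * (1 + w) * real b - (real b * w + 3) = 3 * (real b - 1) + 2 * (w * real b)"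
        by (simp add: algebra_simps)
      ultimately have "0 \<le> 3 * (1 + w) * real b - (real b * w + 3)" using b1 by simp
      then show ?thesis by (simp only: diff_ge_0_iff_ge)
    qed
    let ?R = "2^29 * E^12 / b + 100000 * (real n + 1) * E^9 + 12288 * E^15 / (real b)\<^sup>2 + 3 * E^3"
    have e1: "(real b * w + 3) * (2^17 * K * E^8 / b + ?R) = (real b * w + 3) * (2^17 * K * E^8 / b) + (real b * w + 3) * ?R"
      by (rule distrib_left)
    have e2: "(real b * w + 3) * ?R \<le> 3 * (1 + w) * real b * ?R"
      by (rule mult_right_mono[OF le]) (use E1 in auto)
    have e3: "(real b * w + 3) * (2^17 * K * E^8 / b) + 3 * (1 + w) * real b * ?R =
       2^17 * K * E^8 * w + (3 * (2^17 * K * E^8)) * (1 / real b)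
        + 3 * (1 + w) * (2^29 * E^12) + 3 * (1 + w) * (100000 * (real n + 1) * E^9 + 3 * E^3) * real b
        + 3 * (1 + w) * (12288 * E^15) * (1 / real b)"
      by (rule arc_term_expansion) (use b1 in simp)
    show ?thesis unfolding e1 e3[symmetric] by (rule add_left_mono[OF e2])
  qed
  then have "(\<Sum>b=1..?B. (real b * w + 3) *
      (2^17 * K * E^8 / b + (2^29 * E^12 / b + 100000 * (real n + 1) * E^9 + 12288 * E^15 / (real b)\<^sup>2 + 3 * E^3)))
    \<le> (\<Sum>b=1..?B. 2^17 * K * E^8 * w + (3 * (2^17 * K * E^8)) * (1 / real b)
        + 3 * (1 + w) * (2^29 * E^12) + 3 * (1 + w) * (100000 * (real n + 1) * E^9 + 3 * E^3) * real b
        + 3 * (1 + w) * (12288 * E^15) * (1 / real b))" by (intro sum_mono) blast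
  also have "\<dots> = 2^17 * K * E^8 * w * real ?B + (3 * (2^17 * K * E^8)) * (\<Sum>b=1..?B. 1 / real b)
        + 3 * (1 + w) * (2^29 * E^12) * real ?B + 3 * (1 + w) * (100000 * (real n + 1) * E^9 + 3 * E^3) * (\<Sum>b=1..?B. real b)
        + 3 * (1 + w) * (12288 * E^15) * (\<Sum>b=1..?B. 1 / real b)"
    by (simp only: sum.distrib sum_distrib_left[symmetric], simp)
  also have "\<dots> \<le> 2^17 * K * E^8 * w * E^4 + (3 * (2^17 * E^6 * E^8)) * (4 * real n + 1)
        + 3 * (1 + w) * (2^29 * E^12) * E^4 + 3 * (1 + w) * (100000 * (real n + 1) * E^9 + 3 * E^3) * E^8
        + 3 * (1 + w) * (12288 * E^15) * (4 * real n + 1)"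
    unfolding B
    by (intro add_mono mult_mono mult_left_mono inv sq) (use K w E1 in \<open>auto intro!: sum_nonneg\<close>)
  also have "\<dots> \<le> 2^17 * w * K * E^12 + 2^31 * (1 + w) * (real n + 1) * E^17"
  proof -
    let ?X = "(1 + w) * (real n + 1) * E^17"
    have p: "(c::real) * E^i \<le> c * E^17" if "i \<le> 17" "c \<ge> 0" for i c
      using E1 that by (intro mult_left_mono power_increasing) auto
    have "(3 * (2^17 * E^6 * E^8)) * (4 * real n + 1) = (3 * 2^17 * (4 * real n + 1)) * E^14" by (simp add: algebra_simps power_add[symmetric])
    also have "\<dots> \<le> (3 * 2^17 * (4 * real n + 1)) * E^17" by (rule p) auto
    also have "\<dots> \<le> (3 * 2^19 * ((1 + w) * (real n + 1))) * E^17"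
    proof (rule mult_right_mono)
      have "4 * real n + 1 \<le> 4 * (1 * (real n + 1))" by simp
      also have "\<dots> \<le> 4 * ((1 + w) * (real n + 1))" using w by (intro mult_left_mono mult_right_mono) auto
      finally show "3 * 2^17 * (4 * real n + 1) \<le> 3 * 2^19 * ((1 + w) * (real n + 1))" by simp
    qed (use E1 in auto)
    finally have 1: "(3 * (2^17 * E^6 * E^8)) * (4 * real n + 1) \<le> (3 * 2^19) * ?X" by (simp add: mult.assoc)
    have "3 * (1 + w) * (2^29 * E^12) * E^4 = (3 * 2^29 * (1 + w)) * E^16" by (simp add: algebra_simps power_add[symmetric])
    also have "\<dots> \<le> (3 * 2^29 * (1 + w)) * E^17" by (rule p) (use w in auto)
    also have "\<dots> \<le> (3 * 2^29 * ((1 + w) * (real n + 1))) * E^17"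
      by (rule mult_right_mono) (use w E1 in \<open>auto simp: algebra_simps\<close>)
    finally have 2: "3 * (1 + w) * (2^29 * E^12) * E^4 \<le> (3 * 2^29) * ?X" by (simp add: mult.assoc)
    have "3 * (1 + w) * (100000 * (real n + 1) * E^9 + 3 * E^3) * E^8
       = (300000 * ((1 + w) * (real n + 1))) * E^17 + (9 * (1 + w)) * E^11"
      by (simp add: algebra_simps power_add[symmetric])
    also have "(9 * (1 + w)) * E^11 \<le> (9 * (1 + w)) * E^17" by (rule p) (use w in auto)
    also have "\<dots> \<le> (9 * ((1 + w) * (real n + 1))) * E^17"
      by (rule mult_right_mono) (use w E1 in \<open>auto simp: algebra_simps\<close>)
    finally have 3: "3 * (1 + w) * (100000 * (real n + 1) * E^9 + 3 * E^3) * E^8 \<le> 300009 * ?X" by (simp add: mult.assoc)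
    have "3 * (1 + w) * (12288 * E^15) * (4 * real n + 1) = (36864 * (1 + w) * (4 * real n + 1)) * E^15"
      by (simp add: algebra_simps)
    also have "\<dots> \<le> (36864 * (1 + w) * (4 * real n + 1)) * E^17" by (rule p) (use w in auto)
    also have "\<dots> \<le> (36864 * (1 + w) * (4 * (real n + 1))) * E^17"
      by (intro mult_right_mono mult_left_mono) (use w E1 in auto)
    also have "\<dots> = 147456 * ?X" by (simp add: algebra_simps)
    finally have 4: "3 * (1 + w) * (12288 * E^15) * (4 * real n + 1) \<le> 147456 * ?X" .
    define X where "X = ?X"
    have X: "X \<ge> 0" using w E1 by (simp add: X_def)
    have 5: "2^17 * K * E^8 * w * E^4 = 2^17 * w * K * E^12" by (simp add: power_add[symmetric])
    have 6: "2^31 * (1 + w) * (real n + 1) * E^17 = 2^31 * ?X" by simp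
    note add_mono[OF add_mono[OF add_mono[OF add_mono[OF eq_refl[OF 5] 1] 2] 3] 4, folded X_def]
    also have "2^17 * w * K * E^12 + 3 * 2^19 * X + 3 * 2^29 * X + 300009 * X + 147456 * X
      = 2^17 * w * K * E^12 + 1612633065 * X" by simp
    also have "\<dots> \<le> 2^17 * w * K * E^12 + 2^31 * X" using X by simp
    finally show ?thesis unfolding 6 X_def .
  qed
  finally show ?thesis .
qed

definition near_triples :: "nat \<Rightarrow> real \<Rightarrow> real \<Rightarrow> real \<Rightarrow> (int \<times> int \<times> int) set" where
  "near_triples n K \<alpha> \<beta> = {(q, p, r). 4096^n \<le> q \<and> q < 4096^Suc n \<and>
     \<alpha> * of_int q \<le> of_int p \<and> of_int p \<le> \<beta> * of_int q \<and> \<bar>of_int (p\<^sup>2 - q * r)\<bar> \<le> K}"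

text \<open>The first term is the heuristic count: about w N^2 pairs (q, p) with N = 4096^n, each
  admitting an r with chance about K/N. The triples are fibred over the Dirichlet fraction a/b of
  p/q, with |b p/q - a| < E^(-4), and each fibre is an instance of \<open>card_arc\<close>.\<close>

lemma near_triples_card:
  assumes K: "0 \<le> K" "K \<le> 2^(6*n)" and w: "\<alpha> \<le> \<beta>"
  shows "finite (near_triples n K \<alpha> \<beta>)"
    and "real (card (near_triples n K \<alpha> \<beta>)) \<le> 2^17 * (\<beta> - \<alpha>) * K * 4096^n
      + 2^31 * (1 + (\<beta> - \<alpha>)) * (real n + 1) * 2^(17*n)"
proof -
  define S where "S = near_triples n K \<alpha> \<beta>"
  define E :: real where "E = 2^n"
  have E1: "E \<ge> 1" by (simp add: E_def)
  have EN: "E^12 = 4096^n" unfolding E_def by (simp flip: power_mult add: mult.commute[of n]) (simp add: power_mult)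
  have KE: "K \<le> E^6" using K by (simp add: E_def power_mult[symmetric] mult.commute)
  let ?B = "2^(4*n) :: nat"
  have B: "real ?B = E^4" unfolding E_def by (simp add: power_mult[symmetric] mult.commute)
  have S: "E^12 \<le> of_int q" "of_int q \<le> 4096 * E^12" "\<alpha> * of_int q \<le> of_int p" "of_int p \<le> \<beta> * of_int q"
    "\<bar>of_int (p\<^sup>2 - q * r)\<bar> \<le> K" "q > 0" if "(q, p, r) \<in> S" for q p r
  proof -
    have q: "4096^n \<le> q" "q < 4096^Suc n" and *: "\<alpha> * of_int q \<le> of_int p" "of_int p \<le> \<beta> * of_int q"
    "\<bar>of_int (p\<^sup>2 - q * r)\<bar> \<le> K" using that by (auto simp: S_def near_triples_def)
    have "real_of_int (4096^n) \<le> of_int q" "real_of_int q \<le> of_int (4096^Suc n)"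
      using q unfolding of_int_le_iff by auto
    then show "E^12 \<le> of_int q" "of_int q \<le> 4096 * E^12" by (auto simp: EN)
    have "(0::int) < 4096^n" by simp
    then show "q > 0" using q by linarith
  qed (use that in \<open>auto simp: S_def near_triples_def\<close>)
  have "\<exists>a b. coprime a b \<and> 0 < b \<and> b \<le> int ?B \<and> \<bar>of_int b * (of_int p / of_int q) - of_int a\<bar> < 1 / ?B" for p q :: int
  proof -
    have "?B > 0" by simp
    from Dirichlet_approx_coprime[OF this, of "of_int p / of_int q"] show ?thesis by metis
  qed
  then obtain fa fb where f: "\<And>p q. coprime (fa p q) (fb p q) \<and> 0 < fb p q \<and> fb p q \<le> int ?B \<and>
      \<bar>of_int (fb p q) * (of_int p / of_int q) - of_int (fa p q)\<bar> < 1 / ?B" by metis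
  define f where "f = (\<lambda>(q, p, r::int). (nat (fb p q), fa p q))"
  define U where "U = (\<lambda>b. {a::int. real b * \<alpha> - 1 \<le> of_int a \<and> of_int a \<le> real b * \<beta> + 1})"
  define T where "T = (SIGMA b:{1..?B}. U b)"
  define G where "G = (\<lambda>b::nat. 2^17 * K * E^8 / b + (2^29 * E^12 / b + 100000 * (real n + 1) * E^9 + 12288 * E^15 / (real b)\<^sup>2 + 3 * E^3))"
  have G0: "G b \<ge> 0" for b using E1 K by (simp add: G_def)
  have U: "finite (U b) \<and> real (card (U b)) \<le> real b * (\<beta> - \<alpha>) + 3" for b
  proof -
    have L: "of_int (x - y) \<le> real b * (\<beta> - \<alpha>) + 2" if "x \<in> U b" "y \<in> U b" for x y
      using that by (simp add: U_def algebra_simps)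
    have "finite (U b)" by (rule card_congruent_ints(1)[OF _ _ L, of 1]) auto
    moreover have "real (card (U b)) \<le> (real b * (\<beta> - \<alpha>) + 2) / of_int 1 + 1"
      by (rule card_congruent_ints(2)[OF _ _ L]) (use w in auto)
    ultimately show ?thesis by simp
  qed
  have fT: "f ` S \<subseteq> T"
  proof
    fix y assume "y \<in> f ` S"
    then obtain q p r where x: "(q, p, r) \<in> S" and y: "y = (nat (fb p q), fa p q)"
      by (auto simp: f_def)
    define b where "b = nat (fb p q)"
    have b: "int b = fb p q" "1 \<le> b" "b \<le> ?B" using f[of p q] by (auto simp: b_def nat_le_iff)
    have qp: "real_of_int q > 0" using S[OF x] by simp
    have "\<bar>of_int (fb p q) * (of_int p / of_int q) - of_int (fa p q)\<bar> < 1 / real ?B" using f[of p q] by auto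
    also have "1 / real ?B \<le> 1" unfolding B using E1 by simp
    finally have d: "\<bar>real b * (of_int p / of_int q) - of_int (fa p q)\<bar> < 1" using b(1) by (metis of_int_of_nat_eq)
    have "\<alpha> \<le> of_int p / of_int q" "of_int p / of_int q \<le> \<beta>" using S[OF x] qp by (auto simp: field_simps)
    then have "real b * \<alpha> \<le> real b * (of_int p / of_int q)" "real b * (of_int p / of_int q) \<le> real b * \<beta>"
      by (intro mult_left_mono; simp)+
    then have "fa p q \<in> U b" using d unfolding U_def by auto
    then show "y \<in> T" using b y by (auto simp: T_def b_def)
  qed
  have fib: "finite {x\<in>S. f x = y} \<and> real (card {x\<in>S. f x = y}) \<le> G (fst y)" if y: "y \<in> T" for y
  proof (cases "{x\<in>S. f x = y} = {}")
    case True then show ?thesis using G0 by (metis card.empty finite.emptyI of_nat_0)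
  next
    case False
    then obtain q0 p0 r0 where 0: "(q0, p0, r0) \<in> S" "f (q0, p0, r0) = y" by auto
    define a where "a = snd y"
    define b where "b = int (fst y)"
    have ab: "coprime a b" "b > 0" "b \<le> int ?B" using 0 f[of p0 q0] by (auto simp: f_def a_def b_def)
    have bB: "real_of_int b \<le> E^4" using ab(3) unfolding B[symmetric] by (metis of_int_le_iff of_int_of_nat_eq)
    define R where "R = (2 * sqrt K + 1) * (4096 * E^12 / (of_int b)\<^sup>2 + 1)
     + 2 * (\<Sum>A=1..2^(4*n+14). (2 * sqrt (4096 * E^12 * real A) / of_int b + 2 * sqrt K + 1) * (2 * K / real A + 1))"
    have "finite {x\<in>S. f x = y} \<and> real (card {x\<in>S. f x = y}) \<le> R"
      unfolding R_def
    proof (rule card_arc[OF ab(2) ab(1)])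
      fix q p r assume x: "(q, p, r) \<in> {x\<in>S. f x = y}"
      then have xS: "(q, p, r) \<in> S" by simp
      have e: "fa p q = a" "fb p q = b" using x f[of p q] by (auto simp: f_def a_def b_def)
      have qp: "real_of_int q > 0" using S[OF xS] by simp
      let ?A = "q * a\<^sup>2 - 2 * p * a * b + r * b\<^sup>2"
      have "\<bar>of_int b * (of_int p / of_int q) - of_int a\<bar> < 1 / E^4" using f[of p q] e B by auto
      then have d: "\<bar>of_int (q * a - p * b)\<bar> \<le> of_int q / E^4"
      proof -
        have "of_int (q * a - p * b) = - (of_int q * (of_int b * (of_int p / of_int q) - of_int a) :: real)"
          using qp by (simp add: field_simps)
        then have "\<bar>of_int (q * a - p * b)\<bar> = of_int q * \<bar>of_int b * (of_int p / of_int q) - of_int a :: real\<bar>"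
          using qp by (simp add: abs_mult)
        also have "\<dots> \<le> of_int q * (1 / E^4)"
          using qp \<open>\<bar>of_int b * (of_int p / of_int q) - of_int a\<bar> < 1 / E^4\<close> by (intro mult_left_mono) auto
        finally show ?thesis by simp
      qed
      have k: "q * ?A = (q * a - p * b)\<^sup>2 - (p\<^sup>2 - q * r) * b\<^sup>2"
        by (simp add: algebra_simps power2_eq_square)
      have "of_int q * \<bar>real_of_int ?A\<bar> = \<bar>real_of_int (q * ?A)\<bar>" using qp by (simp add: abs_mult)
      also have "\<dots> = \<bar>(of_int (q * a - p * b))\<^sup>2 - of_int (p\<^sup>2 - q * r) * (of_int b)\<^sup>2\<bar>"
        unfolding k by simp
      also have "\<dots> \<le> \<bar>(of_int (q * a - p * b))\<^sup>2\<bar> + \<bar>of_int (p\<^sup>2 - q * r) * (of_int b)\<^sup>2\<bar>"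
        by (rule abs_triangle_ineq4)
      also have "\<dots> = \<bar>of_int (q * a - p * b)\<bar>^2 + \<bar>of_int (p\<^sup>2 - q * r)\<bar> * (of_int b)\<^sup>2"
        by (simp only: abs_mult abs_power2 power2_abs)
      \<comment> \<open>Dirichlet gives |q a - p b| <= q / E^4, and b <= E^4. After division by q,
        which lies between E^12 and 4096 E^12, the first term is at most 4096 E^4 and the second at
        most E^2: the range 2^14 E^4 for the values.\<close>
      also have "\<dots> \<le> (of_int q / E^4)^2 + E^6 * (E^4)\<^sup>2"
        by (intro add_mono mult_mono power_mono) (use d S(5)[OF xS] KE bB E1 ab in auto)
      also have "\<dots> = of_int q * (of_int q / E^8) + E^14"
        by (simp add: power2_eq_square power_add[symmetric])
      also have "\<dots> \<le> of_int q * (4096 * E^12 / E^8) + of_int q * E\<^sup>2"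
      proof (intro add_mono mult_left_mono divide_right_mono)
        have "E^14 = E^12 * E\<^sup>2" by (simp add: power_add[symmetric])
        also have "\<dots> \<le> of_int q * E\<^sup>2" using S[OF xS] by (intro mult_right_mono) auto
        finally show "E^14 \<le> of_int q * E\<^sup>2" .
      qed (use S[OF xS] E1 in auto)
      also have "\<dots> = of_int q * (4096 * E^4 + E\<^sup>2)" using E1 by (simp add: field_simps power_add[symmetric])
      also have "\<dots> \<le> of_int q * (2^14 * E^4)"
      proof -
        have "E\<^sup>2 \<le> E^4" using E1 by (intro power_increasing) auto
        moreover have "E^4 \<ge> 0" using E1 by simp
        moreover have "2^14 * E^4 = 16384 * E^4" by simp
        ultimately have "4096 * E^4 + E\<^sup>2 \<le> 2^14 * E^4" by linarith
        then show ?thesis using qp by (intro mult_left_mono) auto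
      qed
      finally have "\<bar>real_of_int ?A\<bar> \<le> 2^14 * E^4" using qp by simp
      also have "2^14 * E^4 = real_of_int (int (2^(4*n+14)))"
        unfolding E_def by (simp add: power_add power_mult[symmetric] mult.commute)
      finally have A: "\<bar>?A\<bar> \<le> int (2^(4*n+14))" by (metis of_int_abs of_int_le_iff)
      show "E^12 \<le> of_int q \<and> of_int q \<le> 4096 * E^12 \<and>
        \<bar>of_int (p\<^sup>2 - q * r)\<bar> \<le> K \<and> \<bar>q * a\<^sup>2 - 2 * p * a * b + r * b\<^sup>2\<bar> \<le> int (2^(4*n+14))"
        using S[OF xS] A by blast
    qed (use E1 K in auto)
    moreover have "R \<le> G (fst y)"
      unfolding R_def G_def b_def of_int_of_nat_eq
      by (rule arc_bound) (use ab K KE in \<open>auto simp: b_def E_def\<close>)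
    ultimately show ?thesis by auto
  qed
  have "finite S \<and> real (card S) \<le> (\<Sum>y\<in>T. G (fst y))"
    by (rule card_le_sum_fibres[OF _ fT fib]) (auto simp: T_def U)
  moreover have "(\<Sum>y\<in>T. G (fst y)) = (\<Sum>b=1..?B. real (card (U b)) * G b)"
  proof -
    have "(\<Sum>y\<in>T. G (fst y)) = (\<Sum>(b, a)\<in>T. G b)" by (simp add: case_prod_beta)
    also have "\<dots> = (\<Sum>b=1..?B. \<Sum>a\<in>U b. G b)"
      unfolding T_def by (rule sum.Sigma[symmetric]) (use U in auto)
    finally show ?thesis by simp
  qed
  moreover have "\<dots> \<le> (\<Sum>b=1..?B. (real b * (\<beta> - \<alpha>) + 3) * G b)"
    by (intro sum_mono mult_right_mono) (use U G0 in auto)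
  moreover have "\<dots> \<le> 2^17 * (\<beta> - \<alpha>) * K * E^12 + 2^31 * (1 + (\<beta> - \<alpha>)) * (real n + 1) * E^17"
    unfolding G_def by (rule sum_arcs_bound) (use K KE w in \<open>auto simp: E_def\<close>)
  ultimately have fin: "finite S" and
    le: "real (card S) \<le> 2^17 * (\<beta> - \<alpha>) * K * E^12 + 2^31 * (1 + (\<beta> - \<alpha>)) * (real n + 1) * E^17"
    by (blast, linarith)
  have E17: "E^17 = 2^(17*n)" unfolding E_def by (simp add: power_mult[symmetric] mult.commute)
  show "finite (near_triples n K \<alpha> \<beta>)" using fin unfolding S_def .
  show "real (card (near_triples n K \<alpha> \<beta>)) \<le> 2^17 * (\<beta> - \<alpha>) * K * 4096^n
      + 2^31 * (1 + (\<beta> - \<alpha>)) * (real n + 1) * 2^(17*n)"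
    using le unfolding S_def EN E17 .
qed

section \<open>Convergence for the parabola\<close>

definition parabola_approximable :: "(real \<Rightarrow> real) \<Rightarrow> real set" where
  "parabola_approximable \<psi> = {t. infinite {q::nat. q \<ge> 1 \<and>
     (\<exists>(p::int) (r::int). \<bar>real q * t - p\<bar> < \<psi> (real q) \<and> \<bar>real q * t\<^sup>2 - r\<bar> < \<psi> (real q))}}"

lemma block_of_nat:
  fixes q :: nat assumes "q \<ge> 1"
  obtains n where "4096^n \<le> q" "q < 4096^Suc n"
proof -
  have ex: "\<exists>n. q < 4096^n" by (rule exI[of _ q]) (rule less_exp[THEN less_le_trans], simp add: power_mono)
  define m where "m = (LEAST n. q < 4096^n)"
  have m: "q < 4096^m" unfolding m_def using ex by (rule LeastI_ex)
  have "m \<noteq> 0" using m assms by (cases m) auto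
  then obtain n where n: "m = Suc n" by (cases m) auto
  have "\<not> q < 4096^n" using not_less_Least[of n "\<lambda>n. q < 4096^n"] n by (simp add: m_def)
  then show ?thesis using that[of n] m n by auto
qed

text \<open>With errors e = q x - p and e' = q x^2 - r the defect is q e' - e (2 q x - e): linear in
  the errors up to e^2, with coefficients of size q.\<close>

lemma conic_defect:
  fixes x q p r :: real
  assumes q: "q > 0" and a: "\<bar>q * x - p\<bar> \<le> d" "\<bar>q * x\<^sup>2 - r\<bar> \<le> d" and T: "\<bar>x\<bar> \<le> T" and d: "d \<le> q"
  shows "\<bar>p\<^sup>2 - q * r\<bar> \<le> q * d * (2 * T + 2)"
proof -
  have d0: "d \<ge> 0" using a by linarith
  have "p\<^sup>2 - q * r = q * (q * x\<^sup>2 - r) - (q * x - p) * (2 * (q * x) - (q * x - p))"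
    by (simp add: algebra_simps power2_eq_square)
  then have "\<bar>p\<^sup>2 - q * r\<bar> \<le> \<bar>q * (q * x\<^sup>2 - r)\<bar> + \<bar>(q * x - p) * (2 * (q * x) - (q * x - p))\<bar>"
    by (metis abs_triangle_ineq4)
  also have "\<dots> = q * \<bar>q * x\<^sup>2 - r\<bar> + \<bar>q * x - p\<bar> * \<bar>2 * (q * x) - (q * x - p)\<bar>"
    using q by (simp add: abs_mult)
  also have "\<dots> \<le> q * d + d * (2 * (q * T) + q)"
  proof (intro add_mono mult_mono)
    have "\<bar>q * x\<bar> \<le> q * T" using q T by (simp add: abs_mult)
    then show "\<bar>2 * (q * x) - (q * x - p)\<bar> \<le> 2 * (q * T) + q" using a(1) d by linarith
  qed (use a q d0 in auto)
  also have "\<dots> = q * d * (2 * T + 2)" by (simp add: algebra_simps)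
  finally show ?thesis .
qed

lemma measure_UN_intervals_le:
  fixes S :: "'a set" and c :: "'a \<Rightarrow> real"
  assumes "finite S" "r \<ge> 0"
  shows "(\<Union>s\<in>S. {c s - r..c s + r}) \<in> fmeasurable lborel"
    "measure lborel (\<Union>s\<in>S. {c s - r..c s + r}) \<le> real (card S) * (2 * r)"
proof -
  show "(\<Union>s\<in>S. {c s - r..c s + r}) \<in> fmeasurable lborel"
    using assms by (intro fmeasurable.finite_UN) (auto simp: fmeasurable_def)
  have "measure lborel (\<Union>s\<in>S. {c s - r..c s + r}) \<le> (\<Sum>s\<in>S. measure lborel {c s - r..c s + r})"
    using assms by (intro measure_UNION_le) auto
  also have "\<dots> = real (card S) * (2 * r)" using assms by simp
  finally show "measure lborel (\<Union>s\<in>S. {c s - r..c s + r}) \<le> real (card S) * (2 * r)" .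
qed

text \<open>In block n the relevant p/q have defect of order \<open>\<delta>\<close> N and carry
  intervals of radius \<open>\<delta>\<close>/N. Count times length gives a multiple of N
  \<open>\<delta>\<close>^2, the term of the condensed series, plus an error of order (n+1)
  2^(-n).\<close>

lemma parabola_null_bounded:
  fixes T :: nat
  assumes anti: "antimono_on {0<..} \<psi>" and sm: "summable (\<lambda>n. 4096^n * (\<psi> (4096^n))\<^sup>2)"
  shows "negligible (parabola_approximable \<psi> \<inter> {- real T..real T})"
proof -
  define N where "N = (\<lambda>n::nat. (4096::real)^n)"
  have N1: "N n \<ge> 1" for n by (simp add: N_def)
  \<comment> \<open>The second entry makes \<open>\<delta>\<close> positive whatever the sign of
    \<open>\<psi>\<close>, and contributes only N \<open>\<delta>\<close>^2 = 1/(n+1)^2.\<close>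
  define \<delta> where "\<delta> = (\<lambda>n. max (\<psi> (N n)) (1 / (64^n * (real n + 1))))"
  have dpos: "\<delta> n > 0" for n by (simp add: \<delta>_def less_max_iff_disj)
  have N64: "N n = 64^n * 64^n" for n unfolding N_def by (simp flip: power_mult_distrib)
  have d2: "N n * (\<delta> n)\<^sup>2 \<le> N n * (\<psi> (N n))\<^sup>2 + 1 / (real n + 1)^2" for n
  proof -
    have "N n * (1 / (64^n * (real n + 1)))\<^sup>2 = 1 / (real n + 1)^2"
      by (simp add: N64 power2_eq_square)
    moreover have "(\<delta> n)\<^sup>2 = (\<psi> (N n))\<^sup>2 \<or> (\<delta> n)\<^sup>2 = (1 / (64^n * (real n + 1)))\<^sup>2"
      by (auto simp: \<delta>_def max_def)
    moreover have "N n * (\<psi> (N n))\<^sup>2 \<ge> 0" using N1[of n] by simp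
    ultimately show ?thesis by auto
  qed
  have s2: "summable (\<lambda>n. N n * (\<delta> n)\<^sup>2)"
  proof (rule summable_comparison_test_ev)
    show "summable (\<lambda>n. N n * (\<psi> (N n))\<^sup>2 + 1 / (real n + 1)^2)"
      using inverse_power_summable[of 2, where 'a=real] sm unfolding N_def
      by (intro summable_add) (auto simp: inverse_eq_divide summable_Suc_iff[of "\<lambda>n. 1 / (real n)^2", symmetric] add.commute)
    show "\<forall>\<^sub>F n in sequentially. norm (N n * (\<delta> n)\<^sup>2) \<le> N n * (\<psi> (N n))\<^sup>2 + 1 / (real n + 1)^2"
      using d2 N1 by (auto intro!: always_eventually simp: abs_mult N_def)
  qed
  have lim: "(\<lambda>n. 64^n * \<delta> n) \<longlonglongrightarrow> 0"
  proof -
    have "(\<lambda>n. sqrt (N n * (\<delta> n)\<^sup>2)) \<longlonglongrightarrow> sqrt 0"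
      by (intro tendsto_real_sqrt summable_LIMSEQ_zero[OF s2])
    moreover have "sqrt (N n * (\<delta> n)\<^sup>2) = 64^n * \<delta> n" for n
      using dpos[of n] by (simp add: N64 real_sqrt_mult)
    ultimately show ?thesis by simp
  qed
  \<comment> \<open>4096 is the ratio between the ends of a block, 2 T + 2 the constant of
    \<open>conic_defect\<close>.\<close>
  define c where "c = 4096 * (2 * real T + 2)"
  have c1: "c \<ge> 1" by (simp add: c_def)
  \<comment> \<open>This puts K n = c \<open>\<delta>\<close> N below 64^n = 2^(6n), the range in
    which the count is valid. Levels before \<open>n0\<close> are discarded, since a limsup does not
    see them.\<close>
  have "\<forall>\<^sub>F n in sequentially. 64^n * \<delta> n < 1 / c"
    using order_tendstoD(2)[OF lim, of "1 / c"] c1 by auto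
  then obtain n0 where n0: "\<And>n. n \<ge> n0 \<Longrightarrow> 64^n * \<delta> n < 1 / c"
    by (auto simp: eventually_sequentially)
  define K where "K = (\<lambda>n. c * \<delta> n * N n)"
  define S where "S = (\<lambda>n. near_triples n (K n) (- real T - 1) (real T + 1))"
  define C where "C = (\<lambda>n. if n < n0 then {} else
     (\<Union>s\<in>S n. {of_int (fst (snd s)) / of_int (fst s) - \<delta> n / N n..of_int (fst (snd s)) / of_int (fst s) + \<delta> n / N n}))"
  have d1: "64^n * \<delta> n \<le> 1" "\<delta> n \<le> 1" if "n \<ge> n0" for n
  proof -
    show 1: "64^n * \<delta> n \<le> 1" using n0[OF that] c1 by (smt (verit) divide_le_eq_1_pos)
    have "1 * \<delta> n \<le> 64^n * \<delta> n" using dpos[of n] by (intro mult_right_mono) auto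
    then show "\<delta> n \<le> 1" using 1 by simp
  qed
  have K: "0 \<le> K n" "K n \<le> 2^(6*n)" if "n \<ge> n0" for n
  proof -
    show "0 \<le> K n" using c1 dpos[of n] N1[of n] by (simp add: K_def)
    have "K n = c * (64^n * \<delta> n) * 64^n" by (simp add: K_def N64)
    also have "\<dots> \<le> c * (1 / c) * 64^n" using n0[OF that] c1 by (intro mult_right_mono mult_left_mono) auto
    also have "\<dots> = 2^(6*n)" using c1 by (simp add: power_mult)
    finally show "K n \<le> 2^(6*n)" .
  qed
  have fin: "finite (S n)" and
    card: "real (card (S n)) \<le> 2^17 * (2 * real T + 2) * K n * N n + 2^31 * (2 * real T + 3) * (real n + 1) * 2^(17*n)"
    if "n \<ge> n0" for n
    using near_triples_card[OF K[OF that], of "- real T - 1" "real T + 1"]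
    unfolding S_def N_def by (auto simp: algebra_simps)
  have Cm: "C n \<in> fmeasurable lborel" for n
    using measure_UN_intervals_le(1)[OF fin, of n "\<delta> n / N n"] dpos[of n] N1[of n]
    by (auto simp: C_def)
  have Cb: "measure lborel (C n) \<le> 2^18 * (2 * real T + 2) * c * (N n * (\<delta> n)\<^sup>2)
      + 2^32 * (2 * real T + 3) * ((real n + 1) * (1/2)^n)" if n: "n \<ge> n0" for n
  proof -
    have "measure lborel (C n) \<le> real (card (S n)) * (2 * (\<delta> n / N n))"
      using measure_UN_intervals_le(2)[OF fin[OF n], of "\<delta> n / N n"] dpos[of n] N1[of n] n
      by (auto simp: C_def)
    also have "\<dots> \<le> (2^17 * (2 * real T + 2) * K n * N n + 2^31 * (2 * real T + 3) * (real n + 1) * 2^(17*n)) * (2 * (\<delta> n / N n))"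
      by (rule mult_right_mono[OF card[OF n]]) (use dpos[of n] N1[of n] in auto)
    also have "\<dots> = 2^18 * (2 * real T + 2) * c * (N n * (\<delta> n)\<^sup>2)
        + 2^32 * (2 * real T + 3) * ((real n + 1) * (2^(17*n) * \<delta> n / N n))"
      using N1[of n] by (simp add: K_def field_simps power2_eq_square)
    \<comment> \<open>Here \<open>\<delta>\<close>/N is at most 64^(-n) 4096^(-n) = 2^(-18n), one
      factor 2^(-n) better than the error of the count.\<close>
    also have "2^(17*n) * \<delta> n / N n \<le> (1/2)^n"
    proof -
      have e1: "64^n * N n = 2^(17*n) * 2^n"
        unfolding N_def by (simp add: power_mult power_mult_distrib[symmetric])
      have "2^(17*n) * \<delta> n / N n = 2^(17*n) * (64^n * \<delta> n) / (64^n * N n)" by simp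
      also have "\<dots> \<le> 2^(17*n) * 1 / (64^n * N n)"
        by (intro divide_right_mono mult_left_mono d1[OF n]) (use N1[of n] in auto)
      also have "\<dots> = 1 / 2^n" unfolding e1 by simp
      finally have "2^(17*n) * \<delta> n / N n \<le> 1 / 2^n" .
      then show ?thesis by (simp add: power_divide)
    qed
    finally show ?thesis by (simp add: mult_left_mono)
  qed
  have "summable (\<lambda>n. measure lborel (C n))"
  proof (rule summable_comparison_test_ev)
    have "summable (\<lambda>n. (real n + 1) * (1/2)^n)"
    proof -
      have "summable (\<lambda>n. of_nat (Suc n) * (1/2::real)^n)"
        using geometric_deriv_sums[of "1/2::real"] by (auto simp: sums_iff)
      then show ?thesis by (simp add: add.commute)
    qed
    then show "summable (\<lambda>n. 2^18 * (2 * real T + 2) * c * (N n * (\<delta> n)\<^sup>2)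
      + 2^32 * (2 * real T + 3) * ((real n + 1) * (1/2)^n))"
      by (intro summable_add summable_mult s2)
    show "\<forall>\<^sub>F n in sequentially. norm (measure lborel (C n)) \<le> 2^18 * (2 * real T + 2) * c * (N n * (\<delta> n)\<^sup>2)
      + 2^32 * (2 * real T + 3) * ((real n + 1) * (1/2)^n)"
      using Cb by (auto simp: eventually_sequentially intro!: exI[of _ n0])
  qed
  then have null: "limsup C \<in> null_sets lborel"
    using Cm by (intro borel_cantelli_limsup1) (auto simp: fmeasurable_def)
  have "parabola_approximable \<psi> \<inter> {- real T..real T} \<subseteq> limsup C"
  proof
    fix t assume t: "t \<in> parabola_approximable \<psi> \<inter> {- real T..real T}"
    have "t \<in> (\<Union>n\<in>{m..}. C n)" for m
    proof -
      have "infinite {q::nat. q \<ge> 1 \<and>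
     (\<exists>(p::int) (r::int). \<bar>real q * t - p\<bar> < \<psi> (real q) \<and> \<bar>real q * t\<^sup>2 - r\<bar> < \<psi> (real q))}"
        using t by (auto simp: parabola_approximable_def)
      then obtain q where q: "q \<ge> 4096^(max m n0)" "q \<ge> 1" and
        ex: "\<exists>(p::int) (r::int). \<bar>real q * t - p\<bar> < \<psi> (real q) \<and> \<bar>real q * t\<^sup>2 - r\<bar> < \<psi> (real q)"
        unfolding infinite_nat_iff_unbounded_le by blast
      from ex obtain p r :: int where pr: "\<bar>real q * t - p\<bar> < \<psi> (real q)" "\<bar>real q * t\<^sup>2 - r\<bar> < \<psi> (real q)"
        by blast
      obtain n where n: "4096^n \<le> q" "q < 4096^Suc n" using block_of_nat[OF q(2)] .
      have "(4096::nat)^(max m n0) < 4096^Suc n" using q(1) n(2) by linarith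
      then have "max m n0 < Suc n" by (rule power_less_imp_less_exp[rotated]) simp
      then have nm: "n \<ge> m" "n \<ge> n0" by auto
      have qN: "N n \<le> real q" "real q \<le> 4096 * N n"
      proof -
        have "real (4096^n) \<le> real q" "real q \<le> real (4096^Suc n)" using n by (simp_all only: of_nat_le_iff less_imp_le)
        then show "N n \<le> real q" "real q \<le> 4096 * N n" by (simp_all add: N_def)
      qed
      have q0: "real q > 0" using q by simp
      have "\<psi> (real q) \<le> \<psi> (N n)"
        using anti N1[of n] qN q0 by (auto simp: monotone_on_def)
      then have "\<psi> (real q) \<le> \<delta> n" by (simp add: \<delta>_def)
      then have pr': "\<bar>real q * t - p\<bar> \<le> \<delta> n" "\<bar>real q * t\<^sup>2 - r\<bar> \<le> \<delta> n" using pr by auto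
      have dq: "\<delta> n \<le> real q" using d1[OF nm(2)] q by (simp add: order_trans)
      have "\<bar>(real_of_int p)\<^sup>2 - real q * real_of_int r\<bar> \<le> real q * \<delta> n * (2 * real T + 2)"
        by (rule conic_defect[OF q0 pr' _ dq]) (use t in auto)
      also have "\<dots> \<le> 4096 * N n * \<delta> n * (2 * real T + 2)"
        by (intro mult_right_mono qN) (use dpos[of n] in auto)
      also have "\<dots> = K n" by (simp add: K_def c_def)
      finally have defect: "\<bar>(real_of_int p)\<^sup>2 - real q * real_of_int r\<bar> \<le> K n" .
      have "\<bar>t - p / q\<bar> = \<bar>real q * t - p\<bar> / q" using q0 by (simp add: abs_divide[symmetric] field_simps)
      also have "\<dots> \<le> \<delta> n / N n" using pr' qN N1[of n] dpos[of n] by (intro frac_le) auto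
      finally have close: "\<bar>t - p / q\<bar> \<le> \<delta> n / N n" .
      also have "\<delta> n / N n \<le> 1" using d1[OF nm(2)] N1[of n] by simp
      finally have "- real T - 1 \<le> p / q" "p / q \<le> real T + 1" using t by auto
      then have "(- real T - 1) * q \<le> p" "p \<le> (real T + 1) * q" using q0 by (simp_all add: field_simps)
      then have "(int q, p, r) \<in> S n"
        using defect n by (auto simp: S_def near_triples_def of_nat_less_iff[symmetric, where 'a=int] simp del: of_nat_less_iff
           dest!: iffD2[OF of_nat_le_iff, where 'a1=int])
      then have "t \<in> C n" using close nm by (force simp: C_def)
      then show ?thesis using nm by blast
    qed
    then show "t \<in> limsup C" by (auto simp: limsup_INF_SUP)
  qed
  then have "parabola_approximable \<psi> \<inter> {- real T..real T} \<in> null_sets lebesgue"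
    by (rule null_sets_completion_subset[OF _ null_sets_completionI[OF null]])
  then show ?thesis by (simp add: negligible_iff_null_sets)
qed

lemma parabola_null:
  assumes anti: "antimono_on {0<..} \<psi>" and sm: "summable (\<lambda>n. 4096^n * (\<psi> (4096^n))\<^sup>2)"
  shows "negligible (parabola_approximable \<psi>)"
proof -
  have "negligible (\<Union>T::nat. parabola_approximable \<psi> \<inter> {- real T..real T})"
    by (intro negligible_countable_Union[of "range _"] ) (use parabola_null_bounded[OF assms] in auto)
  moreover have "(\<Union>T::nat. parabola_approximable \<psi> \<inter> {- real T..real T}) = parabola_approximable \<psi>"
  proof -
    have "\<exists>T::nat. x \<in> {- real T..real T}" for x :: real
    proof -
      obtain T where "\<bar>x\<bar> \<le> real T" using real_arch_simple by blast
      then show ?thesis by (intro exI[of _ T]) auto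
    qed
    then show ?thesis by blast
  qed
  ultimately show ?thesis by simp
qed

section \<open>Second moments and positive density\<close>

text \<open>At the first index where the sum reaches 1, a term of at most 1 cannot carry it beyond
  2. Total mass of order 1 makes the second moment comparable with the first.\<close>

lemma exists_block_sum:
  fixes F :: "nat \<Rightarrow> real"
  assumes F: "\<And>n. 0 \<le> F n" "\<And>n. F n \<le> 1" and div: "\<not> summable F"
  obtains l where "1 \<le> sum F {k..<l}" "sum F {k..<l} \<le> 2"
proof -
  have "\<exists>l. 1 \<le> sum F {k..<l}"
  proof (rule ccontr)
    assume "\<not> ?thesis"
    then have lt: "sum F {k..<l} < 1" for l by (meson not_le)
    have "summable F"
    proof (rule summableI_nonneg_bounded[where x="sum F {..<k} + 1"])
      fix l
      have "sum F {..<l} \<le> sum F ({..<k} \<union> {k..<l})" using F by (intro sum_mono2) auto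
      also have "\<dots> = sum F {..<k} + sum F {k..<l}" by (rule sum.union_disjoint) auto
      finally show "sum F {..<l} \<le> sum F {..<k} + 1" using lt[of l] by linarith
    qed (use F in auto)
    then show False using div by blast
  qed
  define l where "l = (LEAST l. 1 \<le> sum F {k..<l})"
  have l: "1 \<le> sum F {k..<l}" unfolding l_def by (rule LeastI_ex) fact
  have "l > k" by (rule ccontr) (use l in auto)
  then obtain l' where l': "l = Suc l'" "k \<le> l'" by (cases l) auto
  have "\<not> 1 \<le> sum F {k..<l'}" using not_less_Least[of l' "\<lambda>l. 1 \<le> sum F {k..<l}"] l' by (simp add: l_def)
  then have "sum F {k..<l} \<le> 2" using l' F(2)[of l'] by simp
  then show thesis using that l by blast
qed

lemma sum_half_powers_le: "finite S \<Longrightarrow> (\<Sum>m\<in>S. (1/2::real)^nat \<bar>int m - int n\<bar>) \<le> 4"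
proof -
  assume fin: "finite S"
  have S: "S = {m\<in>S. m < n} \<union> {m\<in>S. n \<le> m}" by auto
  have geo: "(\<Sum>k\<in>K. (1/2::real)^k) \<le> 2" if "finite K" for K :: "nat set"
  proof -
    have "(\<Sum>k\<in>K. (1/2::real)^k) \<le> (\<Sum>k. (1/2)^k)"
      by (rule sum_le_suminf) (use that in \<open>auto simp: summable_geometric\<close>)
    also have "\<dots> = 2" by (subst suminf_geometric) auto
    finally show ?thesis .
  qed
  have "(\<Sum>m\<in>{m\<in>S. m < n}. (1/2::real)^nat \<bar>int m - int n\<bar>) = (\<Sum>k\<in>(\<lambda>m. n - m) ` {m\<in>S. m < n}. (1/2)^k)"
    by (subst sum.reindex) (auto intro!: inj_onI sum.cong arg_cong[where f="\<lambda>k. (1/2)^k"])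
  moreover have "(\<Sum>m\<in>{m\<in>S. n \<le> m}. (1/2::real)^nat \<bar>int m - int n\<bar>) = (\<Sum>k\<in>(\<lambda>m. m - n) ` {m\<in>S. n \<le> m}. (1/2)^k)"
    by (subst sum.reindex) (auto intro!: inj_onI sum.cong arg_cong[where f="\<lambda>k. (1/2)^k"])
  ultimately show ?thesis
    using geo[of "(\<lambda>m. n - m) ` {m\<in>S. m < n}"] geo[of "(\<lambda>m. m - n) ` {m\<in>S. n \<le> m}"] fin
    by (subst S, subst sum.union_disjoint) auto
qed

text \<open>With h the number of sets containing a point, h <= \<open>\<mu>\<close> h^2 + 1/(4
  \<open>\<mu>\<close>) on the union, and h = 0 outside. The mass bound 2 and the row sums 4 of the
  decay factors bound the integral of h^2 by 10 C w times the sum of F. The choice of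
  \<open>\<mu>\<close> makes its contribution half of the lower bound for the integral of h.\<close>

lemma measure_union_ge_second_moment:
  fixes A :: "nat \<Rightarrow> 'a set" and F :: "nat \<Rightarrow> real"
  assumes S: "finite S" and A: "\<And>n. n \<in> S \<Longrightarrow> A n \<in> fmeasurable M"
    and F: "\<And>n. n \<in> S \<Longrightarrow> 0 \<le> F n"
    and s: "1 \<le> sum F S" "sum F S \<le> 2" and c: "c > 0" "C > 0" "w \<ge> 0"
    and low: "\<And>n. n \<in> S \<Longrightarrow> c * w * F n \<le> measure M (A n)"
    and cor: "\<And>n m. n \<in> S \<Longrightarrow> m \<in> S \<Longrightarrow>
        measure M (A n \<inter> A m) \<le> C * w * (F n * F m + (1/2)^nat \<bar>int m - int n\<bar> * (F n + F m))"
  shows "c\<^sup>2 / (20 * C) * w \<le> measure M (\<Union>n\<in>S. A n)"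
proof -
  define U where "U = (\<Union>n\<in>S. A n)"
  define h where "h = (\<lambda>x. \<Sum>n\<in>S. indicator (A n) x :: real)"
  define \<mu> where "\<mu> = c / (20 * C)"
  have l0: "\<mu> > 0" using c by (simp add: \<mu>_def)
  have U: "U \<in> fmeasurable M" unfolding U_def using S A by (intro fmeasurable.finite_UN) auto
  have intA: "integrable M (indicator (A n) :: _ \<Rightarrow> real)" if "n \<in> S" for n
    using A[OF that] by (simp add: fmeasurable_def less_top[symmetric])
  have intAA: "integrable M (\<lambda>x. indicator (A n \<inter> A m) x :: real)" if "n \<in> S" "m \<in> S" for n m
    using fmeasurable.Int[OF A A, of n m] that by (simp add: fmeasurable_def less_top[symmetric])
  have h2: "(h x)\<^sup>2 = (\<Sum>n\<in>S. \<Sum>m\<in>S. indicator (A n \<inter> A m) x)" for x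
    by (simp add: h_def power2_eq_square sum_product indicator_inter_arith)
  have int_h: "integrable M h" unfolding h_def by (intro Bochner_Integration.integrable_sum intA)
  have int_h2: "integrable M (\<lambda>x. (h x)\<^sup>2)" unfolding h2
    by (intro Bochner_Integration.integrable_sum intAA)
  have int_U: "integrable M (indicator U :: _ \<Rightarrow> real)"
    using U by (simp add: fmeasurable_def less_top[symmetric])
  have pw: "h x \<le> \<mu> * (h x)\<^sup>2 + 1 / (4 * \<mu>) * indicator U x" for x
  proof (cases "x \<in> U")
    case True
    have "0 \<le> (2 * \<mu> * h x - 1)\<^sup>2" by simp
    then have "4 * \<mu> * h x \<le> 4 * \<mu> * (\<mu> * (h x)\<^sup>2) + 1" by (simp add: power2_eq_square algebra_simps)
    then have "h x \<le> (4 * \<mu> * (\<mu> * (h x)\<^sup>2) + 1) / (4 * \<mu>)" using l0 by (simp add: pos_le_divide_eq mult.commute)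
    also have "\<dots> = \<mu> * (h x)\<^sup>2 + 1 / (4 * \<mu>)" using l0 by (simp add: add_divide_distrib)
    finally show ?thesis using True by simp
  next
    case False
    then have "h x = 0" unfolding h_def U_def by (intro sum.neutral) auto
    then show ?thesis using False by simp
  qed
  have "c * w * sum F S \<le> (\<Sum>n\<in>S. measure M (A n))"
    unfolding sum_distrib_left by (rule sum_mono) (rule low)
  also have "\<dots> = (\<integral>x. h x \<partial>M)"
    unfolding h_def using intA A by (subst Bochner_Integration.integral_sum) (auto intro!: sum.cong simp: fmeasurable_def sets.Int_space_eq2)
  also have "\<dots> \<le> (\<integral>x. \<mu> * (h x)\<^sup>2 + 1 / (4 * \<mu>) * indicator U x \<partial>M)"
    by (intro integral_mono pw int_h Bochner_Integration.integrable_add integrable_mult_right int_h2 int_U)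
  also have "\<dots> = \<mu> * (\<integral>x. (h x)\<^sup>2 \<partial>M) + 1 / (4 * \<mu>) * measure M U"
    using int_h2 int_U U by (simp add: fmeasurable_def sets.Int_space_eq2)
  also have "(\<integral>x. (h x)\<^sup>2 \<partial>M) = (\<Sum>n\<in>S. \<Sum>m\<in>S. measure M (A n \<inter> A m))"
  proof -
    have "(\<integral>x. (h x)\<^sup>2 \<partial>M) = (\<Sum>n\<in>S. \<integral>x. (\<Sum>m\<in>S. indicator (A n \<inter> A m) x) \<partial>M)"
      unfolding h2 by (rule Bochner_Integration.integral_sum) (intro Bochner_Integration.integrable_sum intAA)
    also have "\<dots> = (\<Sum>n\<in>S. \<Sum>m\<in>S. \<integral>x. indicator (A n \<inter> A m) x \<partial>M)"
      by (intro sum.cong refl Bochner_Integration.integral_sum intAA)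
    also have "\<dots> = (\<Sum>n\<in>S. \<Sum>m\<in>S. measure M (A n \<inter> A m))"
    proof (intro sum.cong refl)
      fix n m assume "n \<in> S" "m \<in> S"
      then have "A n \<inter> A m \<inter> space M = A n \<inter> A m"
        using A[of n] by (auto simp: fmeasurable_def dest: sets.sets_into_space)
      then show "(\<integral>x. indicator (A n \<inter> A m) x \<partial>M) = measure M (A n \<inter> A m)" by simp
    qed
    finally show ?thesis .
  qed
  also have "(\<Sum>n\<in>S. \<Sum>m\<in>S. measure M (A n \<inter> A m)) \<le>
      (\<Sum>n\<in>S. \<Sum>m\<in>S. C * w * (F n * F m + (1/2)^nat \<bar>int m - int n\<bar> * (F n + F m)))"
    by (intro sum_mono cor)
  also have "\<dots> = C * w * ((sum F S)\<^sup>2 + 2 * (\<Sum>n\<in>S. F n * (\<Sum>m\<in>S. (1/2)^nat \<bar>int m - int n\<bar>)))"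
  proof -
    let ?d = "\<lambda>n m. (1/2::real)^nat \<bar>int m - int n\<bar>"
    have "(\<Sum>n\<in>S. \<Sum>m\<in>S. ?d n m * F m) = (\<Sum>m\<in>S. \<Sum>n\<in>S. ?d n m * F m)" by (rule sum.swap)
    also have "\<dots> = (\<Sum>m\<in>S. \<Sum>n\<in>S. ?d m n * F m)" by (simp add: abs_minus_commute)
    finally have sw: "(\<Sum>n\<in>S. \<Sum>m\<in>S. ?d n m * F m) = (\<Sum>n\<in>S. \<Sum>m\<in>S. ?d n m * F n)" .
    have "(\<Sum>n\<in>S. \<Sum>m\<in>S. F n * F m + ?d n m * (F n + F m))
       = (\<Sum>n\<in>S. \<Sum>m\<in>S. F n * F m) + (\<Sum>n\<in>S. \<Sum>m\<in>S. ?d n m * F n) + (\<Sum>n\<in>S. \<Sum>m\<in>S. ?d n m * F m)"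
      by (simp add: distrib_left sum.distrib)
    also have "\<dots> = (sum F S)\<^sup>2 + 2 * (\<Sum>n\<in>S. F n * (\<Sum>m\<in>S. ?d n m))"
      unfolding sw by (simp add: power2_eq_square sum_product sum_distrib_left mult.commute)
    finally show ?thesis by (simp only: sum_distrib_left[symmetric])
  qed
  also have "\<dots> \<le> C * w * (2 * sum F S + 2 * (\<Sum>n\<in>S. F n * 4))"
  proof (intro mult_left_mono add_mono sum_mono)
    have "sum F S * sum F S \<le> 2 * sum F S" using s by (intro mult_right_mono) auto
    then show "(sum F S)\<^sup>2 \<le> 2 * sum F S" by (simp add: power2_eq_square)
  qed (use c F sum_half_powers_le[OF S] in auto)
  also have "\<dots> = 10 * C * w * sum F S" by (simp add: sum_distrib_right[symmetric])
  finally have "c * w * sum F S \<le> \<mu> * (10 * C * w * sum F S) + 1 / (4 * \<mu>) * measure M U"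
    using l0 by (simp add: mult_left_mono)
  also have "\<mu> * (10 * C * w * sum F S) = c * w * sum F S / 2" using c by (simp add: \<mu>_def field_simps)
  finally have "c * w * sum F S / 2 \<le> 1 / (4 * \<mu>) * measure M U" by linarith
  then have "4 * \<mu> * (c * w * sum F S / 2) \<le> measure M U" using l0 by (simp add: field_simps)
  moreover have "c\<^sup>2 / (20 * C) * w * 1 \<le> c\<^sup>2 / (20 * C) * w * (2 * sum F S)"
    using s c by (intro mult_left_mono) auto
  moreover have "4 * \<mu> * (c * w * sum F S / 2) = c\<^sup>2 / (20 * C) * w * (2 * sum F S)"
    by (simp add: \<mu>_def power2_eq_square)
  ultimately show ?thesis unfolding U_def by linarith
qed

text \<open>Every tail contains a block of mass between 1 and 2, whose union already has the
  asserted measure; continuity from above passes to the limsup. The constant depends on c and C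
  alone, not on F or \<open>n0\<close>.\<close>

lemma measure_limsup_ge_second_moment:
  fixes A :: "nat \<Rightarrow> 'a set" and F :: "nat \<Rightarrow> real"
  assumes A: "\<And>n. A n \<in> sets M" "\<And>n. A n \<subseteq> I" and I: "I \<in> fmeasurable M"
    and F: "\<And>n. 0 \<le> F n" "\<And>n. F n \<le> 1" "\<not> summable F" and c: "c > 0" "C > 0" "w \<ge> 0"
    and low: "\<And>n. n \<ge> n0 \<Longrightarrow> c * w * F n \<le> measure M (A n)"
    and cor: "\<And>n m. n0 \<le> n \<Longrightarrow> n \<le> m \<Longrightarrow>
        measure M (A n \<inter> A m) \<le> C * w * (F n * F m + (1/2)^(m - n) * (F n + F m))"
  shows "c\<^sup>2 / (20 * C) * w \<le> measure M (limsup A)"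
proof -
  have fA: "A n \<in> fmeasurable M" for n using A I fmeasurableI2 by metis
  define V where "V = (\<lambda>k. \<Union>n\<in>{k..}. A n)"
  have V: "V k \<in> fmeasurable M" for k
    by (rule fmeasurableI2[OF I]) (use A in \<open>auto simp: V_def\<close>)
  have cor': "measure M (A n \<inter> A m) \<le> C * w * (F n * F m + (1/2)^nat \<bar>int m - int n\<bar> * (F n + F m))"
    if "n0 \<le> n" "n0 \<le> m" for n m
  proof (cases "n \<le> m")
    case True
    then show ?thesis using cor[OF that(1) True] by (simp add: nat_diff_distrib')
  next
    case False
    then have "nat \<bar>int m - int n\<bar> = n - m" by auto
    then show ?thesis using cor[OF that(2), of n] False by (simp add: Int_commute mult.commute add.commute)
  qed
  have "c\<^sup>2 / (20 * C) * w \<le> measure M (V k)" if "k \<ge> n0" for k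
  proof -
    obtain l where l: "1 \<le> sum F {k..<l}" "sum F {k..<l} \<le> 2" using exists_block_sum[OF F] by metis
    have "c\<^sup>2 / (20 * C) * w \<le> measure M (\<Union>n\<in>{k..<l}. A n)"
      by (rule measure_union_ge_second_moment[OF _ _ _ l c]) (use fA F low cor' that in auto)
    also have "\<dots> \<le> measure M (V k)"
      by (rule measure_mono_fmeasurable) (use V A in \<open>auto simp: V_def\<close>)
    finally show ?thesis .
  qed
  moreover have "(\<lambda>k. measure M (V k)) \<longlonglongrightarrow> measure M (\<Inter>k. V k)"
  proof (rule Lim_measure_decseq)
    show "range V \<subseteq> sets M" using V by auto
    show "emeasure M (V i) \<noteq> \<infinity>" for i using V[of i] by (auto simp: fmeasurable_def)
    show "decseq V" unfolding decseq_def V_def by (intro allI impI UN_mono) auto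
  qed
  ultimately have "c\<^sup>2 / (20 * C) * w \<le> measure M (\<Inter>k. V k)"
    by (intro LIMSEQ_le_const[of "\<lambda>k. measure M (V k)"]) auto
  then show ?thesis by (simp add: V_def limsup_INF_SUP)
qed

section \<open>From a fixed proportion of every interval to full measure\<close>

lemma negligible_Int_boxes:
  fixes K K' :: "'a::euclidean_space set"
  assumes "interior K \<inter> interior K' = {}" "\<exists>c d. K = cbox c d" "\<exists>c d. K' = cbox c d"
  shows "negligible (K \<inter> K')"
proof -
  have "convex (K \<inter> K')" using assms by (auto intro: convex_Int)
  then show ?thesis using assms(1) by (simp add: negligible_convex_interior)
qed

text \<open>Cover the part Z of the complement in [-T, T] by non-overlapping intervals of total
  length at most |Z| + e. W fills the proportion \<open>\<kappa>\<close> of the cover and is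
  disjoint from Z, so |Z| + \<open>\<kappa>\<close> |cover| <= |cover| <= |Z| + e. Hence
  \<open>\<kappa>\<close> |Z| <= e for every e > 0.\<close>

lemma negligible_complement_if_uniformly_positive:
  fixes W :: "real set"
  assumes W: "W \<in> sets lebesgue" and k: "\<kappa> > 0"
    and low: "\<And>a b. a < b \<Longrightarrow> \<kappa> * (b - a) \<le> measure lebesgue (W \<inter> {a..b})"
  shows "negligible (- W)"
proof -
  have loc: "negligible ({- real T..real T} - W)" for T :: nat
  proof -
    define Z where "Z = {- real T..real T} - W"
    have Z: "Z \<in> lmeasurable" unfolding Z_def using W by (intro fmeasurable_Diff) auto
    have key: "\<kappa> * measure lebesgue Z \<le> e" if e: "e > 0" for e
    proof -
      obtain \<D> where D: "countable \<D>"
        "\<And>K. K \<in> \<D> \<Longrightarrow> K \<subseteq> cbox (- real T) (real T) \<and> K \<noteq> {} \<and> (\<exists>c d. K = cbox c d)"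
        "pairwise (\<lambda>A B. interior A \<inter> interior B = {}) \<D>"
        "Z \<subseteq> \<Union>\<D>" "\<Union>\<D> \<in> lmeasurable" "measure lebesgue (\<Union>\<D>) \<le> measure lebesgue Z + e"
        by (rule measurable_outer_intervals_bounded[OF Z _ e, of "- real T" "real T"]) (auto simp: Z_def)
      have fin: "\<kappa> * measure lebesgue (\<Union>\<F>) \<le> measure lebesgue (W \<inter> \<Union>\<F>)" if F: "finite \<F>" "\<F> \<subseteq> \<D>" for \<F>
      proof -
        have Km: "K \<in> lmeasurable" if "K \<in> \<F>" for K using D(2) F that by blast
        have WK: "W \<inter> K \<in> lmeasurable" if "K \<in> \<F>" for K
          by (rule fmeasurableI2[OF Km[OF that]]) (use W Km[OF that] in \<open>auto simp: fmeasurable_def\<close>)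
        have "\<kappa> * measure lebesgue (\<Union>\<F>) \<le> \<kappa> * (\<Sum>K\<in>\<F>. measure lebesgue K)"
          using measure_UNION_le[OF F(1), of "\<lambda>K. K" lebesgue] Km k by (intro mult_left_mono) (auto simp: fmeasurable_def)
        also have "\<dots> = (\<Sum>K\<in>\<F>. \<kappa> * measure lebesgue K)" by (rule sum_distrib_left)
        also have "\<dots> \<le> (\<Sum>K\<in>\<F>. measure lebesgue (W \<inter> K))"
        proof (rule sum_mono)
          fix K assume "K \<in> \<F>"
          then obtain u v where K: "K = {u..v}" using D(2) F by (metis cbox_interval subsetD)
          show "\<kappa> * measure lebesgue K \<le> measure lebesgue (W \<inter> K)"
            using low[of u v] unfolding K by (cases "u < v") auto
        qed
        also have "\<dots> = measure lebesgue (\<Union>((\<lambda>K. W \<inter> K) ` \<F>))"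
        proof (rule measure_negligible_finite_Union_image[symmetric, OF F(1)])
          show "pairwise (\<lambda>K K'. negligible (W \<inter> K \<inter> (W \<inter> K'))) \<F>"
          proof (rule pairwiseI)
            fix K K' assume K: "K \<in> \<F>" "K' \<in> \<F>" "K \<noteq> K'"
            then have "interior K \<inter> interior K' = {}" using D(3) F(2) by (auto simp: pairwise_def)
            then have "negligible (K \<inter> K')" by (rule negligible_Int_boxes) (use D(2) F(2) K in blast)+
            then show "negligible (W \<inter> K \<inter> (W \<inter> K'))" by (rule negligible_subset) auto
          qed
        qed (use WK in auto)
        also have "\<Union>((\<lambda>K. W \<inter> K) ` \<F>) = W \<inter> \<Union>\<F>" by auto
        finally show ?thesis .
      qed
      have WD: "W \<inter> \<Union>\<D> \<in> lmeasurable"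
        by (rule fmeasurableI2[OF D(5)]) (use W D(5) in \<open>auto simp: fmeasurable_def\<close>)
      \<comment> \<open>The estimate for finite subfamilies passes to the countable one along the
        initial segments of an enumeration, which needs a nonempty family.\<close>
      have "\<kappa> * measure lebesgue (\<Union>\<D>) \<le> measure lebesgue (W \<inter> \<Union>\<D>)"
      proof (cases "\<D> = {}")
        case False
        define V where "V = (\<lambda>n. \<Union>(from_nat_into \<D> ` {..<n::nat}))"
        have VD: "\<Union>(range V) = \<Union>\<D>"
        proof -
          have "\<Union>(range V) = \<Union>(range (from_nat_into \<D>))" by (auto simp: V_def)
          then show ?thesis using range_from_nat_into[OF False D(1)] by simp
        qed
        have sub: "from_nat_into \<D> ` {..<n} \<subseteq> \<D>" for n using from_nat_into[OF False] by auto
        have Vm: "V n \<in> lmeasurable" for n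
        proof -
          have "K \<in> lmeasurable" if K: "K \<in> from_nat_into \<D> ` {..<n}" for K
          proof -
            have "K \<in> \<D>" using sub K by (rule subsetD)
            then obtain u v where "K = cbox u v" using D(2) by blast
            then show ?thesis by simp
          qed
          then show ?thesis unfolding V_def by (intro fmeasurable.finite_Union) auto
        qed
        have inc: "incseq V"
          unfolding incseq_def V_def by (intro allI impI Union_mono image_mono) auto
        have "(\<lambda>n. measure lebesgue (V n)) \<longlonglongrightarrow> measure lebesgue (\<Union>(range V))"
          by (rule Lim_measure_incseq) (use Vm inc D(5) VD in \<open>auto simp: fmeasurable_def\<close>)
        moreover have "(\<lambda>n. measure lebesgue (W \<inter> V n)) \<longlonglongrightarrow> measure lebesgue (\<Union>n. W \<inter> V n)"
          by (rule Lim_measure_incseq) (use Vm inc W WD VD in \<open>auto simp: fmeasurable_def incseq_def Int_UN_distrib[symmetric]\<close>)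
        moreover have "(\<Union>n. W \<inter> V n) = W \<inter> \<Union>\<D>" using VD by auto
        moreover have "\<kappa> * measure lebesgue (V n) \<le> measure lebesgue (W \<inter> V n)" for n
          using fin[OF _ sub[of n]] by (simp add: V_def)
        ultimately show ?thesis unfolding VD
          by (intro LIMSEQ_le[OF tendsto_mult_left[of "\<lambda>n. measure lebesgue (V n)"]]) auto
      qed auto
      moreover have "measure lebesgue Z + measure lebesgue (W \<inter> \<Union>\<D>) = measure lebesgue (Z \<union> (W \<inter> \<Union>\<D>))"
        by (rule measure_Union[symmetric]) (use Z WD in \<open>auto simp: fmeasurable_def Z_def\<close>)
      moreover have "measure lebesgue (Z \<union> (W \<inter> \<Union>\<D>)) \<le> measure lebesgue (\<Union>\<D>)"
        by (rule measure_mono_fmeasurable) (use D(4,5) Z WD in \<open>auto simp: fmeasurable_def\<close>)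
      moreover have "\<kappa> * measure lebesgue Z \<le> \<kappa> * measure lebesgue (\<Union>\<D>)"
        using k D(4,5) Z by (intro mult_left_mono measure_mono_fmeasurable) (auto simp: fmeasurable_def)
      ultimately show ?thesis using D by linarith
    qed
    have "\<kappa> * measure lebesgue Z \<le> 0" by (rule field_le_epsilon) (use key in auto)
    then have "measure lebesgue Z = 0" using k by (simp add: mult_le_0_iff order_antisym)
    then show ?thesis using Z unfolding Z_def by (simp add: negligible_iff_measure)
  qed
  have "negligible (\<Union>T. {- real T..real T} - W)"
    by (rule negligible_countable_Union) (use loc in auto)
  moreover have "- W \<subseteq> (\<Union>T. {- real T..real T} - W)"
  proof
    fix x assume "x \<in> - W"
    moreover obtain T where "\<bar>x\<bar> \<le> real T" using real_arch_simple by blast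
    ultimately have "x \<in> {- real T..real T} - W" by auto
    then show "x \<in> (\<Union>T. {- real T..real T} - W)" by blast
  qed
  ultimately show ?thesis by (rule negligible_subset)
qed

section \<open>Divergence for the parabola\<close>

text \<open>Both small quantities are linear in (q, p, r): q x - p, and the form q X^2 - 2 p X Y + r
  Y^2 at (x, 1). For each multiplier k <= N suitable integers bring both into [0, 1). N + 1
  multipliers fall into T1 T2 <= N cells, and two triples in one cell are subtracted.\<close>

lemma simultaneous_pigeonhole:
  fixes x :: real and T1 T2 N :: nat
  assumes T: "T1 > 0" "T2 > 0" "T1 * T2 \<le> N"
  obtains q p r :: int where "1 \<le> q" "q \<le> int N" "\<bar>of_int q * x - of_int p\<bar> < 1 / real T1"
    "\<bar>of_int r - 2 * of_int p * x + of_int q * x\<^sup>2\<bar> < 1 / real T2"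
proof -
  define P where "P = (\<lambda>k::nat. \<lfloor>real k * x\<rfloor>)"
  define R where "R = (\<lambda>k::nat. - \<lfloor>real k * x\<^sup>2 - 2 * of_int (P k) * x\<rfloor>)"
  define e where "e = (\<lambda>k. real k * x - of_int (P k))"
  define f where "f = (\<lambda>k. of_int (R k) - 2 * of_int (P k) * x + real k * x\<^sup>2)"
  have e: "0 \<le> e k" "e k < 1" for k unfolding e_def P_def by linarith+
  have f: "0 \<le> f k" "f k < 1" for k unfolding f_def R_def by linarith+
  define g where "g = (\<lambda>k. (nat \<lfloor>e k * T1\<rfloor>, nat \<lfloor>f k * T2\<rfloor>))"
  have cell: "nat \<lfloor>u * real t\<rfloor> < t" if "0 \<le> u" "u < 1" "t > 0" for u :: real and t :: nat
  proof -
    have "u * real t < real t" using that by simp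
    then show ?thesis using that by (simp add: floor_less_iff nat_less_iff)
  qed
  have close: "\<bar>u - v\<bar> < 1 / real t" if "0 \<le> u" "0 \<le> v" "t > 0" "nat \<lfloor>u * real t\<rfloor> = nat \<lfloor>v * real t\<rfloor>"
    for u v :: real and t :: nat
  proof -
    have "\<lfloor>u * real t\<rfloor> = \<lfloor>v * real t\<rfloor>" using that by (simp add: eq_nat_nat_iff)
    then have "\<bar>u * real t - v * real t\<bar> < 1" by linarith
    moreover have "\<bar>u * real t - v * real t\<bar> = \<bar>u - v\<bar> * real t"
      by (simp add: left_diff_distrib[symmetric] abs_mult)
    ultimately show ?thesis using that by (simp add: field_simps)
  qed
  have "g ` {0..N} \<subseteq> {..<T1} \<times> {..<T2}" using cell e f T by (auto simp: g_def)
  then have "card (g ` {0..N}) \<le> card ({..<T1} \<times> {..<T2})" by (intro card_mono) auto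
  also have "\<dots> < card {0..N}" using T by (simp add: card_cartesian_product)
  finally have "\<not> inj_on g {0..N}" by (rule pigeonhole)
  then obtain k' l' where kl': "k' \<in> {0..N}" "l' \<in> {0..N}" "g k' = g l'" "k' \<noteq> l'"
    by (auto simp: inj_on_def)
  define k where "k = min k' l'"
  define l where "l = max k' l'"
  have kl: "k < l" "l \<le> N" "g k = g l" using kl' by (auto simp: k_def l_def min_def max_def)
  have "\<bar>e l - e k\<bar> < 1 / real T1" using close[of "e l" "e k" T1] e T kl by (auto simp: g_def)
  moreover have "\<bar>f l - f k\<bar> < 1 / real T2" using close[of "f l" "f k" T2] f T kl by (auto simp: g_def)
  ultimately show ?thesis using kl
    by (intro that[of "int l - int k" "P l - P k" "R l - R k"]) (auto simp: e_def f_def algebra_simps)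
qed

text \<open>The pigeonhole is applied with T2 about 1/\<open>\<delta>\<close> and T1 about N
  \<open>\<delta>\<close>. Since p^2 - q r = (q x - p)^2 - q (form at (x, 1)), the error q x - p
  enters the defect only squared. So p/q may be far from x compared with its distance to the curve;
  controlling q x^2 - r instead would make that error enter linearly.\<close>

lemma exists_triple_near_conic:
  fixes x \<delta> :: real and N :: nat
  assumes d: "0 < \<delta>" "\<delta> \<le> 1" and N: "4 \<le> real N * \<delta>"
  obtains q p r :: int where "1 \<le> q" "q \<le> int N" "\<bar>of_int q * x - of_int p\<bar> \<le> 4 / (real N * \<delta>)"
    "\<bar>of_int (p\<^sup>2 - q * r)\<bar> \<le> (4 / (real N * \<delta>))\<^sup>2 + of_int q * \<delta>"
proof -
  define T2 where "T2 = nat \<lceil>1 / \<delta>\<rceil>"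
  define T1 where "T1 = N div T2"
  have i1: "1 \<le> 1 / \<delta>" using d by simp
  have T2: "1 / \<delta> \<le> real T2" "real T2 \<le> 2 / \<delta>"
  proof -
    have "real T2 = of_int \<lceil>1 / \<delta>\<rceil>" unfolding T2_def using i1 by simp
    moreover have "2 / \<delta> = 1 / \<delta> + 1 / \<delta>" by simp
    ultimately show "1 / \<delta> \<le> real T2" "real T2 \<le> 2 / \<delta>" using i1 by linarith+
  qed
  have "1 \<le> real T2" using T2(1) i1 by linarith
  then have T2p: "T2 > 0" by simp
  have le: "T1 * T2 \<le> N" by (simp add: T1_def)
  have "N < (T1 + 1) * T2" unfolding T1_def using T2p
    by (metis add.commute dividend_less_times_div mult.commute mult_Suc_right plus_1_eq_Suc)
  then have "real N < real ((T1 + 1) * T2)" by (simp only: of_nat_less_iff)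
  also have "\<dots> = (real T1 + 1) * real T2" by (simp add: algebra_simps)
  also have "\<dots> \<le> (real T1 + 1) * (2 / \<delta>)" using T2 by (intro mult_left_mono) auto
  finally have T1: "real N * \<delta> / 2 < real T1 + 1" using d by (simp add: field_simps)
  then have T1': "real N * \<delta> / 4 \<le> real T1" "T1 > 0"
    using N by simp_all
  obtain q p r :: int where q: "1 \<le> q" "q \<le> int N" and qp: "\<bar>of_int q * x - of_int p\<bar> < 1 / real T1"
    and r: "\<bar>of_int r - 2 * of_int p * x + of_int q * x\<^sup>2\<bar> < 1 / real T2"
    using simultaneous_pigeonhole[OF T1'(2) T2p le] by blast
  have "1 / real T1 \<le> 1 / (real N * \<delta> / 4)" using T1' N by (intro divide_left_mono mult_pos_pos) auto
  then have qp': "\<bar>of_int q * x - of_int p\<bar> \<le> 4 / (real N * \<delta>)" using qp by simp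
  have "1 / real T2 \<le> 1 / (1 / \<delta>)" using T2(1) i1 T2p d by (intro divide_left_mono) auto
  then have r': "\<bar>of_int r - 2 * of_int p * x + of_int q * x\<^sup>2\<bar> \<le> \<delta>" using r by simp
  have q0: "real_of_int q > 0" using q by simp
  have "real_of_int (p\<^sup>2 - q * r) = (of_int q * x - of_int p)\<^sup>2 - of_int q * (of_int r - 2 * of_int p * x + of_int q * x\<^sup>2)"
    by (simp add: algebra_simps power2_eq_square)
  then have "\<bar>real_of_int (p\<^sup>2 - q * r)\<bar> \<le> \<bar>(of_int q * x - of_int p)\<^sup>2\<bar> + \<bar>of_int q * (of_int r - 2 * of_int p * x + of_int q * x\<^sup>2)\<bar>"
    by (metis abs_triangle_ineq4)
  also have "\<dots> = \<bar>of_int q * x - of_int p\<bar>\<^sup>2 + of_int q * \<bar>of_int r - 2 * of_int p * x + of_int q * x\<^sup>2\<bar>"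
    using q0 by (simp add: abs_mult)
  also have "\<dots> \<le> (4 / (real N * \<delta>))\<^sup>2 + of_int q * \<delta>"
    using qp' r' q0 by (intro add_mono power_mono mult_left_mono) auto
  finally show ?thesis using that q qp' by blast
qed

text \<open>The defect condition says that r/q is within 2 \<open>\<delta>\<close>/q of (p/q)^2. The
  window for q reaches three blocks below 4096^n, the loss incurred in
  \<open>bad_set_small\<close>.\<close>

definition near_conic_points :: "nat \<Rightarrow> real \<Rightarrow> real set" where
  "near_conic_points n \<delta> = {z. \<exists>(q::int) (p::int) (r::int). 4096^(n-3) \<le> q \<and> q \<le> 4096^n \<and>
     z = of_int p / of_int q \<and> \<bar>of_int (p\<^sup>2 - q * r)\<bar> \<le> 2 * of_int q * \<delta>}"

text \<open>Each x has a triple with q <= 4096^n from \<open>exists_triple_near_conic\<close>. If q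
  < 4096^(n-3), then x lies in an interval of radius \<open>\<eta>\<close>/4096^i around p/q for a
  near triple of some block i < n - 3; B is the union of these intervals. As \<open>\<eta>\<close>
  \<open>\<delta>\<close> = 4/4096^n, the main terms of the count add up to at most 2^33 w
  4096^(n-3)/4096^n = w/8: three blocks are dropped for this reason. The statement is uniform in f
  because f varies with the level.\<close>

lemma bad_set_small:
  fixes \<alpha> \<beta> :: real
  assumes ab: "\<alpha> < \<beta>"
  shows "\<forall>\<^sub>F n in sequentially. \<forall>f. 1 / (8192 * (real n + 1)) \<le> f \<longrightarrow> f \<le> 1 / 8192 \<longrightarrow>
    (\<exists>B\<in>fmeasurable lborel. measure lborel B \<le> (\<beta> - \<alpha>) / 2 \<and>
      (\<forall>x\<in>{\<alpha>..\<beta>} - B. \<exists>z\<in>near_conic_points n (f / 64^n). \<bar>x - z\<bar> \<le> 2^38 / (64^(3*n) * f)))"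
proof -
  define w where "w = \<beta> - \<alpha>"
  have w: "w > 0" using ab by (simp add: w_def)
  \<comment> \<open>Upper bound for \<open>\<eta>\<close> = 4/(64^n f) when f >= 1/(8192 (n+1)); the
    asymptotic conditions are imposed on h so that they do not involve f.\<close>
  define h where "h = (\<lambda>n::nat. 32768 * (real n + 1) / 64^n)"
  have "\<forall>\<^sub>F n in sequentially. h n < w / 2"
    using order_tendstoD(2)[of h 0 sequentially "w/2"] w unfolding h_def by (auto, real_asymp)
  moreover have "\<forall>\<^sub>F n in sequentially. h n < 1 / 2" unfolding h_def by real_asymp
  moreover have "\<forall>\<^sub>F n in sequentially. 2^19 * h n^3 * real n < 1 / 8" unfolding h_def by real_asymp
  moreover have "\<forall>\<^sub>F n in sequentially. h n * (real n + 1)^2 * 32^n < w / (2^35 * (1 + 2 * w))"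
  proof -
    have "(\<lambda>n. h n * (real n + 1)^2 * 32^n) \<longlonglongrightarrow> 0" unfolding h_def by real_asymp
    then show ?thesis by (rule order_tendstoD) (use w in auto)
  qed
  moreover have "\<forall>\<^sub>F n in sequentially. h n^2 < 1 / (8192 * (real n + 1) * 64^n)" unfolding h_def by real_asymp
  moreover have "\<forall>\<^sub>F n in sequentially. n \<ge> (3::nat)" by (rule eventually_ge_at_top)
  ultimately show ?thesis
  proof eventually_elim
    case (elim n)
    show ?case
    proof (intro allI impI)
      fix f :: real assume f: "1 / (8192 * (real n + 1)) \<le> f" "f \<le> 1 / 8192"
      have f0: "f > 0" using f(1) by (rule less_le_trans[rotated]) simp
      define \<delta> where "\<delta> = f / 64^n"
      define N where "N = (4096::nat)^n"
      have N: "real N = 64^n * 64^n" unfolding N_def by (simp flip: power_mult_distrib)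
      define \<eta> where "\<eta> = 4 / (real N * \<delta>)"
      have d0: "\<delta> > 0" using f0 by (simp add: \<delta>_def)
      have \<eta>': "\<eta> = 4 / (64^n * f)" unfolding \<eta>_def N \<delta>_def by simp
      have e0: "\<eta> > 0" using f0 by (simp add: \<eta>')
      have "\<eta> \<le> 4 / (64^n * (1 / (8192 * (real n + 1))))" unfolding \<eta>'
        using f(1) f0 by (intro divide_left_mono mult_left_mono mult_pos_pos) auto
      then have eh: "\<eta> \<le> h n" by (simp add: h_def)
      have d1: "\<delta> \<le> 1"
      proof -
        have "\<delta> \<le> (1/8192) / 1" unfolding \<delta>_def using f f0 by (intro frac_le) auto
        then show ?thesis by simp
      qed
      have e1: "\<eta> \<le> 1 / 2" using eh elim(2) by linarith
      have "\<eta>\<^sup>2 \<le> (h n)\<^sup>2" using eh e0 by (intro power_mono) auto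
      also have "\<dots> \<le> 1 / (8192 * (real n + 1) * 64^n)" using elim(5) by simp
      also have "\<dots> = (1 / (8192 * (real n + 1))) / 64^n" by simp
      also have "\<dots> \<le> \<delta>" unfolding \<delta>_def using f by (intro divide_right_mono) auto
      finally have e2: "\<eta>\<^sup>2 \<le> \<delta>" .
      \<comment> \<open>The bound \<open>\<eta>\<close>^2 + q \<open>\<delta>\<close> on the defect,
        for q < 4096^Suc i. The cap f <= 1/8192 gives 4096^Suc i \<open>\<delta>\<close> <= 64^i /
        2, so that K i <= 2^(6i) and the count applies.\<close>
      define K where "K = (\<lambda>i::nat. 4096^Suc i * \<delta> + \<eta>\<^sup>2)"
      define S where "S = (\<lambda>i. near_triples i (K i) (\<alpha> - w / 2) (\<beta> + w / 2))"
      let ?I = "\<lambda>i s. {real_of_int (fst (snd s)) / of_int (fst s) - \<eta> / 4096^i..of_int (fst (snd s)) / of_int (fst s) + \<eta> / 4096^i}"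
      define B where "B = (\<Union>i\<in>{..<n-3}. \<Union>s\<in>S i. ?I i s)"
      have K: "0 \<le> K i" "K i \<le> 2^(6*i)" if "i < n" for i
      proof -
        show "0 \<le> K i" using d0 by (simp add: K_def)
        have "4096^Suc i * \<delta> = 4096 * 64^i * f * (64^i / 64^n)"
          unfolding \<delta>_def by (simp flip: power_mult_distrib)
        also have "\<dots> \<le> 4096 * 64^i * (1 / 8192) * 1"
          using f f0 that by (intro mult_mono) (auto intro!: power_increasing)
        finally have "4096^Suc i * \<delta> \<le> 64^i / 2" by simp
        moreover have "\<eta>\<^sup>2 \<le> 1 / 2"
        proof -
          have "\<eta>\<^sup>2 \<le> (1/2)\<^sup>2" using e1 e0 by (intro power_mono) auto
          then show ?thesis by (simp add: power2_eq_square)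
        qed
        moreover have "(1::real) \<le> 64^i" by simp
        ultimately have "K i \<le> 64^i" unfolding K_def by linarith
        then show "K i \<le> 2^(6*i)" by (simp add: power_mult)
      qed
      have wid: "\<beta> + w / 2 - (\<alpha> - w / 2) = 2 * w" by (simp add: w_def)
      have fin: "finite (S i)" and card: "real (card (S i)) \<le> 2^17 * (2 * w) * K i * 4096^i
          + 2^31 * (1 + 2 * w) * (real i + 1) * 2^(17*i)" if "i < n" for i
        using near_triples_card[OF K[OF that], of "\<alpha> - w / 2" "\<beta> + w / 2"] w ab
        unfolding S_def wid by auto
      have Bf: "B \<in> fmeasurable lborel"
        unfolding B_def using fin e0
        by (intro fmeasurable.finite_UN measure_UN_intervals_le(1)) auto
      have "measure lborel B \<le> (\<Sum>i<n-3. measure lborel (\<Union>s\<in>S i. ?I i s))"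
        unfolding B_def using fin e0
        by (intro measure_UNION_le) (auto intro!: fmeasurableD measure_UN_intervals_le(1))
      also have "\<dots> \<le> (\<Sum>i<n-3. real (card (S i)) * (2 * (\<eta> / 4096^i)))"
        using fin e0 by (intro sum_mono measure_UN_intervals_le(2)) auto
      also have "\<dots> \<le> (\<Sum>i<n-3. (2^31 * w * (\<eta> * \<delta>)) * 4096^i + 2^19 * w * \<eta>^3 + 2^32 * (1 + 2 * w) * \<eta> * ((real n + 1) * 32^n))"
      proof (rule sum_mono)
        fix i assume "i \<in> {..<n-3}"
        then have i: "i < n" by auto
        have "real (card (S i)) * (2 * (\<eta> / 4096^i)) \<le> (2^17 * (2 * w) * K i * 4096^i
          + 2^31 * (1 + 2 * w) * (real i + 1) * 2^(17*i)) * (2 * (\<eta> / 4096^i))"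
          using card[OF i] e0 by (intro mult_right_mono) auto
        also have "\<dots> = 2^19 * w * K i * \<eta> + 2^32 * (1 + 2 * w) * \<eta> * ((real i + 1) * (2^(17*i) / 4096^i))"
          by (simp add: field_simps)
        also have "2^(17*i) / 4096^i = (32::real)^i"
          by (simp add: power_mult power_divide[symmetric])
        also have "2^19 * w * K i * \<eta> = (2^31 * w * (\<eta> * \<delta>)) * 4096^i + 2^19 * w * \<eta>^3"
          by (simp add: K_def algebra_simps power2_eq_square power3_eq_cube)
        also have "2^32 * (1 + 2 * w) * \<eta> * ((real i + 1) * 32^i) \<le> 2^32 * (1 + 2 * w) * \<eta> * ((real n + 1) * 32^n)"
          using i w e0 by (intro mult_left_mono mult_mono power_increasing) auto
        finally show "real (card (S i)) * (2 * (\<eta> / 4096^i)) \<le>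
          (2^31 * w * (\<eta> * \<delta>)) * 4096^i + 2^19 * w * \<eta>^3 + 2^32 * (1 + 2 * w) * \<eta> * ((real n + 1) * 32^n)"
          by simp
      qed
      also have "\<dots> = (2^31 * w * (\<eta> * \<delta>)) * (\<Sum>i<n-3. 4096^i) + real (n - 3) * (2^19 * w * \<eta>^3) + real (n - 3) * (2^32 * (1 + 2 * w) * \<eta> * ((real n + 1) * 32^n))"
        by (simp add: sum.distrib sum_distrib_left)
      \<comment> \<open>Only the first share is tight; the other two are small for large n by the
        conditions on h.\<close>
      also have "\<dots> \<le> w / 8 + w / 8 + w / 8"
      proof (intro add_mono)
        have "(\<Sum>i<n-3. (4096::real)^i) = (4096^(n-3) - 1) / 4095" by (subst geometric_sum) auto
        also have "\<dots> \<le> 4096^(n-3)" by (simp add: field_simps)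
        finally have "(2^31 * w * (\<eta> * \<delta>)) * (\<Sum>i<n-3. 4096^i) \<le> (2^31 * w * (\<eta> * \<delta>)) * 4096^(n-3)"
          using w e0 d0 by (intro mult_left_mono) auto
        also have "\<dots> = w / 8"
        proof -
          have ed: "\<eta> * \<delta> = 4 / 4096^n" unfolding \<eta>_def N_def using d0 by simp
          have "(4096::real)^n = 4096^3 * 4096^(n-3)" using elim(6) by (metis le_add_diff_inverse power_add)
          then show ?thesis unfolding ed by simp
        qed
        finally show "(2^31 * w * (\<eta> * \<delta>)) * (\<Sum>i<n-3. 4096^i) \<le> w / 8" .
        have "\<eta>^3 * real (n - 3) \<le> h n^3 * real n"
          using eh e0 by (intro mult_mono power_mono) auto
        then have "2^19 * (\<eta>^3 * real (n - 3)) \<le> 1 / 8" using elim(3) by simp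
        then have "w * (2^19 * (\<eta>^3 * real (n - 3))) \<le> w * (1 / 8)" using w by (intro mult_left_mono) auto
        then show "real (n - 3) * (2^19 * w * \<eta>^3) \<le> w / 8" by (simp add: algebra_simps)
        have "real (n - 3) * (2^32 * (1 + 2 * w) * \<eta> * ((real n + 1) * 32^n))
          = (2^32 * (1 + 2 * w)) * (\<eta> * (real (n - 3) * (real n + 1)) * 32^n)" by (simp add: algebra_simps)
        also have "\<dots> \<le> (2^32 * (1 + 2 * w)) * (h n * (real n + 1)^2 * 32^n)"
          unfolding power2_eq_square using w eh e0 by (intro mult_mono) auto
        also have "\<dots> \<le> (2^32 * (1 + 2 * w)) * (w / (2^35 * (1 + 2 * w)))"
          using elim(4) w by (intro mult_left_mono) auto
        also have "\<dots> = w / 8" using w by (simp add: field_simps)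
        finally show "real (n - 3) * (2^32 * (1 + 2 * w) * \<eta> * ((real n + 1) * 32^n)) \<le> w / 8" .
      qed
      also have "\<dots> \<le> (\<beta> - \<alpha>) / 2" using w by (simp add: w_def)
      finally have Bm: "measure lborel B \<le> (\<beta> - \<alpha>) / 2" .
      have "\<exists>z\<in>near_conic_points n (f / 64^n). \<bar>x - z\<bar> \<le> 2^38 / (64^(3*n) * f)"
        if x: "x \<in> {\<alpha>..\<beta>} - B" for x
      proof -
        have "4 \<le> real N * \<delta>" using e1 d0 unfolding \<eta>_def by (simp add: divide_le_eq N_def split: if_splits)
        then obtain q p r :: int where q: "1 \<le> q" "q \<le> int N" and qp: "\<bar>of_int q * x - of_int p\<bar> \<le> \<eta>"
          and r: "\<bar>of_int (p\<^sup>2 - q * r)\<bar> \<le> \<eta>\<^sup>2 + of_int q * \<delta>"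
          using exists_triple_near_conic[OF d0 d1, of N x] unfolding \<eta>_def by blast
        have q0: "real_of_int q \<ge> 1" using q by simp
        have eq: "\<bar>x - of_int p / of_int q\<bar> = \<bar>of_int q * x - of_int p\<bar> / of_int q"
          using q0 by (simp add: abs_divide[symmetric] field_simps)
        have big: "4096^(n-3) \<le> q"
        proof (rule ccontr)
          assume small: "\<not> 4096^(n-3) \<le> q"
          have "1 \<le> nat q" using q by simp
          from block_of_nat[OF this] obtain i where i: "4096^i \<le> nat q" "nat q < 4096^Suc i" .
          have i': "4096^i \<le> q" "q < 4096^Suc i" using i q by (auto simp: le_nat_iff nat_less_iff)
          have "(4096::int)^i < 4096^(n-3)" using small i'(1) by linarith
          then have in3: "i < n - 3" by (rule power_less_imp_less_exp[rotated]) simp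
          have qi: "4096^i \<le> real_of_int q" "real_of_int q \<le> 4096^Suc i"
            using i' by (metis of_int_le_iff of_int_numeral of_int_power, metis less_imp_le of_int_le_iff of_int_numeral of_int_power)
          have "\<bar>of_int (p\<^sup>2 - q * r)\<bar> \<le> K i"
          proof -
            have "of_int q * \<delta> \<le> 4096^Suc i * \<delta>" using qi d0 by (intro mult_right_mono) auto
            then show ?thesis using r unfolding K_def by linarith
          qed
          moreover have cl: "\<bar>x - of_int p / of_int q\<bar> \<le> \<eta> / 4096^i"
            unfolding eq using qp qi e0 by (intro frac_le) auto
          moreover have "\<bar>x - of_int p / of_int q\<bar> \<le> w / 2"
          proof -
            have "\<eta> / 4096^i \<le> \<eta> / 1" using e0 by (intro divide_left_mono) auto
            then show ?thesis using cl eh elim(1) by simp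
          qed
          then have "\<alpha> - w / 2 \<le> of_int p / of_int q" "of_int p / of_int q \<le> \<beta> + w / 2"
          proof -
            have "\<alpha> \<le> x" "x \<le> \<beta>" using x by auto
            then show "\<alpha> - w / 2 \<le> of_int p / of_int q" "of_int p / of_int q \<le> \<beta> + w / 2"
              using \<open>\<bar>x - of_int p / of_int q\<bar> \<le> w / 2\<close> by linarith+
          qed
          then have "(\<alpha> - w / 2) * of_int q \<le> of_int p" "of_int p \<le> (\<beta> + w / 2) * of_int q"
            using q0 by (simp_all add: pos_le_divide_eq pos_divide_le_eq)
          ultimately have "(q, p, r) \<in> S i" using i' by (simp add: S_def near_triples_def)
          moreover have "x \<in> {of_int p / of_int q - \<eta> / 4096^i..of_int p / of_int q + \<eta> / 4096^i}"
            using cl by (auto simp: abs_le_iff)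
          ultimately have "x \<in> B" unfolding B_def using in3 by force
          then show False using x by blast
        qed
        have bigr: "4096^(n-3) \<le> real_of_int q" using big by (metis of_int_le_iff of_int_numeral of_int_power)
        \<comment> \<open>Origin of 2^38: the 4 in \<open>\<eta>\<close> times the 4096^3 = 2^36
          lost at the lower end of the window.\<close>
        have "\<bar>x - of_int p / of_int q\<bar> \<le> \<eta> / 4096^(n-3)"
          unfolding eq using qp bigr e0 by (intro frac_le) auto
        also have "\<dots> = 4 * 4096^3 / (64^n * (4096^3 * 4096^(n-3)) * f)" unfolding \<eta>' by simp
        also have "(4096::real)^3 * 4096^(n-3) = 4096^n" using elim(6) by (metis le_add_diff_inverse power_add)
        also have "(64::real)^n * 4096^n = 64^(3*n)" by (simp add: power_mult flip: power_mult_distrib)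
        finally have "\<bar>x - of_int p / of_int q\<bar> \<le> 2^38 / (64^(3*n) * f)" by simp
        moreover have "\<bar>of_int (p\<^sup>2 - q * r)\<bar> \<le> 2 * of_int q * (f / 64^n)"
        proof -
          have "1 * \<delta> \<le> of_int q * \<delta>" using q0 d0 by (intro mult_right_mono) auto
          then have "\<bar>of_int (p\<^sup>2 - q * r)\<bar> \<le> 2 * (of_int q * \<delta>)" using r e2 by linarith
          then show ?thesis by (simp add: \<delta>_def)
        qed
        moreover have "q \<le> 4096^n" using q(2) by (simp add: N_def)
        ultimately show ?thesis using big unfolding near_conic_points_def by blast
      qed
      then show "\<exists>B\<in>fmeasurable lborel. measure lborel B \<le> (\<beta> - \<alpha>) / 2 \<and>
      (\<forall>x\<in>{\<alpha>..\<beta>} - B. \<exists>z\<in>near_conic_points n (f / 64^n). \<bar>x - z\<bar> \<le> 2^38 / (64^(3*n) * f))"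
        using Bf Bm by blast
    qed
  qed
qed

text \<open>A bound on counts rather than a minimal gap: one point per cell of a grid of mesh L
  satisfies it, although points of adjacent cells may be arbitrarily close.\<close>

definition separated_within :: "real \<Rightarrow> real set \<Rightarrow> bool" where
  "separated_within L Z \<longleftrightarrow> (\<forall>u l. 0 \<le> l \<longrightarrow> finite (Z \<inter> {u..u + l}) \<and> real (card (Z \<inter> {u..u + l})) \<le> l / L + 2)"

text \<open>One point of P is chosen in every grid cell inside [\<open>\<alpha>\<close>,
  \<open>\<beta>\<close>] that contains one. Enlarged by one cell on each side, these cells cover
  [\<open>\<alpha>\<close> + 2L, \<open>\<beta>\<close> - 2L] outside B, so 3 L card J >= w - 4L -
  w/2 >= w/4. A is the union of the \<open>\<sigma>\<close>-neighbourhoods cut to their own cells: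
  the pieces are disjoint, and since \<open>\<sigma>\<close> <= L/2 each keeps length at least
  \<open>\<sigma>\<close>.\<close>

lemma level_set:
  fixes \<alpha> \<beta> L \<sigma> :: real
  assumes L: "0 < L" "L \<le> (\<beta> - \<alpha>) / 16" and \<sigma>: "0 < \<sigma>" "\<sigma> \<le> L / 2"
    and B: "B \<in> fmeasurable lborel" "measure lborel B \<le> (\<beta> - \<alpha>) / 2"
    and P: "\<And>x. x \<in> {\<alpha>..\<beta>} - B \<Longrightarrow> \<exists>z\<in>P. \<bar>x - z\<bar> \<le> L"
  obtains Z A where "finite Z" "Z \<subseteq> P" "separated_within L Z" "real (card Z) \<le> (\<beta> - \<alpha>) / L"
    "A \<in> sets lborel" "A \<subseteq> {\<alpha>..\<beta>}" "A \<subseteq> (\<Union>z\<in>Z. {z - \<sigma>..z + \<sigma>})"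
    "(\<beta> - \<alpha>) * (\<sigma> / L) / 12 \<le> measure lborel A"
proof -
  define w where "w = \<beta> - \<alpha>"
  define J where "J = {i::int. \<alpha> \<le> of_int i * L \<and> (of_int i + 1) * L \<le> \<beta> \<and> (\<exists>z\<in>P. \<lfloor>z / L\<rfloor> = i)}"
  define c where "c = (\<lambda>i. SOME z. z \<in> P \<and> \<lfloor>z / L\<rfloor> = i)"
  have c: "c i \<in> P" "\<lfloor>c i / L\<rfloor> = i" if "i \<in> J" for i
    using that someI_ex[of "\<lambda>z. z \<in> P \<and> \<lfloor>z / L\<rfloor> = i"] by (auto simp: J_def c_def)
  have cell: "of_int i * L \<le> c i" "c i < (of_int i + 1) * L" if "i \<in> J" for i
  proof -
    have "of_int i \<le> c i / L" "c i / L < of_int i + 1" using c(2)[OF that] by linarith+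
    then show "of_int i * L \<le> c i" "c i < (of_int i + 1) * L" using L by (simp_all add: field_simps)
  qed
  define Z where "Z = c ` J"
  have inj: "inj_on c J" by (rule inj_onI) (metis c(2))
  have Jd: "of_int (i - j) \<le> w / L - 1" if "i \<in> J" "j \<in> J" for i j
  proof -
    have "(of_int i + 1) * L - of_int j * L \<le> w" using that by (auto simp: J_def w_def)
    then have "(of_int (i - j) + 1) * L \<le> w" by (simp add: algebra_simps)
    then have "of_int (i - j) + 1 \<le> w / L" using L by (simp add: pos_le_divide_eq)
    then show ?thesis by linarith
  qed
  have wL: "16 \<le> w / L" using L by (simp add: w_def field_simps)
  have finJ: "finite J" by (rule card_congruent_ints(1)[OF zero_less_one _ Jd]) auto
  have cardJ: "real (card J) \<le> w / L"
  proof -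
    have "real (card J) \<le> (w / L - 1) / of_int 1 + 1"
      by (rule card_congruent_ints(2)[OF _ _ Jd]) (use wL in auto)
    then show ?thesis by simp
  qed
  have cardZ: "card Z = card J" unfolding Z_def by (rule card_image[OF inj])
  have sep: "separated_within L Z" unfolding separated_within_def
  proof (intro allI impI)
    fix u l :: real assume l: "0 \<le> l"
    define J' where "J' = {i\<in>J. c i \<in> {u..u + l}}"
    have Z': "Z \<inter> {u..u + l} = c ` J'" by (auto simp: Z_def J'_def)
    have d: "of_int (i - j) \<le> l / L + 1" if "i \<in> J'" "j \<in> J'" for i j
    proof -
      have "of_int i * L \<le> u + l" "u < (of_int j + 1) * L"
        using that cell[of i] cell[of j] by (auto simp: J'_def)
      then have "of_int (i - j) * L \<le> l + L" by (simp add: algebra_simps)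
      then have "of_int (i - j) \<le> (l + L) / L" using L by (simp add: pos_le_divide_eq)
      then show ?thesis using L by (simp add: add_divide_distrib)
    qed
    have "real (card J') \<le> (l / L + 1) / of_int 1 + 1"
      by (rule card_congruent_ints(2)[OF _ _ d]) (use l L in auto)
    moreover have "card (c ` J') = card J'" by (rule card_image[OF inj_on_subset[OF inj]]) (auto simp: J'_def)
    ultimately show "finite (Z \<inter> {u..u + l}) \<and> real (card (Z \<inter> {u..u + l})) \<le> l / L + 2"
      unfolding Z' using finJ by (auto simp: J'_def)
  qed
  define D where "D = (\<lambda>i. {of_int i * L..<(of_int i + 1) * L} \<inter> {c i - \<sigma>..c i + \<sigma>})"
  define A where "A = (\<Union>i\<in>J. D i)"
  have Df: "D i \<in> fmeasurable lborel" for i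
    by (rule fmeasurableI2[OF fmeasurable_compact[OF compact_Icc, of "c i - \<sigma>" "c i + \<sigma>"]]) (auto simp: D_def)
  have D\<sigma>: "\<sigma> \<le> measure lborel (D i)" if i: "i \<in> J" for i
  proof (cases "c i \<le> of_int i * L + L / 2")
    case True
    have "{c i..<c i + \<sigma>} \<subseteq> D i" using True cell[OF i] \<sigma> by (auto simp: D_def algebra_simps)
    then have "measure lborel {c i..<c i + \<sigma>} \<le> measure lborel (D i)"
      by (intro measure_mono_fmeasurable Df) auto
    then show ?thesis using \<sigma> by simp
  next
    case False
    have "{c i - \<sigma>..c i} \<subseteq> D i" using False cell[OF i] \<sigma> by (auto simp: D_def algebra_simps)
    then have "measure lborel {c i - \<sigma>..c i} \<le> measure lborel (D i)"
      by (intro measure_mono_fmeasurable Df) auto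
    then show ?thesis using \<sigma> by simp
  qed
  have disj: "pairwise (\<lambda>i j. disjnt (D i) (D j)) J"
  proof (rule pairwiseI)
    fix i j :: int assume "i \<noteq> j"
    show "disjnt (D i) (D j)"
    proof (rule ccontr)
      assume "\<not> disjnt (D i) (D j)"
      then obtain x where x: "x \<in> D i" "x \<in> D j" by (auto simp: disjnt_def)
      have fl: "\<lfloor>x / L\<rfloor> = k" if "x \<in> D k" for k
        using that L by (intro floor_unique) (auto simp: D_def pos_le_divide_eq pos_divide_less_eq)
      show False using fl[OF x(1)] fl[OF x(2)] \<open>i \<noteq> j\<close> by simp
    qed
  qed
  have mA: "measure lborel A = (\<Sum>i\<in>J. measure lborel (D i))"
    unfolding A_def by (rule measure_UNION'[OF finJ Df disj])
  have "real (card J) * \<sigma> = (\<Sum>i\<in>J. \<sigma>)" by simp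
  also have "\<dots> \<le> measure lborel A" unfolding mA by (rule sum_mono) (rule D\<sigma>)
  finally have lowA: "real (card J) * \<sigma> \<le> measure lborel A" .
  have cov: "{\<alpha> + 2 * L..\<beta> - 2 * L} \<subseteq> B \<union> (\<Union>i\<in>J. {(of_int i - 1) * L..(of_int i + 2) * L})"
  proof
    fix x assume x: "x \<in> {\<alpha> + 2 * L..\<beta> - 2 * L}"
    show "x \<in> B \<union> (\<Union>i\<in>J. {(of_int i - 1) * L..(of_int i + 2) * L})"
    proof (cases "x \<in> B")
      case False
      then have "x \<in> {\<alpha>..\<beta>} - B" using x L by auto
      then obtain z where z: "z \<in> P" "\<bar>x - z\<bar> \<le> L" using P by blast
      define i where "i = \<lfloor>z / L\<rfloor>"
      have "of_int i \<le> z / L" "z / L < of_int i + 1" unfolding i_def by linarith+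
      then have i: "of_int i * L \<le> z" "z < (of_int i + 1) * L" using L by (simp_all add: field_simps)
      then have "z < of_int i * L + L" by (simp add: algebra_simps)
      then have "\<alpha> \<le> of_int i * L" "of_int i * L + L \<le> \<beta>" using x z i by auto
      then have "i \<in> J" using z unfolding J_def i_def by (auto simp: algebra_simps)
      moreover have "x \<in> {(of_int i - 1) * L..(of_int i + 2) * L}"
        using z(2) i \<open>z < of_int i * L + L\<close> by (auto simp: algebra_simps)
      ultimately show ?thesis by blast
    qed auto
  qed
  have mJ: "(\<Union>i\<in>J. {(of_int i - 1) * L..(of_int i + 2) * L}) \<in> fmeasurable lborel"
    by (intro fmeasurable.finite_UN finJ fmeasurable_compact compact_Icc)
  have "w - 4 * L = measure lborel {\<alpha> + 2 * L..\<beta> - 2 * L}" using L by (simp add: w_def)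
  also have "\<dots> \<le> measure lborel (B \<union> (\<Union>i\<in>J. {(of_int i - 1) * L..(of_int i + 2) * L}))"
    by (rule measure_mono_fmeasurable[OF cov _ fmeasurable.Un[OF B(1) mJ]]) simp
  also have "\<dots> \<le> measure lborel B + measure lborel (\<Union>i\<in>J. {(of_int i - 1) * L..(of_int i + 2) * L})"
    by (rule measure_Un_le) (use fmeasurableD[OF B(1)] fmeasurableD[OF mJ] in auto)
  also have "measure lborel (\<Union>i\<in>J. {(of_int i - 1) * L..(of_int i + 2) * L}) \<le> (\<Sum>i\<in>J. measure lborel {(of_int i - 1) * L..(of_int i + 2) * L})"
    by (rule measure_UNION_le[OF finJ]) auto
  also have "\<dots> = (\<Sum>i\<in>J. 3 * L)"
    by (rule sum.cong) (use L in \<open>auto simp: algebra_simps\<close>)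
  finally have "w / 4 \<le> real (card J) * (3 * L)" using B L by (simp add: w_def)
  then have "w / (12 * L) \<le> real (card J)" using L by (simp add: pos_divide_le_eq)
  then have "w / (12 * L) * \<sigma> \<le> real (card J) * \<sigma>" using \<sigma> by (intro mult_right_mono) auto
  then have "w * (\<sigma> / L) / 12 \<le> measure lborel A" using lowA by simp
  then show ?thesis
  proof (intro that[of Z A])
    show "A \<subseteq> {\<alpha>..\<beta>}" by (fastforce simp: A_def D_def J_def)
    show "A \<subseteq> (\<Union>z\<in>Z. {z - \<sigma>..z + \<sigma>})" by (auto simp: A_def D_def Z_def)
    show "A \<in> sets lborel" unfolding A_def by (rule sets.finite_UN[OF finJ fmeasurableD[OF Df]])
    show "Z \<subseteq> P" using c by (auto simp: Z_def)
  qed (use finJ sep cardJ cardZ in \<open>auto simp: Z_def[symmetric] w_def\<close>, simp add: Z_def)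
qed

text \<open>An interval of radius \<open>\<sigma>\<close> meets at most 2(\<open>\<sigma>\<close> +
  \<open>\<sigma>'\<close>)/L' + 2 <= 2 \<open>\<sigma>\<close>/L' + 3 intervals of the other level.
  The part 2 \<open>\<sigma>\<close>/L' yields the product expected of independent sets. The 3
  matters when L' is large compared with \<open>\<sigma>\<close> and leaves
  \<open>6 * (\<sigma>' / L)\<close>, small if the second level is much finer.\<close>

lemma measure_level_inter:
  assumes Z: "finite Z" "real (card Z) \<le> w / L" and A: "A \<in> sets lborel" "A \<subseteq> (\<Union>z\<in>Z. {z - \<sigma>..z + \<sigma>})"
    and Z': "separated_within L' Z'" "finite Z'" and A': "A' \<in> sets lborel" "A' \<subseteq> (\<Union>z\<in>Z'. {z - \<sigma>'..z + \<sigma>'})"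
    and pos: "\<sigma> > 0" "\<sigma>' > 0" "L > 0" "L' > 0" "\<sigma>' \<le> L' / 2" "w \<ge> 0"
  shows "measure lborel (A \<inter> A') \<le> w * (4 * (\<sigma> / L) * (\<sigma>' / L') + 6 * (\<sigma>' / L))"
proof -
  define V where "V = (\<lambda>z. Z' \<inter> {z - \<sigma> - \<sigma>'..z - \<sigma> - \<sigma>' + 2 * (\<sigma> + \<sigma>')})"
  have V: "finite (V z)" "real (card (V z)) \<le> 2 * \<sigma> / L' + 3" for z
  proof -
    have *: "finite (V z) \<and> real (card (V z)) \<le> 2 * (\<sigma> + \<sigma>') / L' + 2"
      using Z'(1) pos unfolding separated_within_def V_def by (elim allE[of _ "z - \<sigma> - \<sigma>'"] allE[of _ "2 * (\<sigma> + \<sigma>')"]) auto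
    then show "finite (V z)" by blast
    have "2 * (\<sigma> + \<sigma>') / L' = 2 * \<sigma> / L' + 2 * \<sigma>' / L'" by (simp add: add_divide_distrib distrib_left)
    moreover have "2 * \<sigma>' / L' \<le> 1" using pos by (simp add: field_simps)
    ultimately show "real (card (V z)) \<le> 2 * \<sigma> / L' + 3" using * by linarith
  qed
  have sub: "A \<inter> A' \<subseteq> (\<Union>z\<in>Z. \<Union>z'\<in>V z. {z' - \<sigma>'..z' + \<sigma>'})"
  proof
    fix x assume "x \<in> A \<inter> A'"
    then obtain z z' where z: "z \<in> Z" "x \<in> {z - \<sigma>..z + \<sigma>}" and z': "z' \<in> Z'" "x \<in> {z' - \<sigma>'..z' + \<sigma>'}"
      using A(2) A'(2) by blast
    then have "z' \<in> V z" by (auto simp: V_def)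
    then show "x \<in> (\<Union>z\<in>Z. \<Union>z'\<in>V z. {z' - \<sigma>'..z' + \<sigma>'})" using z z' by blast
  qed
  have m1: "(\<Union>z'\<in>V z. {z' - \<sigma>'..z' + \<sigma>'}) \<in> fmeasurable lborel" for z
    using measure_UN_intervals_le(1)[OF V(1), of \<sigma>' "\<lambda>z. z" z] pos by simp
  have "measure lborel (A \<inter> A') \<le> measure lborel (\<Union>z\<in>Z. \<Union>z'\<in>V z. {z' - \<sigma>'..z' + \<sigma>'})"
    by (rule measure_mono_fmeasurable[OF sub _ fmeasurable.finite_UN[OF Z(1) m1]]) (use A A' in auto)
  also have "\<dots> \<le> (\<Sum>z\<in>Z. measure lborel (\<Union>z'\<in>V z. {z' - \<sigma>'..z' + \<sigma>'}))"
    by (rule measure_UNION_le[OF Z(1)]) (rule fmeasurableD[OF m1])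
  also have "\<dots> \<le> (\<Sum>z\<in>Z. (2 * \<sigma> / L' + 3) * (2 * \<sigma>'))"
  proof (rule sum_mono)
    fix z
    have "measure lborel (\<Union>z'\<in>V z. {z' - \<sigma>'..z' + \<sigma>'}) \<le> real (card (V z)) * (2 * \<sigma>')"
      using measure_UN_intervals_le(2)[OF V(1), of \<sigma>' "\<lambda>z. z" z] pos by simp
    also have "\<dots> \<le> (2 * \<sigma> / L' + 3) * (2 * \<sigma>')" using V(2) pos by (intro mult_right_mono) auto
    finally show "measure lborel (\<Union>z'\<in>V z. {z' - \<sigma>'..z' + \<sigma>'}) \<le> (2 * \<sigma> / L' + 3) * (2 * \<sigma>')" .
  qed
  also have "\<dots> = real (card Z) * ((2 * \<sigma> / L' + 3) * (2 * \<sigma>'))" by simp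
  also have "\<dots> \<le> (w / L) * ((2 * \<sigma> / L' + 3) * (2 * \<sigma>'))" using Z(2) pos by (intro mult_right_mono) auto
  also have "\<dots> = w * (4 * (\<sigma> / L) * (\<sigma>' / L') + 6 * (\<sigma>' / L))" by (simp add: algebra_simps add_divide_distrib)
  finally show ?thesis .
qed

section \<open>Approximable parameters as a limsup of level sets\<close>

lemma parabola_approximable_borel: "parabola_approximable \<psi> \<in> sets borel"
proof -
  define U where "U = (\<lambda>m::nat. \<Union>q\<in>{q::nat. q \<ge> m \<and> q \<ge> 1}. \<Union>p::int. \<Union>r::int.
     {t. \<bar>real q * t - p\<bar> < \<psi> (real q) \<and> \<bar>real q * t\<^sup>2 - r\<bar> < \<psi> (real q)})"
  have "open (U m)" for m
    unfolding U_def by (intro open_UN ballI open_Collect_conj open_Collect_less continuous_intros)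
  then have "(\<Inter>m. U m) \<in> sets borel" by (intro sets.countable_INT) auto
  also have "(\<Inter>m. U m) = parabola_approximable \<psi>"
    unfolding parabola_approximable_def infinite_nat_iff_unbounded_le U_def
    by (simp only: set_eq_iff INT_iff UN_iff mem_Collect_eq Bex_def) blast
  finally show ?thesis .
qed

text \<open>Use q x^2 - r = (q x - p)(x + z) + (p^2 - q r)/q, where the terms are at most (2T + 1)
  \<open>\<delta>\<close> and 2 \<open>\<delta>\<close>; the constant 2T + 4 makes the inequality
  strict. As q <= 4096^n, monotonicity allows testing \<open>\<psi>\<close> at 4096^n. The lower
  bound on q later yields infinitely many q.\<close>

lemma near_conic_point_approximates:
  fixes x T \<delta> \<sigma> :: real
  assumes z: "z \<in> near_conic_points n \<delta>" and x: "\<bar>x - z\<bar> \<le> \<sigma>" "\<bar>x\<bar> \<le> T"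
    and s: "4096^n * \<sigma> \<le> \<delta>" "\<sigma> \<le> 1" and \<delta>: "\<delta> > 0" and \<psi>: "(2 * T + 4) * \<delta> \<le> \<psi> (4096^n)"
    and anti: "antimono_on {0<..} \<psi>"
  shows "\<exists>q::nat. 4096^(n-3) \<le> q \<and> (\<exists>(p::int) (r::int). \<bar>real q * x - p\<bar> < \<psi> (real q) \<and> \<bar>real q * x\<^sup>2 - r\<bar> < \<psi> (real q))"
proof -
  obtain q p r :: int where q: "4096^(n-3) \<le> q" "q \<le> 4096^n" and zq: "z = of_int p / of_int q"
    and r: "\<bar>of_int (p\<^sup>2 - q * r)\<bar> \<le> 2 * of_int q * \<delta>"
    using z by (auto simp: near_conic_points_def)
  have "(0::int) < 4096^(n-3)" by simp
  then have q0: "q > 0" using q(1) by linarith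
  have T0: "T \<ge> 0" using x(2) by linarith
  have q0': "real_of_int q > 0" using q0 by simp
  have qN: "real_of_int q \<le> 4096^n" using q(2) by (metis of_int_le_iff of_int_numeral of_int_power)
  have \<psi>q: "\<psi> (4096^n) \<le> \<psi> (of_int q)"
    using anti q0' qN by (auto simp: monotone_on_def)
  have "\<bar>of_int q * x - of_int p\<bar> = of_int q * \<bar>x - z\<bar>"
  proof -
    have "of_int q * x - of_int p = of_int q * (x - z)" using q0' by (simp add: zq right_diff_distrib)
    then show ?thesis using q0' by (simp add: abs_mult)
  qed
  also have "\<dots> \<le> 4096^n * \<sigma>" using x qN q0' by (intro mult_mono) auto
  finally have 1: "\<bar>of_int q * x - of_int p\<bar> \<le> \<delta>" using s by linarith
  have pz: "of_int p = of_int q * z" using q0' by (simp add: zq)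
  have "of_int q * x\<^sup>2 - of_int r = (of_int q * x - of_int p) * (x + z) + of_int (p\<^sup>2 - q * r) / of_int q"
    using q0' by (simp add: pz power2_eq_square field_simps)
  then have "\<bar>of_int q * x\<^sup>2 - of_int r\<bar> \<le> \<bar>(of_int q * x - of_int p) * (x + z)\<bar> + \<bar>of_int (p\<^sup>2 - q * r) / of_int q\<bar>"
    by (metis abs_triangle_ineq)
  also have "\<dots> = \<bar>of_int q * x - of_int p\<bar> * \<bar>x + z\<bar> + \<bar>of_int (p\<^sup>2 - q * r)\<bar> / of_int q"
    using q0' by (simp add: abs_mult abs_divide)
  also have "\<dots> \<le> \<delta> * (2 * T + 1) + 2 * \<delta>"
  proof (intro add_mono mult_mono)
    show "\<bar>x + z\<bar> \<le> 2 * T + 1" using x s by linarith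
    show "\<bar>of_int (p\<^sup>2 - q * r)\<bar> / of_int q \<le> 2 * \<delta>" using r q0' by (simp add: pos_divide_le_eq algebra_simps)
  qed (use 1 \<delta> in auto)
  also have "\<dots> < (2 * T + 4) * \<delta>" using \<delta> by (simp add: algebra_simps)
  finally have 2: "\<bar>of_int q * x\<^sup>2 - of_int r\<bar> < \<psi> (of_int q)" using \<psi> \<psi>q by linarith
  have "(2 * T + 4) * \<delta> = 2 * (T * \<delta>) + 4 * \<delta>" by (simp add: algebra_simps)
  moreover have "0 \<le> T * \<delta>" using \<delta> T0 by simp
  ultimately have "\<delta> < (2 * T + 4) * \<delta>" using \<delta> by linarith
  then have 3: "\<bar>of_int q * x - of_int p\<bar> < \<psi> (of_int q)" using 1 \<psi> \<psi>q by linarith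
  have "4096^(n-3) \<le> nat q" using q(1) by (simp add: le_nat_iff)
  moreover have "real (nat q) = of_int q" using q0 by simp
  ultimately show ?thesis using 2 3 by (intro exI[of _ "nat q"]) auto
qed

text \<open>At level n the spacing L comes from \<open>bad_set_small\<close> and the radius is
  \<open>\<sigma>\<close> = \<open>\<delta>\<close>/4096^n with \<open>\<delta>\<close> = f/64^n.
  Then \<open>\<sigma>\<close>/L = f^2/2^38, where f^2 is the term of the condensed series up to a
  constant. The interval affects only f and \<open>n0\<close>, so the proportion obtained is
  independent of it.\<close>

lemma limsup_parabola_measure:
  fixes a b :: real
  assumes anti: "antimono_on {0<..} \<psi>" and pos: "\<And>x. x > 0 \<Longrightarrow> \<psi> x > 0"
    and nsm: "\<not> summable (\<lambda>n. 4096^n * (\<psi> (4096^n))\<^sup>2)" and ab: "a < b"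
  shows "(1 / (12 * 2^38))\<^sup>2 / 20 * (b - a) \<le> measure lebesgue (parabola_approximable \<psi> \<inter> {a..b})"
proof -
  define w where "w = b - a"
  have w: "w > 0" using ab by (simp add: w_def)
  define T where "T = max \<bar>a\<bar> \<bar>b\<bar>"
  have T: "\<bar>x\<bar> \<le> T" if "x \<in> {a..b}" for x using that by (auto simp: T_def)
  have T0: "T \<ge> 0" by (simp add: T_def)
  \<comment> \<open>The cap is the one of \<open>bad_set_small\<close>, the divisor 2T + 4 the
    constant of \<open>near_conic_point_approximates\<close>. Passing to f discards the levels where
    g < 1/(8192 (n+1)), whose squares are summable.\<close>
  define g where "g = (\<lambda>n. min (1 / 8192) (64^n * \<psi> (4096^n) / (2 * T + 4)))"
  define f where "f = (\<lambda>n. if 1 / (8192 * (real n + 1)) \<le> g n then g n else 0)"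
  have \<psi>p: "\<psi> (4096^n) > 0" for n by (rule pos) simp
  have g0: "g n > 0" for n using \<psi>p[of n] T0 by (simp add: g_def)
  have g1: "g n \<le> 1 / 8192" for n unfolding g_def by (rule min.cobounded1)
  have f0: "0 \<le> f n" "f n \<le> 1 / 8192" "f n \<le> g n" for n using g0[of n] g1[of n] by (auto simp: f_def)
  have fpos: "1 / (8192 * (real n + 1)) \<le> f n" "f n > 0" "f n = g n" if "f n \<noteq> 0" for n
    using that g0[of n] by (auto simp: f_def split: if_splits)
  have nsf: "\<not> summable (\<lambda>n. (f n)\<^sup>2)"
  proof
    assume sf: "summable (\<lambda>n. (f n)\<^sup>2)"
    have "summable (\<lambda>n. (f n)\<^sup>2 + 1 / (real n + 1)^2)"
      using inverse_power_summable[of 2, where 'a=real] 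
      by (intro summable_add sf) (auto simp: inverse_eq_divide summable_Suc_iff[of "\<lambda>n. 1 / (real n)^2", symmetric] add.commute)
    then have sg: "summable (\<lambda>n. (g n)\<^sup>2)"
    proof (rule summable_comparison_test_ev[rotated], intro always_eventually allI)
      fix n
      show "norm ((g n)\<^sup>2) \<le> (f n)\<^sup>2 + 1 / (real n + 1)^2"
      proof (cases "f n = g n")
        case False
        then have "g n \<le> 1 / (8192 * (real n + 1))" by (auto simp: f_def split: if_splits)
        also have "\<dots> \<le> 1 / (real n + 1)" by (intro divide_left_mono) auto
        finally have "(g n)\<^sup>2 \<le> (1 / (real n + 1))\<^sup>2" using g0[of n] by (intro power_mono) auto
        then show ?thesis by (simp add: power_divide add_increasing)
      qed simp
    qed
    \<comment> \<open>Since g tends to 0 the cap is eventually inactive, and g^2 is then a constant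
      multiple of the term of the divergent series.\<close>
    have "(\<lambda>n. sqrt ((g n)\<^sup>2)) \<longlonglongrightarrow> sqrt 0" by (intro tendsto_real_sqrt summable_LIMSEQ_zero[OF sg])
    then have "g \<longlonglongrightarrow> 0" using g0 by (simp add: less_imp_le)
    then have "\<forall>\<^sub>F n in sequentially. g n < 1 / 8192" by (rule order_tendstoD) simp
    then have "\<forall>\<^sub>F n in sequentially. norm (4096^n * (\<psi> (4096^n))\<^sup>2) \<le> (2 * T + 4)\<^sup>2 * (g n)\<^sup>2"
    proof eventually_elim
      case (elim n)
      then have "g n = 64^n * \<psi> (4096^n) / (2 * T + 4)" by (auto simp: g_def min_def split: if_splits)
      then have "64^n * \<psi> (4096^n) = (2 * T + 4) * g n" using T0 by (simp add: field_simps)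
      moreover have "4096^n * (\<psi> (4096^n))\<^sup>2 = (64^n * \<psi> (4096^n))\<^sup>2"
        by (simp add: power2_eq_square flip: power_mult_distrib)
      ultimately show ?case by (simp add: power_mult_distrib)
    qed
    then have "summable (\<lambda>n. 4096^n * (\<psi> (4096^n))\<^sup>2)"
      by (rule summable_comparison_test_ev) (intro summable_mult sg)
    then show False using nsm by blast
  qed
  define \<sigma> where "\<sigma> = (\<lambda>n. f n / 64^(3*n))"
  define L where "L = (\<lambda>n. 2^38 / (64^(3*n) * f n))"
  have ev: "\<forall>\<^sub>F n in sequentially. 2^51 * (real n + 1) / 64^(3*n) < w / 16"
  proof -
    have "(\<lambda>n. 2^51 * (real n + 1) / 64^(3*n)) \<longlonglongrightarrow> 0" by real_asymp
    then show ?thesis by (rule order_tendstoD) (use w in simp)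
  qed
  obtain n0 where n0: "\<And>n f. n \<ge> n0 \<Longrightarrow> 1 / (8192 * (real n + 1)) \<le> f \<Longrightarrow> f \<le> 1 / 8192 \<Longrightarrow>
    (\<exists>B\<in>fmeasurable lborel. measure lborel B \<le> (b - a) / 2 \<and>
      (\<forall>x\<in>{a..b} - B. \<exists>z\<in>near_conic_points n (f / 64^n). \<bar>x - z\<bar> \<le> 2^38 / (64^(3*n) * f)))"
    and n0': "\<And>n. n \<ge> n0 \<Longrightarrow> 2^51 * (real n + 1) / 64^(3*n) < w / 16"
    using eventually_conj[OF bad_set_small[OF ab] ev] unfolding eventually_sequentially by blast
  define good where "good = (\<lambda>n. n \<ge> n0 \<and> f n \<noteq> 0)"
  have \<sigma>L: "\<sigma> n > 0" "L n > 0" "\<sigma> n / L n = (f n)\<^sup>2 / 2^38" "\<sigma> n \<le> L n / 2" if "good n" for n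
  proof -
    have fp: "f n > 0" using fpos that by (auto simp: good_def)
    then show "\<sigma> n > 0" "L n > 0" by (auto simp: \<sigma>_def L_def)
    show e: "\<sigma> n / L n = (f n)\<^sup>2 / 2^38" using fp by (simp add: \<sigma>_def L_def power2_eq_square)
    have "(f n)\<^sup>2 \<le> 1\<^sup>2" using f0[of n] by (intro power_mono) auto
    then have "\<sigma> n / L n \<le> 1 / 2" unfolding e by simp
    then show "\<sigma> n \<le> L n / 2" using \<open>L n > 0\<close> by (simp add: field_simps)
  qed
  define level where "level = (\<lambda>n Z A. finite Z \<and> Z \<subseteq> near_conic_points n (f n / 64^n) \<and> separated_within (L n) Z \<and>
    real (card Z) \<le> (b - a) / L n \<and> A \<in> sets lborel \<and> A \<subseteq> {a..b} \<and> A \<subseteq> (\<Union>z\<in>Z. {z - \<sigma> n..z + \<sigma> n}) \<and>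
    (b - a) * (\<sigma> n / L n) / 12 \<le> measure lborel A)"
  have "\<exists>Z A. level n Z A" if gn: "good n" for n
  proof -
    have n: "n \<ge> n0" and fn: "f n \<noteq> 0" using gn by (auto simp: good_def)
    note fp = fpos[OF fn]
    have "L n \<le> 2^38 / (64^(3*n) * (1 / (8192 * (real n + 1))))"
      unfolding L_def using fp by (intro divide_left_mono mult_left_mono mult_pos_pos) auto
    also have "\<dots> = 2^51 * (real n + 1) / 64^(3*n)" by simp
    finally have Lw: "L n \<le> (b - a) / 16" using n0'[OF n] unfolding w_def by linarith
    from n0[OF n fp(1) f0(2)] obtain B where B: "B \<in> fmeasurable lborel" "measure lborel B \<le> (b - a) / 2"
      "\<And>x. x \<in> {a..b} - B \<Longrightarrow> \<exists>z\<in>near_conic_points n (f n / 64^n). \<bar>x - z\<bar> \<le> L n"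
      unfolding L_def by blast
    show ?thesis
      by (rule level_set[OF \<sigma>L(2)[OF gn] Lw \<sigma>L(1)[OF gn] \<sigma>L(4)[OF gn] B], assumption)
         (unfold level_def, intro exI conjI)
  qed
  then obtain Z A' where lev: "\<And>n. good n \<Longrightarrow> level n (Z n) (A' n)" by metis
  define A where "A = (\<lambda>n. if good n then A' n else {})"
  have Aeq: "A n = A' n" if "good n" for n using that by (simp add: A_def)
  have Am: "A n \<in> sets lborel" "A n \<subseteq> {a..b}" for n
    using lev[of n] by (auto simp: A_def level_def)
  have "(1 / (12 * 2^38))\<^sup>2 / (20 * 1) * w \<le> measure lborel (limsup A)"
  proof (rule measure_limsup_ge_second_moment[where F="\<lambda>n. (f n)\<^sup>2" and I="{a..b}" and ?n0.0=n0])
    show "{a..b} \<in> fmeasurable lborel" by (rule fmeasurable_compact[OF compact_Icc])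
    show "(f n)\<^sup>2 \<le> 1" for n using f0[of n] by (intro power_le_one) auto
    show "1 / (12 * 2^38) * w * (f n)\<^sup>2 \<le> measure lborel (A n)" if "n \<ge> n0" for n
    proof (cases "f n = 0")
      case False
      then have gn: "good n" using that by (simp add: good_def)
      have "(b - a) * (\<sigma> n / L n) / 12 \<le> measure lborel (A n)" using lev[OF gn] Aeq[OF gn] by (simp add: level_def)
      then show ?thesis unfolding \<sigma>L(3)[OF gn] by (simp add: w_def)
    qed simp
    show "measure lborel (A n \<inter> A m) \<le> 1 * w * ((f n)\<^sup>2 * (f m)\<^sup>2 + (1/2)^(m - n) * ((f n)\<^sup>2 + (f m)\<^sup>2))"
      if "n0 \<le> n" "n \<le> m" for n m
    proof (cases "good n \<and> good m")
      case False
      then have "A n \<inter> A m = {}" by (auto simp: A_def)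
      then show ?thesis using w by simp
    next
      case True
      then have gn: "good n" and gm: "good m" by auto
      have "measure lborel (A' n \<inter> A' m) \<le> w * (4 * (\<sigma> n / L n) * (\<sigma> m / L m) + 6 * (\<sigma> m / L n))"
        by (rule measure_level_inter[of "Z n" _ _ _ _ _ "Z m"])
           (use lev[OF gn] lev[OF gm] \<sigma>L[OF gn] \<sigma>L[OF gm] w in \<open>auto simp: level_def w_def\<close>)
      also have "\<dots> \<le> w * ((f n)\<^sup>2 * (f m)\<^sup>2 + (1/2)^(m - n) * ((f n)\<^sup>2 + (f m)\<^sup>2))"
      proof (intro mult_left_mono add_mono)
        show "4 * (\<sigma> n / L n) * (\<sigma> m / L m) \<le> (f n)\<^sup>2 * (f m)\<^sup>2"
          unfolding \<sigma>L(3)[OF gn] \<sigma>L(3)[OF gm] by (simp add: field_simps)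
        have fnm: "f n * f m \<le> (f n)\<^sup>2 + (f m)\<^sup>2"
        proof -
          have "0 \<le> (f n - f m)\<^sup>2" by simp
          moreover have "0 \<le> f n * f m" using f0 by simp
          ultimately show ?thesis by (simp add: power2_eq_square algebra_simps)
        qed
        \<comment> \<open>Apart from the factor f n f m, the quotient \<open>\<sigma>\<close> m / L
          n shrinks by 64^3 with each step of m: the source of the decay in m - n.\<close>
        have "(64::real)^(3*m) = 64^(3*n) * 64^(3*(m-n))" using that by (simp flip: power_add)
        then have "\<sigma> m / L n = f n * f m * (1 / 64^(3*(m-n))) / 2^38"
          by (simp add: \<sigma>_def L_def)
        also have "\<dots> \<le> ((f n)\<^sup>2 + (f m)\<^sup>2) * (1/2)^(m-n) / 2^38"
        proof (intro divide_right_mono mult_mono fnm)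
          have "1 / (64::real)^(3*(m-n)) = (1/262144)^(m-n)" by (simp add: power_mult power_divide)
          also have "\<dots> \<le> (1/2)^(m-n)" by (intro power_mono) auto
          finally show "1 / (64::real)^(3*(m-n)) \<le> (1/2)^(m-n)" .
        qed auto
        finally have "\<sigma> m / L n \<le> ((f n)\<^sup>2 + (f m)\<^sup>2) * (1/2)^(m-n) / 2^38" .
        then have "6 * (\<sigma> m / L n) \<le> 6 * (((f n)\<^sup>2 + (f m)\<^sup>2) * (1/2)^(m-n) / 2^38)"
          by (rule mult_left_mono) simp
        also have "\<dots> = (6 / 2^38) * ((1/2)^(m-n) * ((f n)\<^sup>2 + (f m)\<^sup>2))" by (simp add: mult.commute)
        also have "\<dots> \<le> 1 * ((1/2)^(m-n) * ((f n)\<^sup>2 + (f m)\<^sup>2))" by (intro mult_right_mono) auto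
        finally show "6 * (\<sigma> m / L n) \<le> (1/2)^(m - n) * ((f n)\<^sup>2 + (f m)\<^sup>2)" by simp
      qed (use w in auto)
      finally show ?thesis using gn gm Aeq by simp
    qed
  qed (use Am nsf w in auto)
  also have "\<dots> = measure lebesgue (limsup A)"
    by (rule measure_completion[symmetric]) (use Am in \<open>auto simp: limsup_INF_SUP\<close>)
  also have "\<dots> \<le> measure lebesgue (parabola_approximable \<psi> \<inter> {a..b})"
  proof (rule measure_mono_fmeasurable)
    show "limsup A \<subseteq> parabola_approximable \<psi> \<inter> {a..b}"
    proof
      fix x assume "x \<in> limsup A"
      then have io: "\<exists>n\<ge>k. x \<in> A n" for k by (auto simp: limsup_INF_SUP)
      have xab: "x \<in> {a..b}" using io[of 0] Am by blast
      have "\<exists>q\<ge>m. q \<in> {q::nat. q \<ge> 1 \<and> (\<exists>(p::int) (r::int). \<bar>real q * x - p\<bar> < \<psi> (real q) \<and> \<bar>real q * x\<^sup>2 - r\<bar> < \<psi> (real q))}" for m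
      proof -
        obtain n where n: "n \<ge> m + 4" "x \<in> A n" using io by blast
        have gn: "good n" using n by (auto simp: A_def split: if_splits)
        note fp = fpos[OF conjunct2[OF gn[unfolded good_def]]]
        have l: "level n (Z n) (A n)" using lev[OF gn] Aeq[OF gn] by simp
        obtain z where z: "z \<in> Z n" "x \<in> {z - \<sigma> n..z + \<sigma> n}" using l n(2) unfolding level_def by blast
        have zn: "z \<in> near_conic_points n (f n / 64^n)" using z l unfolding level_def by blast
        have "\<exists>q::nat. 4096^(n-3) \<le> q \<and> (\<exists>(p::int) (r::int). \<bar>real q * x - p\<bar> < \<psi> (real q) \<and> \<bar>real q * x\<^sup>2 - r\<bar> < \<psi> (real q))"
        proof (rule near_conic_point_approximates[OF zn _ T[OF xab] _ _ _ _ anti])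
          show "\<bar>x - z\<bar> \<le> \<sigma> n" using z by auto
          have "(64::real)^(3*n) = 4096^n * 64^n" by (simp add: power_mult flip: power_mult_distrib)
          then show "4096^n * \<sigma> n \<le> f n / 64^n" by (simp add: \<sigma>_def)
          have "\<sigma> n \<le> (1 / 8192) / 1" unfolding \<sigma>_def using f0[of n] by (intro frac_le) auto
          then show "\<sigma> n \<le> 1" by simp
          show "f n / 64^n > 0" using fp by simp
          have "f n \<le> 64^n * \<psi> (4096^n) / (2 * T + 4)" unfolding fp(3) g_def by simp
          then show "(2 * T + 4) * (f n / 64^n) \<le> \<psi> (4096^n)" using T0 by (simp add: field_simps)
        qed
        then obtain q :: nat where q: "4096^(n-3) \<le> q"
          "\<exists>(p::int) (r::int). \<bar>real q * x - p\<bar> < \<psi> (real q) \<and> \<bar>real q * x\<^sup>2 - r\<bar> < \<psi> (real q)" by blast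
        have "n - 3 < 4096^(n-3)" by (rule less_le_trans[OF less_exp]) (simp add: power_mono)
        then have "q \<ge> m" "q \<ge> 1" using q(1) n(1) by linarith+
        then show ?thesis using q(2) by blast
      qed
      then show "x \<in> parabola_approximable \<psi> \<inter> {a..b}"
        using xab unfolding parabola_approximable_def infinite_nat_iff_unbounded_le by blast
    qed
    have "limsup A \<in> sets lborel" using Am by (auto simp: limsup_INF_SUP)
    then show "limsup A \<in> sets lebesgue" by (rule sets_completionI_sets)
    show "parabola_approximable \<psi> \<inter> {a..b} \<in> lmeasurable"
    proof -
      have "parabola_approximable \<psi> \<in> sets lebesgue"
        using parabola_approximable_borel[of \<psi>] by (intro sets_completionI_sets) simp
      moreover have "{a..b} \<in> lmeasurable" by simp
      ultimately show ?thesis by (metis Int_commute fmeasurable_Int_fmeasurable)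
    qed
  qed
  finally show ?thesis by (simp add: w_def)
qed

lemma parabola_full:
  assumes "antimono_on {0<..} \<psi>" and "\<And>x. x > 0 \<Longrightarrow> \<psi> x > 0"
    and "\<not> summable (\<lambda>n. 4096^n * (\<psi> (4096^n))\<^sup>2)"
  shows "negligible (- parabola_approximable \<psi>)"
proof (rule negligible_complement_if_uniformly_positive)
  show "parabola_approximable \<psi> \<in> sets lebesgue"
    using parabola_approximable_borel[of \<psi>] by (intro sets_completionI_sets) simp
  show "(0::real) < (1 / (12 * 2^38))\<^sup>2 / 20" by simp
qed (rule limsup_parabola_measure[OF assms])

section \<open>One-dimensional Hausdorff null sets\<close>

lemma hausdorff1_pre_zeroI:
  assumes "\<And>e. e > 0 \<Longrightarrow> \<exists>U::nat \<Rightarrow> 'a::metric_space set. A \<subseteq> (\<Union>i. U i) \<and>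
    (\<forall>i. bounded (U i) \<and> diameter (U i) \<le> \<delta>) \<and> (\<Sum>i. ennreal (diameter (U i))) \<le> ennreal e"
  shows "hausdorff1_pre \<delta> A = 0"
proof -
  have "hausdorff1_pre \<delta> A \<le> 0 + ennreal e" if e: "e > 0" for e
  proof -
    obtain U :: "nat \<Rightarrow> 'a set" where U: "A \<subseteq> (\<Union>i. U i)" "\<forall>i. bounded (U i) \<and> diameter (U i) \<le> \<delta>"
      "(\<Sum>i. ennreal (diameter (U i))) \<le> ennreal e" using assms[OF e] by blast
    have "hausdorff1_pre \<delta> A \<le> (\<Sum>i. ennreal (diameter (U i)))"
      unfolding hausdorff1_pre_def by (rule INF_lower) (use U in auto)
    then show ?thesis using U(3) by simp
  qed
  then have "hausdorff1_pre \<delta> A \<le> 0" by (rule ennreal_le_epsilon)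
  then show ?thesis by simp
qed

lemma hausdorff1_pre_zeroD:
  fixes A :: "'a::metric_space set"
  assumes "hausdorff1_pre \<delta> A = 0" "e > 0"
  obtains U :: "nat \<Rightarrow> 'a set" where "A \<subseteq> (\<Union>i. U i)" "\<And>i. bounded (U i)" "\<And>i. diameter (U i) \<le> \<delta>"
    "(\<Sum>i. ennreal (diameter (U i))) < ennreal e"
proof -
  have "hausdorff1_pre \<delta> A < ennreal e" using assms by simp
  then show ?thesis unfolding hausdorff1_pre_def INF_less_iff using that by blast
qed

lemma hausdorff1_pre_zero_subset:
  assumes "hausdorff1_pre \<delta> B = 0" "A \<subseteq> B"
  shows "hausdorff1_pre \<delta> A = 0"
proof (rule hausdorff1_pre_zeroI, goal_cases)
  case (1 e)
  from hausdorff1_pre_zeroD[OF assms(1) this] obtain U where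
    "B \<subseteq> (\<Union>i. U i)" "\<And>i. bounded (U i)" "\<And>i. diameter (U i) \<le> \<delta>" "(\<Sum>i. ennreal (diameter (U i))) < ennreal e"
    by blast
  then show ?case using assms(2) by (intro exI[of _ U]) auto
qed

lemma hausdorff1_pre_zero_UN:
  fixes A :: "nat \<Rightarrow> 'a::metric_space set"
  assumes "\<And>n. hausdorff1_pre \<delta> (A n) = 0"
  shows "hausdorff1_pre \<delta> (\<Union>n. A n) = 0"
proof (rule hausdorff1_pre_zeroI, goal_cases)
  case e: (1 e)
  have "\<exists>U::nat \<Rightarrow> 'a set. A n \<subseteq> (\<Union>i. U i) \<and> (\<forall>i. bounded (U i) \<and> diameter (U i) \<le> \<delta>) \<and>
      (\<Sum>i. ennreal (diameter (U i))) \<le> ennreal (e * (1/2)^Suc n)" for n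
  proof -
    have "0 < e * (1/2)^Suc n" using e by simp
    from hausdorff1_pre_zeroD[OF assms this] show ?thesis by (metis less_imp_le)
  qed
  then obtain U :: "nat \<Rightarrow> nat \<Rightarrow> 'a set" where U: "\<And>n. A n \<subseteq> (\<Union>i. U n i)"
    "\<And>n i. bounded (U n i) \<and> diameter (U n i) \<le> \<delta>"
    "\<And>n. (\<Sum>i. ennreal (diameter (U n i))) \<le> ennreal (e * (1/2)^Suc n)" by metis
  define V where "V = (\<lambda>k. case prod_decode k of (n, i) \<Rightarrow> U n i)"
  have "(\<Sum>k. ennreal (diameter (V k))) = (\<Sum>n. \<Sum>i. ennreal (diameter (U n i)))"
    using suminf_ennreal_2dimen[of "\<lambda>n. \<Sum>i. ennreal (diameter (U n i))" "\<lambda>(n, i). ennreal (diameter (U n i))"]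
    by (simp add: V_def case_prod_beta)
  also have "\<dots> \<le> (\<Sum>n. ennreal (e * (1/2)^Suc n))" by (intro suminf_le U) auto
  also have "\<dots> = ennreal (\<Sum>n. e * (1/2)^Suc n)"
    by (rule suminf_ennreal2) (use e power_half_series in \<open>auto intro!: summable_mult simp: sums_iff\<close>)
  also have "(\<Sum>n. e * (1/2)^Suc n) = e"
    using sums_mult[OF power_half_series, of e] by (simp add: sums_iff)
  finally have "(\<Sum>k. ennreal (diameter (V k))) \<le> ennreal e" .
  moreover have "(\<Union>n. A n) \<subseteq> (\<Union>k. V k)"
  proof
    fix x assume "x \<in> (\<Union>n. A n)"
    then obtain n i where "x \<in> U n i" using U(1) by blast
    then have "x \<in> V (prod_encode (n, i))" by (simp add: V_def)
    then show "x \<in> (\<Union>k. V k)" by blast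
  qed
  moreover have "bounded (V k) \<and> diameter (V k) \<le> \<delta>" for k
    using U(2) by (simp add: V_def case_prod_beta)
  ultimately show ?case
    by (intro exI[of _ V]) auto
qed

lemma hausdorff1_zero_iff: "hausdorff1 A = 0 \<longleftrightarrow> (\<forall>\<delta>>0. hausdorff1_pre \<delta> A = 0)"
proof -
  have "hausdorff1 A = 0 \<longleftrightarrow> hausdorff1 A \<le> 0" by simp
  also have "\<dots> \<longleftrightarrow> (\<forall>\<delta>>0. hausdorff1_pre \<delta> A = 0)" unfolding hausdorff1_def SUP_le_iff by auto
  finally show ?thesis .
qed

lemma hausdorff1_zero_subset: "hausdorff1 B = 0 \<Longrightarrow> A \<subseteq> B \<Longrightarrow> hausdorff1 A = 0"
  using hausdorff1_pre_zero_subset unfolding hausdorff1_zero_iff by blast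

lemma hausdorff1_zero_Un:
  assumes "hausdorff1 A = 0" "hausdorff1 B = 0" shows "hausdorff1 (A \<union> B) = 0"
proof -
  have "(\<Union>n::nat. if n = 0 then A else B) = A \<union> B" by (auto split: if_splits)
  then show ?thesis using assms hausdorff1_pre_zero_UN[where A="\<lambda>n. if n = 0 then A else B"]
    unfolding hausdorff1_zero_iff by (metis (full_types))
qed

lemma hausdorff1_singleton: "hausdorff1 {x} = 0"
  unfolding hausdorff1_zero_iff
  by (intro allI impI hausdorff1_pre_zeroI exI[of _ "\<lambda>i. {x}"]) auto

lemma hausdorff1_finite: "finite F \<Longrightarrow> hausdorff1 F = 0"
proof (induction F rule: finite_induct)
  case empty
  show ?case by (rule hausdorff1_zero_subset[OF hausdorff1_singleton]) auto
next
  case (insert x F)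
  then show ?case using hausdorff1_zero_Un[OF hausdorff1_singleton[of x], of F] by simp
qed

section \<open>Null sets of parameters have null images on a curve\<close>

lemma hausdorff1_pre_lipschitz_image:
  fixes f :: "real \<Rightarrow> 'a::real_normed_vector"
  assumes neg: "negligible Z" and Z: "Z \<subseteq> {u..v}" and k: "k > 0" "k * (v - u) \<le> \<delta>" "u < v"
    and lip: "\<And>x y. x \<in> Z \<Longrightarrow> y \<in> Z \<Longrightarrow> norm (f x - f y) \<le> k * \<bar>x - y\<bar>"
  shows "hausdorff1_pre \<delta> (f ` Z) = 0"
proof (rule hausdorff1_pre_zeroI, goal_cases)
  case e: (1 e)
  then have ek: "e / k > 0" using k by simp
  have Zm: "Z \<in> lmeasurable" "measure lebesgue Z = 0" using neg by (auto simp: negligible_iff_measure)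
  \<comment> \<open>Intervals inside [u, v] have images of diameter at most k (v - u) <=
    \<open>\<delta>\<close>, and total length at most e/k gives total diameter at most e.\<close>
  obtain \<D> where D: "countable \<D>"
    "\<And>K. K \<in> \<D> \<Longrightarrow> K \<subseteq> cbox u v \<and> K \<noteq> {} \<and> (\<exists>c d. K = cbox c d)"
    "pairwise (\<lambda>A B. interior A \<inter> interior B = {}) \<D>"
    "Z \<subseteq> \<Union>\<D>" "\<Union>\<D> \<in> lmeasurable" "measure lebesgue (\<Union>\<D>) \<le> measure lebesgue Z + e / k"
    by (rule measurable_outer_intervals_bounded[OF Zm(1) _ ek, of u v]) (use Z in auto)
  define I where "I = to_nat_on \<D> ` \<D>"
  define U where "U = (\<lambda>i. if i \<in> I then f ` (Z \<inter> from_nat_into \<D> i) else {})"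
  have fn: "from_nat_into \<D> i \<in> \<D>" if "i \<in> I" for i using that D(1) by (auto simp: I_def)
  have diamK: "norm (f x - f y) \<le> k * measure lebesgue K" "bounded (f ` (Z \<inter> K))"
    if K: "K \<in> \<D>" and "x \<in> Z \<inter> K" "y \<in> Z \<inter> K" for K x y
  proof -
    obtain c d where cd: "K = {c..d}" using D(2)[OF K] by (auto simp: cbox_interval)
    have *: "norm (f x - f y) \<le> k * measure lebesgue K" if "x \<in> Z \<inter> K" "y \<in> Z \<inter> K" for x y
    proof -
      have "norm (f x - f y) \<le> k * \<bar>x - y\<bar>" using lip that by auto
      also have "\<dots> \<le> k * (d - c)" using that cd k by (intro mult_left_mono) auto
      also have "\<dots> = k * measure lebesgue K" using that cd by simp
      finally show ?thesis .
    qed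
    then show "norm (f x - f y) \<le> k * measure lebesgue K" using that by blast
    have "norm z \<le> norm (f x) + k * measure lebesgue K" if "z \<in> f ` (Z \<inter> K)" for z
      using that *[OF _ \<open>x \<in> Z \<inter> K\<close>] norm_triangle_sub[of z "f x"] by force
    then show "bounded (f ` (Z \<inter> K))" by (auto simp: bounded_iff)
  qed
  have dU: "diameter (U i) \<le> k * measure lebesgue (from_nat_into \<D> i)" if i: "i \<in> I" for i
    unfolding U_def using i k diamK(1)[OF fn[OF i]] by (auto intro!: diameter_le)
  have bU: "bounded (U i)" for i
  proof (cases "U i = {}")
    case False
    then obtain x where "i \<in> I" "x \<in> Z \<inter> from_nat_into \<D> i" by (auto simp: U_def split: if_splits)
    then show ?thesis using diamK(2)[OF fn, of i x x] by (simp add: U_def)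
  qed auto
  have "diameter (U i) \<le> \<delta>" for i
  proof (cases "i \<in> I")
    case True
    have "measure lebesgue (from_nat_into \<D> i) \<le> measure lebesgue {u..v}"
      using D(2)[OF fn[OF True]] by (intro measure_mono_fmeasurable) (auto simp: cbox_interval)
    also have "\<dots> = v - u" using k by simp
    finally have "k * measure lebesgue (from_nat_into \<D> i) \<le> k * (v - u)" using k by (intro mult_left_mono) auto
    then show ?thesis using dU[OF True] k by linarith
  next
    case False
    have "0 \<le> k * (v - u)" using k by simp
    then have "0 \<le> \<delta>" using k(2) by linarith
    then show ?thesis using False by (simp add: U_def)
  qed
  moreover have "f ` Z \<subseteq> (\<Union>i. U i)"
  proof
    fix y assume "y \<in> f ` Z"
    then obtain x where x: "x \<in> Z" "y = f x" by blast
    then obtain K where K: "K \<in> \<D>" "x \<in> K" using D(4) by blast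
    have "y \<in> U (to_nat_on \<D> K)" using x K D(1) by (auto simp: U_def I_def)
    then show "y \<in> (\<Union>i. U i)" by blast
  qed
  moreover have "(\<Sum>i. ennreal (diameter (U i))) \<le> ennreal e"
  proof -
    have "(\<Sum>i<n. ennreal (diameter (U i))) \<le> ennreal e" for n
    proof -
      define J where "J = {i\<in>I. i < n}"
      define \<F> where "\<F> = from_nat_into \<D> ` J"
      have inj: "inj_on (from_nat_into \<D>) J"
        by (rule inj_on_inverseI[of _ "to_nat_on \<D>"]) (use D(1) in \<open>auto simp: J_def I_def\<close>)
      have F: "finite \<F>" "\<F> \<subseteq> \<D>" using fn by (auto simp: \<F>_def J_def)
      have Km: "K \<in> lmeasurable" if "K \<in> \<F>" for K using D(2) F that by blast
      have "(\<Sum>i<n. ennreal (diameter (U i))) = (\<Sum>i\<in>J. ennreal (diameter (U i)))"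
        by (rule sum.mono_neutral_right) (auto simp: J_def U_def)
      also have "\<dots> \<le> (\<Sum>i\<in>J. ennreal (k * measure lebesgue (from_nat_into \<D> i)))"
        by (intro sum_mono ennreal_leI dU) (auto simp: J_def)
      also have "\<dots> = ennreal (\<Sum>i\<in>J. k * measure lebesgue (from_nat_into \<D> i))"
        using k by (intro sum_ennreal) auto
      also have "(\<Sum>i\<in>J. k * measure lebesgue (from_nat_into \<D> i)) = k * (\<Sum>K\<in>\<F>. measure lebesgue K)"
        unfolding \<F>_def by (simp add: sum.reindex[OF inj] sum_distrib_left)
      also have "(\<Sum>K\<in>\<F>. measure lebesgue K) = measure lebesgue (\<Union>\<F>)"
      proof (rule measure_negligible_finite_Union[symmetric, OF F(1) Km])
        show "pairwise (\<lambda>S T. negligible (S \<inter> T)) \<F>"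
        proof (rule pairwiseI)
          fix K K' assume K: "K \<in> \<F>" "K' \<in> \<F>" "K \<noteq> K'"
          then have "interior K \<inter> interior K' = {}" using D(3) F(2) by (auto simp: pairwise_def)
          then show "negligible (K \<inter> K')" by (rule negligible_Int_boxes) (use D(2) F(2) K in blast)+
        qed
      qed
      also have "measure lebesgue (\<Union>\<F>) \<le> measure lebesgue (\<Union>\<D>)"
        by (rule measure_mono_fmeasurable) (use F Km D(5) in \<open>auto intro!: fmeasurableD fmeasurable.finite_Union\<close>)
      also have "\<dots> \<le> e / k" using D(6) Zm by simp
      finally show ?thesis using k by (simp add: ennreal_leI mult_left_mono)
    qed
    then show ?thesis unfolding suminf_eq_SUP by (intro SUP_least)
  qed
  ultimately show ?case
    using bU by (intro exI[of _ U]) auto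
qed

text \<open>One integer k controls both the slope and the radius, so that the points at which k
  works give a countable decomposition.\<close>

lemma differentiable_locally_lipschitz_at:
  fixes f :: "real \<Rightarrow> 'a::real_normed_vector"
  assumes "f differentiable (at t)"
  shows "\<exists>k::nat. \<forall>s. \<bar>s - t\<bar> < 1 / (real k + 1) \<longrightarrow> norm (f s - f t) \<le> real k * \<bar>s - t\<bar>"
proof -
  obtain f' where f': "(f has_derivative f') (at t)" using assms by (auto simp: differentiable_def)
  then have bl: "bounded_linear f'" and "\<forall>e>0. \<exists>d>0. \<forall>y. norm (y - t) < d \<longrightarrow> norm (f y - f t - f' (y - t)) \<le> e * norm (y - t)"
    by (auto simp: has_derivative_at_alt)
  then obtain d where d: "d > 0" "\<And>y. norm (y - t) < d \<Longrightarrow> norm (f y - f t - f' (y - t)) \<le> 1 * norm (y - t)"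
    using zero_less_one by blast
  obtain B where B: "\<And>x. norm (f' x) \<le> norm x * B" using bounded_linear.bounded[OF bl] by blast
  obtain k :: nat where k: "real k > max (B + 1) (1 / d)" using reals_Archimedean2 by blast
  have "norm (f s - f t) \<le> real k * \<bar>s - t\<bar>" if s: "\<bar>s - t\<bar> < 1 / (real k + 1)" for s
  proof -
    have "1 / (real k + 1) < d" using k d(1) by (simp add: field_simps)
    then have "norm (f s - f t - f' (s - t)) \<le> \<bar>s - t\<bar>" using d(2)[of s] s by simp
    then have "norm (f s - f t) \<le> \<bar>s - t\<bar> + norm (f' (s - t))"
      using norm_triangle_sub[of "f s - f t" "f' (s - t)"] by linarith
    also have "\<dots> \<le> \<bar>s - t\<bar> + \<bar>s - t\<bar> * B" using B[of "s - t"] by simp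
    also have "\<dots> = (B + 1) * \<bar>s - t\<bar>" by (simp add: algebra_simps)
    also have "\<dots> \<le> real k * \<bar>s - t\<bar>" using k by (intro mult_right_mono) auto
    finally show ?thesis .
  qed
  then show ?thesis by blast
qed

text \<open>The Lipschitz constants are only pointwise. Z splits into the sets P k where k works at
  scale 1/(k+1), and these into cells shorter than that scale; on each piece f is uniformly
  Lipschitz, and countably many pieces suffice.\<close>

lemma hausdorff1_differentiable_image:
  fixes f :: "real \<Rightarrow> 'a::real_normed_vector"
  assumes neg: "negligible Z" and diff: "\<And>t. t \<in> Z \<Longrightarrow> f differentiable (at t)"
  shows "hausdorff1 (f ` Z) = 0"
  unfolding hausdorff1_zero_iff
proof (intro allI impI)
  fix \<delta> :: real assume \<delta>: "\<delta> > 0"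
  define P where "P = (\<lambda>k::nat. {t\<in>Z. \<forall>s. \<bar>s - t\<bar> < 1 / (real k + 1) \<longrightarrow> norm (f s - f t) \<le> real k * \<bar>s - t\<bar>})"
  \<comment> \<open>Short enough for two points of one cell to satisfy the inequality defining P k,
    and for the image of a cell to have diameter at most \<open>\<delta>\<close>.\<close>
  define h where "h = (\<lambda>k::nat. min (1 / (2 * (real k + 1))) (\<delta> / (real k + 1)))"
  define R where "R = (\<lambda>(k::nat) (j::nat). P k \<inter> {of_int (int_decode j) * h k..(of_int (int_decode j) + 1) * h k})"
  have h: "h k > 0" "h k < 1 / (real k + 1)" "(real k + 1) * h k \<le> \<delta>" for k
  proof -
    show "h k > 0" using \<delta> by (simp add: h_def)
    have "h k \<le> 1 / (2 * (real k + 1))" by (simp add: h_def)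
    also have "\<dots> < 1 / (real k + 1)" by (simp add: field_simps)
    finally show "h k < 1 / (real k + 1)" .
    have "h k \<le> \<delta> / (real k + 1)" by (simp add: h_def)
    then show "(real k + 1) * h k \<le> \<delta>" by (simp add: pos_le_divide_eq mult.commute)
  qed
  have "hausdorff1_pre \<delta> (f ` R k j) = 0" for k j
  proof (rule hausdorff1_pre_lipschitz_image[where k="real k + 1"])
    show "negligible (R k j)" by (rule negligible_subset[OF neg]) (auto simp: R_def P_def)
    show "R k j \<subseteq> {of_int (int_decode j) * h k..(of_int (int_decode j) + 1) * h k}" by (auto simp: R_def)
    show "(real k + 1) * ((of_int (int_decode j) + 1) * h k - of_int (int_decode j) * h k) \<le> \<delta>"
      using h(3)[of k] by (simp add: algebra_simps)
    show "of_int (int_decode j) * h k < (of_int (int_decode j) + 1) * h k" using h(1)[of k] by (simp add: algebra_simps)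
    fix x y assume xy: "x \<in> R k j" "y \<in> R k j"
    then have "\<bar>x - y\<bar> \<le> h k" by (auto simp: R_def algebra_simps)
    then have "\<bar>x - y\<bar> < 1 / (real k + 1)" using h(2)[of k] by linarith
    then have "norm (f x - f y) \<le> real k * \<bar>x - y\<bar>" using xy(2) by (simp add: R_def P_def)
    also have "\<dots> \<le> (real k + 1) * \<bar>x - y\<bar>" by (intro mult_right_mono) auto
    finally show "norm (f x - f y) \<le> (real k + 1) * \<bar>x - y\<bar>" .
  qed auto
  then have "hausdorff1_pre \<delta> (\<Union>k. \<Union>j. f ` R k j) = 0" by (intro hausdorff1_pre_zero_UN)
  moreover have "f ` Z \<subseteq> (\<Union>k. \<Union>j. f ` R k j)"
  proof
    fix y assume "y \<in> f ` Z"
    then obtain t where t: "t \<in> Z" "y = f t" by blast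
    obtain k where k: "t \<in> P k" using differentiable_locally_lipschitz_at[OF diff[OF t(1)]] t(1) by (auto simp: P_def)
    define j where "j = int_encode \<lfloor>t / h k\<rfloor>"
    have "of_int \<lfloor>t / h k\<rfloor> \<le> t / h k" "t / h k \<le> of_int \<lfloor>t / h k\<rfloor> + 1" by linarith+
    then have "of_int \<lfloor>t / h k\<rfloor> * h k \<le> t" "t \<le> (of_int \<lfloor>t / h k\<rfloor> + 1) * h k"
      using pos_le_divide_eq[OF h(1)] pos_divide_le_eq[OF h(1)] by blast+
    then have "t \<in> R k j" using k by (simp add: R_def j_def)
    then show "y \<in> (\<Union>k. \<Union>j. f ` R k j)" using t by blast
  qed
  ultimately show "hausdorff1_pre \<delta> (f ` Z) = 0" by (rule hausdorff1_pre_zero_subset)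
qed

section \<open>Rational projective maps\<close>

lemma dist_nearest_int_less_iff: "dist_nearest_int x < e \<longleftrightarrow> (\<exists>m::int. \<bar>x - m\<bar> < e)"
proof
  assume "dist_nearest_int x < e"
  moreover have "(\<int> :: real set) \<noteq> {}" using Ints_0 by blast
  ultimately have "(INF a\<in>\<int>. dist x a) < e" by (simp add: dist_nearest_int_def infdist_def)
  then obtain a where "a \<in> \<int>" "dist x a < e"
    by (subst (asm) cINF_less_iff) (auto intro!: bdd_belowI2[where m=0])
  then show "\<exists>m::int. \<bar>x - m\<bar> < e" by (auto elim!: Ints_cases simp: dist_real_def)
next
  assume "\<exists>m::int. \<bar>x - m\<bar> < e"
  then obtain m :: int where "\<bar>x - m\<bar> < e" by blast
  moreover have "infdist x \<int> \<le> dist x (of_int m)" by (rule infdist_le) simp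
  ultimately show "dist_nearest_int x < e" by (simp add: dist_nearest_int_def dist_real_def)
qed

lemma simul_approximable_iff:
  "y \<in> simul_approximable \<psi> \<longleftrightarrow> infinite {q::nat. q \<ge> 1 \<and>
     (\<exists>(p::int) (r::int). \<bar>real q * y$1 - p\<bar> < \<psi> (real q) \<and> \<bar>real q * y$2 - r\<bar> < \<psi> (real q))}"
  unfolding simul_approximable_def mem_Collect_eq max_less_iff_conj dist_nearest_int_less_iff
  by (simp only: ex_simps)

text \<open>Passing from \<open>y\<close> to \<open>y'\<close> preserves approximability up to rescaling \<open>\<psi>\<close>; the scaling
  factor is a power of \<open>4096\<close>, which only shifts the condensed series below.\<close>

definition approximation_transfers :: "real^2 \<Rightarrow> real^2 \<Rightarrow> bool" where
  "approximation_transfers y y' \<longleftrightarrow> (\<forall>D. \<exists>j::nat. \<forall>\<psi>. antimono_on {0<..} \<psi> \<longrightarrow>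
     (\<forall>\<^sub>F x in at_top. \<psi> x \<le> D) \<longrightarrow> y \<in> simul_approximable \<psi> \<longrightarrow>
     y' \<in> simul_approximable (\<lambda>x. 4096^j * \<psi> (x / 4096^j)))"

lemma antimono_on_rescale:
  fixes \<psi> :: "real \<Rightarrow> real"
  assumes "antimono_on {0<..} \<psi>" "c > 0" "d \<ge> 0"
  shows "antimono_on {0<..} (\<lambda>x. d * \<psi> (c * x))"
  using assms by (auto simp: monotone_on_def intro!: mult_left_mono)

text \<open>The intermediate function is eventually bounded by 4096^j D, and it is this bound that
  selects the second exponent.\<close>

lemma approximation_transfers_trans:
  assumes "approximation_transfers x y" "approximation_transfers y z"
  shows "approximation_transfers x z"
  unfolding approximation_transfers_def
proof (rule allI, goal_cases)
  case (1 D)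
  obtain j where j: "\<And>\<psi>. antimono_on {0<..} \<psi> \<Longrightarrow> (\<forall>\<^sub>F x in at_top. \<psi> x \<le> D) \<Longrightarrow> x \<in> simul_approximable \<psi> \<Longrightarrow>
     y \<in> simul_approximable (\<lambda>x. 4096^j * \<psi> (x / 4096^j))"
    using assms(1) unfolding approximation_transfers_def by blast
  obtain k where k: "\<And>\<psi>. antimono_on {0<..} \<psi> \<Longrightarrow> (\<forall>\<^sub>F x in at_top. \<psi> x \<le> 4096^j * D) \<Longrightarrow> y \<in> simul_approximable \<psi> \<Longrightarrow>
     z \<in> simul_approximable (\<lambda>x. 4096^k * \<psi> (x / 4096^k))"
    using assms(2) unfolding approximation_transfers_def by blast
  show ?case
  proof (intro exI[of _ "k + j"] allI impI)
    fix \<psi> :: "real \<Rightarrow> real"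
    assume a: "antimono_on {0<..} \<psi>" "\<forall>\<^sub>F x in at_top. \<psi> x \<le> D" "x \<in> simul_approximable \<psi>"
    define \<phi> where "\<phi> = (\<lambda>x. 4096^j * \<psi> (x / 4096^j))"
    have "antimono_on {0<..} \<phi>" unfolding \<phi>_def using antimono_on_rescale[OF a(1), of "1 / 4096^j" "4096^j"] by simp
    moreover have "\<forall>\<^sub>F x in at_top. \<phi> x \<le> 4096^j * D"
    proof -
      have "filterlim (\<lambda>x::real. x / 4096^j) at_top at_top"
        by (rule filterlim_at_top_mult_tendsto_pos[of "\<lambda>x. 1 / 4096^j", where g="\<lambda>x. x", THEN filterlim_cong[THEN iffD1, rotated -1]])
           (auto intro!: filterlim_ident always_eventually)
      from eventually_compose_filterlim[OF a(2) this] show ?thesis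
        by eventually_elim (simp add: \<phi>_def)
    qed
    moreover have "y \<in> simul_approximable \<phi>" unfolding \<phi>_def by (rule j[OF a])
    ultimately have "z \<in> simul_approximable (\<lambda>x. 4096^k * \<phi> (x / 4096^k))" by (rule k)
    then show "z \<in> simul_approximable (\<lambda>x. 4096^(k + j) * \<psi> (x / 4096^(k + j)))"
      by (simp add: \<phi>_def power_add mult.assoc)
  qed
qed

lemma finite_rats_common_denominator:
  assumes "finite S" "S \<subseteq> (\<rat> :: real set)"
  shows "\<exists>c::int. c > 0 \<and> (\<forall>x\<in>S. of_int c * x \<in> \<int>)"
  using assms
proof (induction S rule: finite_induct)
  case empty
  then show ?case by (intro exI[of _ 1]) auto
next
  case (insert x S)
  then obtain c :: int where c: "c > 0" "\<forall>x\<in>S. of_int c * x \<in> \<int>" by auto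
  obtain a b :: int where ab: "b > 0" "x = of_int a / of_int b"
    using insert.prems by (metis Rats_cases' insert_subset)
  have "of_int (b * c) * x \<in> \<int>" using ab by simp
  moreover have "of_int (b * c) * y \<in> \<int>" if "y \<in> S" for y
    using c(2) that Ints_mult[OF Ints_of_int, of "of_int c * y" b] by (auto simp: mult.assoc)
  ultimately show ?case using ab c by (intro exI[of _ "b * c"]) auto
qed

lemma error_combination_bound:
  fixes e1 e2 \<epsilon> H m1 m2 :: real
  assumes "\<bar>e1\<bar> \<le> \<epsilon>" "\<bar>e2\<bar> \<le> \<epsilon>" "\<bar>m1\<bar> \<le> H" "\<bar>m2\<bar> \<le> H"
  shows "\<bar>m1 * e1 + m2 * e2\<bar> \<le> 2 * H * \<epsilon>"
proof -
  have "\<bar>m1 * e1\<bar> \<le> H * \<epsilon>" "\<bar>m2 * e2\<bar> \<le> H * \<epsilon>" unfolding abs_mult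
    by (intro mult_mono; use assms in auto)+
  then show ?thesis by linarith
qed

text \<open>The matrix m acts on the integer vector (q, p, r). The new denominator is q d minus a
  combination of the old errors, and the new errors are bounded combinations of the old ones. The
  eventual bound D on \<open>\<psi>\<close> keeps the correction to the denominator bounded.\<close>

lemma integer_projective_transfers:
  fixes m :: "nat \<Rightarrow> nat \<Rightarrow> int" and y y' :: "real^2"
  defines "d \<equiv> m 0 0 + m 0 1 * y$1 + m 0 2 * y$2"
  assumes d: "d \<noteq> 0"
    and y1: "d * y'$1 = m 1 0 + m 1 1 * y$1 + m 1 2 * y$2"
    and y2: "d * y'$2 = m 2 0 + m 2 1 * y$1 + m 2 2 * y$2"
  shows "approximation_transfers y y'"
  unfolding approximation_transfers_def
proof (rule allI, goal_cases)
  case (1 D)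
  define H where "H = real_of_int (\<bar>m 0 1\<bar> + \<bar>m 0 2\<bar> + \<bar>m 1 1\<bar> + \<bar>m 1 2\<bar> + \<bar>m 2 1\<bar> + \<bar>m 2 2\<bar>)"
  define Y where "Y = max \<bar>y'$1\<bar> \<bar>y'$2\<bar>"
  define D' where "D' = max D 0"
  have H: "H \<ge> 0" "\<bar>real_of_int (m 0 1)\<bar> \<le> H" "\<bar>real_of_int (m 0 2)\<bar> \<le> H" "\<bar>real_of_int (m 1 1)\<bar> \<le> H"
     "\<bar>real_of_int (m 1 2)\<bar> \<le> H" "\<bar>real_of_int (m 2 1)\<bar> \<le> H" "\<bar>real_of_int (m 2 2)\<bar> \<le> H"
    unfolding H_def by auto
  have Y: "Y \<ge> 0" "\<bar>y'$1\<bar> \<le> Y" "\<bar>y'$2\<bar> \<le> Y" by (auto simp: Y_def)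
  have D': "D' \<ge> 0" "D \<le> D'" by (auto simp: D'_def)
  \<comment> \<open>The first entry is the factor lost in the errors, the second the growth of the
    denominator; neither involves \<open>\<psi>\<close>.\<close>
  obtain j :: nat where "max (2 * H + Y * (2 * H)) (\<bar>d\<bar> + 2 * H * D') < real j" using reals_Archimedean2 by blast
  also have "real j < 4096^j"
  proof -
    have "real j < 2^j" by (rule of_nat_less_two_power)
    also have "\<dots> \<le> 4096^j" by (intro power_mono) auto
    finally show ?thesis .
  qed
  finally have j: "2 * H + Y * (2 * H) < 4096^j" "\<bar>d\<bar> + 2 * H * D' < 4096^j" by auto
  show ?case
  proof (intro exI[of _ j] allI impI)
    fix \<psi> :: "real \<Rightarrow> real"
    assume anti: "antimono_on {0<..} \<psi>" and ev: "\<forall>\<^sub>F x in at_top. \<psi> x \<le> D" and ya: "y \<in> simul_approximable \<psi>"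
    obtain x0 where x0: "\<And>x. x \<ge> x0 \<Longrightarrow> \<psi> x \<le> D" using ev by (auto simp: eventually_at_top_linorder)
    have "\<exists>Q\<ge>M. Q \<in> {q::nat. q \<ge> 1 \<and> (\<exists>(p::int) (r::int). \<bar>real q * y'$1 - p\<bar> < 4096^j * \<psi> (real q / 4096^j) \<and>
        \<bar>real q * y'$2 - r\<bar> < 4096^j * \<psi> (real q / 4096^j))}" for M
    proof -
      \<comment> \<open>Beyond M' the bound D is in force and |Q| exceeds M, so new denominators are
        arbitrarily large.\<close>
      obtain M' :: nat where M': "real M' \<ge> max x0 ((2 * H * D' + real M + 1) / \<bar>d\<bar>)"
        using real_arch_simple by blast
      obtain q :: nat and p r :: int where q: "q \<ge> M'" "q \<ge> 1"
        and pr: "\<bar>real q * y$1 - p\<bar> < \<psi> (real q)" "\<bar>real q * y$2 - r\<bar> < \<psi> (real q)"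
        using ya unfolding simul_approximable_iff infinite_nat_iff_unbounded_le by blast
      define e1 where "e1 = real q * y$1 - p"
      define e2 where "e2 = real q * y$2 - r"
      define \<epsilon> where "\<epsilon> = \<psi> (real q)"
      have e: "\<bar>e1\<bar> \<le> \<epsilon>" "\<bar>e2\<bar> \<le> \<epsilon>" "\<epsilon> > 0" using pr by (auto simp: e1_def e2_def \<epsilon>_def)
      have "real q \<ge> x0" using q M' by linarith
      then have eD: "\<epsilon> \<le> D'" using x0[of "real q"] D' by (simp add: \<epsilon>_def)
      define Q where "Q = m 0 0 * int q + m 0 1 * p + m 0 2 * r"
      define P where "P = m 1 0 * int q + m 1 1 * p + m 1 2 * r"
      define R where "R = m 2 0 * int q + m 2 1 * p + m 2 2 * r"
      have p: "real_of_int p = real q * y$1 - e1" "real_of_int r = real q * y$2 - e2" by (auto simp: e1_def e2_def)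
      have Q: "real_of_int Q = real q * d - (m 0 1 * e1 + m 0 2 * e2)"
        unfolding Q_def d_def of_int_add of_int_mult of_int_of_nat_eq p by (simp add: algebra_simps)
      have P: "real_of_int P = real q * (d * y'$1) - (m 1 1 * e1 + m 1 2 * e2)"
        unfolding P_def y1 of_int_add of_int_mult of_int_of_nat_eq p by (simp add: algebra_simps)
      have R: "real_of_int R = real q * (d * y'$2) - (m 2 1 * e1 + m 2 2 * e2)"
        unfolding R_def y2 of_int_add of_int_mult of_int_of_nat_eq p by (simp add: algebra_simps)
      have b0: "\<bar>m 0 1 * e1 + m 0 2 * e2\<bar> \<le> 2 * H * \<epsilon>" and b1: "\<bar>m 1 1 * e1 + m 1 2 * e2\<bar> \<le> 2 * H * \<epsilon>"
        and b2: "\<bar>m 2 1 * e1 + m 2 2 * e2\<bar> \<le> 2 * H * \<epsilon>"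
        by (intro error_combination_bound e H)+
      have HD: "2 * H * \<epsilon> \<le> 2 * H * D'" using H(1) eD by (intro mult_left_mono) auto
      have qd: "\<bar>real q * d\<bar> = real q * \<bar>d\<bar>" by (simp add: abs_mult)
      have "(2 * H * D' + real M + 1) / \<bar>d\<bar> \<le> real q" using q M' by linarith
      then have "2 * H * D' + real M + 1 \<le> real q * \<bar>d\<bar>" using d by (simp add: pos_divide_le_eq)
      then have Qlow: "real M + 1 \<le> \<bar>real_of_int Q\<bar>" unfolding Q using b0 HD qd by linarith
      have Qup: "\<bar>real_of_int Q\<bar> \<le> 4096^j * real q"
      proof -
        have "2 * H * D' * 1 \<le> 2 * H * D' * real q" using q H D' by (intro mult_left_mono) auto
        then have "\<bar>real_of_int Q\<bar> \<le> (\<bar>d\<bar> + 2 * H * D') * real q" unfolding Q using b0 HD qd by (simp add: algebra_simps)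
        also have "\<dots> \<le> 4096^j * real q" using j by (intro mult_right_mono) auto
        finally show ?thesis .
      qed
      have Qpos: "\<bar>real_of_int Q\<bar> > 0" using Qlow by linarith
      have "\<epsilon> \<le> \<psi> (\<bar>real_of_int Q\<bar> / 4096^j)"
      proof -
        have "\<bar>real_of_int Q\<bar> / 4096^j \<le> real q" using Qup by (simp add: pos_divide_le_eq mult.commute)
        then show ?thesis using anti Qpos q unfolding \<epsilon>_def monotone_on_def by auto
      qed
      then have key: "(2 * H + Y * (2 * H)) * \<epsilon> < 4096^j * \<psi> (\<bar>real_of_int Q\<bar> / 4096^j)"
        using j(1) e(3) by (intro mult_less_le_imp_less) (use H Y in auto)
      have gen: "\<bar>of_int Q * v - of_int V\<bar> < 4096^j * \<psi> (\<bar>real_of_int Q\<bar> / 4096^j)"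
        if V: "real_of_int V = real q * (d * v) - c" "\<bar>c\<bar> \<le> 2 * H * \<epsilon>" "\<bar>v\<bar> \<le> Y" for V v c
      proof -
        have "of_int Q * v - of_int V = c - v * (m 0 1 * e1 + m 0 2 * e2)" unfolding Q V(1) by (simp add: algebra_simps)
        then have "\<bar>of_int Q * v - of_int V\<bar> \<le> \<bar>c\<bar> + \<bar>v\<bar> * \<bar>m 0 1 * e1 + m 0 2 * e2\<bar>"
          by (metis abs_triangle_ineq4 abs_mult)
        also have "\<dots> \<le> 2 * H * \<epsilon> + Y * (2 * H * \<epsilon>)"
          using V b0 Y by (intro add_mono mult_mono) auto
        also have "\<dots> = (2 * H + Y * (2 * H)) * \<epsilon>" by (simp add: algebra_simps)
        finally show ?thesis using key by linarith
      qed
      \<comment> \<open>Q has the sign of d, possibly negative; the whole new vector is multiplied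
        by that sign.\<close>
      define s where "s = sgn Q"
      have sQ: "s * Q = \<bar>Q\<bar>" "\<bar>s\<bar> = 1" using Qpos by (auto simp: s_def sgn_if)
      define N where "N = nat \<bar>Q\<bar>"
      have N: "real N = \<bar>real_of_int Q\<bar>" by (simp add: N_def)
      have sg: "\<bar>real N * v - of_int (s * V)\<bar> = \<bar>of_int Q * v - of_int V\<bar>" for v V
      proof -
        have "real N = of_int (s * Q)" using sQ N by simp
        then have "real N * v - of_int (s * V) = of_int s * (of_int Q * v - of_int V)" by (simp add: algebra_simps)
        moreover have "\<bar>real_of_int s\<bar> = 1" using sQ(2) by (metis of_int_1 of_int_abs)
        ultimately show ?thesis by (simp add: abs_mult)
      qed
      have "\<bar>real N * y'$1 - of_int (s * P)\<bar> < 4096^j * \<psi> (real N / 4096^j)"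
        by (subst sg, subst N, rule gen[OF P b1 Y(2)])
      moreover have "\<bar>real N * y'$2 - of_int (s * R)\<bar> < 4096^j * \<psi> (real N / 4096^j)"
        by (subst sg, subst N, rule gen[OF R b2 Y(3)])
      moreover have "N \<ge> M" "N \<ge> 1" using Qlow N by linarith+
      ultimately show ?thesis by (intro exI[of _ N]) blast
    qed
    then show "y' \<in> simul_approximable (\<lambda>x. 4096^j * \<psi> (x / 4096^j))"
      unfolding simul_approximable_iff infinite_nat_iff_unbounded_le by blast
  qed
qed

lemma rational_projective_transfers:
  fixes m :: "nat \<Rightarrow> nat \<Rightarrow> real" and y y' :: "real^2"
  defines "d \<equiv> m 0 0 + m 0 1 * y$1 + m 0 2 * y$2"
  assumes d: "d \<noteq> 0" and m: "\<And>i k. i < 3 \<Longrightarrow> k < 3 \<Longrightarrow> m i k \<in> \<rat>"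
    and y1: "d * y'$1 = m 1 0 + m 1 1 * y$1 + m 1 2 * y$2"
    and y2: "d * y'$2 = m 2 0 + m 2 1 * y$1 + m 2 2 * y$2"
  shows "approximation_transfers y y'"
proof -
  have "finite ((\<lambda>(i, k). m i k) ` ({..<3} \<times> {..<3}))" "(\<lambda>(i, k). m i k) ` ({..<3} \<times> {..<3}) \<subseteq> \<rat>"
    using m by auto
  from finite_rats_common_denominator[OF this] obtain c :: int
    where c: "c > 0" "\<And>i k. i < 3 \<Longrightarrow> k < 3 \<Longrightarrow> of_int c * m i k \<in> \<int>" by auto
  define n where "n = (\<lambda>i k. \<lfloor>of_int c * m i k\<rfloor>)"
  have n: "real_of_int (n i k) = of_int c * m i k" if "i < 3" "k < 3" for i k
    using c(2)[OF that] by (auto simp: n_def elim: Ints_cases)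
  have e: "n i 0 + n i 1 * y$1 + n i 2 * y$2 = of_int c * (m i 0 + m i 1 * y$1 + m i 2 * y$2)" if "i < 3" for i
    using that by (simp add: n algebra_simps)
  show ?thesis
  proof (rule integer_projective_transfers[of n])
    show "n 0 0 + n 0 1 * y$1 + n 0 2 * y$2 \<noteq> 0" using d c e[of 0] by (simp add: d_def)
    show "(n 0 0 + n 0 1 * y$1 + n 0 2 * y$2) * y'$1 = n 1 0 + n 1 1 * y$1 + n 1 2 * y$2"
      using e[of 0] e[of 1] y1 by (simp add: d_def mult.assoc)
    show "(n 0 0 + n 0 1 * y$1 + n 0 2 * y$2) * y'$2 = n 2 0 + n 2 1 * y$1 + n 2 2 * y$2"
      using e[of 0] e[of 2] y2 by (simp add: d_def mult.assoc)
  qed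
qed

section \<open>Rational quadrics\<close>

text \<open>Cauchy condensation with ratio 4096. As g h is f at h + 1, the block starting at index
  4096^k has arguments from 4096^k + 1 to 4096^Suc k and is bounded below by its last value. The
  block starting at 4096^k - 1 has arguments from 4096^k on and is bounded above by its first
  value.\<close>

lemma condensation_4096:
  fixes f :: "real \<Rightarrow> real"
  assumes anti: "antimono_on {0<..} f" and nonneg: "\<And>x. x > 0 \<Longrightarrow> f x \<ge> 0"
  shows "summable (\<lambda>h::nat. f (real (Suc h))) \<longleftrightarrow> summable (\<lambda>n. 4096^n * f (4096^n))"
proof -
  define g where "g = (\<lambda>h::nat. f (real (Suc h)))"
  have mono: "f y \<le> f x" if "0 < x" "x \<le> y" for x y using anti that by (auto simp: monotone_on_def)
  have g0: "g h \<ge> 0" for h by (simp add: g_def nonneg)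
  have c0: "0 \<le> 4096^n * f (4096^n)" for n by (simp add: nonneg)
  have low: "4096^Suc k * f (4096^Suc k) \<le> 2 * sum g {4096^k..<4096^Suc k}" for k :: nat
  proof -
    have "f (4096^Suc k) \<le> g h" if "h \<in> {4096^k..<4096^Suc k}" for h
    proof -
      have "real (Suc h) \<le> real (4096^Suc k)" using that by (simp only: of_nat_le_iff) auto
      then show ?thesis unfolding g_def by (intro mono) auto
    qed
    then have "real (card {4096^k..<4096^Suc k::nat}) * f (4096^Suc k) \<le> sum g {4096^k..<4096^Suc k}"
      by (intro sum_bounded_below) auto
    moreover have "4096^Suc k * f (4096^Suc k) \<le> 2 * (real (card {4096^k..<4096^Suc k::nat}) * f (4096^Suc k))"
      using nonneg[of "4096^Suc k"] by (simp add: of_nat_diff)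
    ultimately show ?thesis by linarith
  qed
  have up: "sum g {4096^k - 1..<4096^Suc k - 1} \<le> 4096 * (4096^k * f (4096^k))" for k :: nat
  proof -
    have "g h \<le> f (4096^k)" if "h \<in> {4096^k - 1..<4096^Suc k - 1}" for h
    proof -
      have "4096^k \<le> Suc h" using that by auto
      then have "real (4096^k) \<le> real (Suc h)" by (simp only: of_nat_le_iff)
      then show ?thesis unfolding g_def by (intro mono) auto
    qed
    then have "sum g {4096^k - 1..<4096^Suc k - 1} \<le> real (card {4096^k - 1..<4096^Suc k - 1::nat}) * f (4096^k)"
      by (intro sum_bounded_above) auto
    also have "\<dots> \<le> real (4096^Suc k) * f (4096^k)"
      by (intro mult_right_mono nonneg) (simp_all only: of_nat_le_iff, auto)
    finally show ?thesis by simp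
  qed
  have A: "(\<Sum>n\<le>m. 4096^n * f (4096^n)) \<le> 2 * sum g {..<4096^m}" for m
  proof (induction m)
    case 0
    show ?case using nonneg[of 1] by (simp add: g_def)
  next
    case (Suc m)
    have "(4096::nat)^m \<le> 4096^Suc m" by simp
    then have "sum g {..<4096^Suc m} = sum g {..<4096^m} + sum g {4096^m..<4096^Suc m}"
      by (subst sum.union_disjoint[symmetric]) (auto intro!: sum.cong simp: ivl_disj_un)
    then show ?case using Suc low[of m] by simp
  qed
  have B: "sum g {..<4096^m - 1} \<le> 4096 * (\<Sum>n<m. 4096^n * f (4096^n))" for m
  proof (induction m)
    case (Suc m)
    have "(4096::nat)^m - 1 \<le> 4096^Suc m - 1" by (intro diff_le_mono) simp
    then have "sum g {..<4096^Suc m - 1} = sum g {..<4096^m - 1} + sum g {4096^m - 1..<4096^Suc m - 1}"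
      by (subst sum.union_disjoint[symmetric]) (auto intro!: sum.cong simp: ivl_disj_un)
    then show ?case using Suc up[of m] by (simp add: distrib_left)
  qed simp
  show ?thesis unfolding g_def[symmetric]
  proof
    assume s: "summable g"
    show "summable (\<lambda>n. 4096^n * f (4096^n))"
    proof (rule summableI_nonneg_bounded[where x="2 * suminf g"])
      fix n
      have "(\<Sum>i<n. 4096^i * f (4096^i)) \<le> (\<Sum>i\<le>n. 4096^i * f (4096^i))"
        by (rule sum_mono2) (use c0 in auto)
      also have "\<dots> \<le> 2 * sum g {..<4096^n}" by (rule A)
      also have "\<dots> \<le> 2 * suminf g" by (intro mult_left_mono sum_le_suminf s) (use g0 in auto)
      finally show "(\<Sum>i<n. 4096^i * f (4096^i)) \<le> 2 * suminf g" .
    qed (rule c0)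
  next
    assume s: "summable (\<lambda>n. 4096^n * f (4096^n))"
    show "summable g"
    proof (rule summableI_nonneg_bounded[where x="4096 * (\<Sum>n. 4096^n * f (4096^n))"])
      fix n :: nat
      have "Suc n \<le> 2^n" by (induction n) auto
      also have "(2::nat)^n \<le> 4096^n" by (intro power_mono) auto
      finally have "n \<le> 4096^n - 1" by simp
      then have "sum g {..<n} \<le> sum g {..<4096^n - 1}" by (intro sum_mono2) (use g0 in auto)
      also have "\<dots> \<le> 4096 * (\<Sum>i<n. 4096^i * f (4096^i))" by (rule B)
      also have "\<dots> \<le> 4096 * (\<Sum>n. 4096^n * f (4096^n))"
        by (intro mult_left_mono sum_le_suminf s) (use c0 in auto)
      finally show "sum g {..<n} \<le> 4096 * (\<Sum>n. 4096^n * f (4096^n))" .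
    qed (rule g0)
  qed
qed

section \<open>From the parabola to all rational quadrics\<close>

definition pt :: "real \<Rightarrow> real \<Rightarrow> real^2" where
  "pt x y = x *\<^sub>R axis 1 1 + y *\<^sub>R axis 2 1"

lemma pt_nth [simp]: "pt x y $ 1 = x" "pt x y $ 2 = y"
  by (simp_all add: pt_def axis_def)

lemma pt_eta: "pt (v$1) (v$2) = v"
  by (simp add: vec_eq_iff forall_2)

lemma parabola_approximable_iff: "t \<in> parabola_approximable \<psi> \<longleftrightarrow> pt t (t\<^sup>2) \<in> simul_approximable \<psi>"
  by (simp add: parabola_approximable_def simul_approximable_iff)

text \<open>Exceptional points come from F or from a negligible set of parameters, and both have
  null images. The exponent j of a transfer depends on the parameter t, so the results for the
  parabola are applied to all rescalings of \<open>\<psi>\<close> and the exceptional sets united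
  over j.\<close>

lemma parametrized_curve_zero_one:
  fixes \<phi> :: "real \<Rightarrow> real^2"
  assumes \<psi>: "approximating_function \<psi>"
    and Q: "Q \<subseteq> F \<union> \<phi> ` D" and F: "finite F"
    and diff: "\<And>t. t \<in> D \<Longrightarrow> \<phi> differentiable (at t)"
    and fwd: "\<And>t. t \<in> D \<Longrightarrow> approximation_transfers (pt t (t\<^sup>2)) (\<phi> t)"
    and bwd: "\<And>t. t \<in> D \<Longrightarrow> approximation_transfers (\<phi> t) (pt t (t\<^sup>2))"
  shows "(summable (\<lambda>h::nat. (\<psi> (real (Suc h)))\<^sup>2) \<longrightarrow> induced_measure Q (approximable_on Q \<psi>) = 0) \<and>
         (\<not> summable (\<lambda>h::nat. (\<psi> (real (Suc h)))\<^sup>2) \<longrightarrow> induced_measure Q (Q - approximable_on Q \<psi>) = 0)"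
proof -
  have anti: "antimono_on {0<..} \<psi>" and pos: "\<And>x. x > 0 \<Longrightarrow> \<psi> x > 0"
    using \<psi> by (auto simp: approximating_function_def)
  have ev: "\<forall>\<^sub>F x in at_top. \<psi> x \<le> \<psi> 1"
    using anti by (auto simp: monotone_on_def intro!: eventually_mono[OF eventually_ge_at_top[of 1]])
  have anti2: "antimono_on {0<..} (\<lambda>x. (\<psi> x)\<^sup>2)"
    using anti pos by (auto simp: monotone_on_def less_imp_le intro!: power_mono)
  have cond: "summable (\<lambda>h::nat. (\<psi> (real (Suc h)))\<^sup>2) \<longleftrightarrow> summable (\<lambda>n. 4096^n * (\<psi> (4096^n))\<^sup>2)"
    by (rule condensation_4096[OF anti2]) simp
  have image_null: "hausdorff1 A = 0" if "A \<subseteq> F \<union> \<phi> ` (D \<inter> Z)" "negligible Z" for A Z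
  proof (rule hausdorff1_zero_subset[OF _ that(1)], rule hausdorff1_zero_Un[OF hausdorff1_finite[OF F]])
    show "hausdorff1 (\<phi> ` (D \<inter> Z)) = 0"
      by (rule hausdorff1_differentiable_image) (use diff negligible_subset[OF that(2)] in auto)
  qed
  show ?thesis unfolding cond
  proof (intro conjI impI)
    assume s: "summable (\<lambda>n. 4096^n * (\<psi> (4096^n))\<^sup>2)"
    define Z where "Z = (\<Union>j::nat. parabola_approximable (\<lambda>x. 4096^j * \<psi> (x / 4096^j)))"
    have "negligible (parabola_approximable (\<lambda>x. 4096^j * \<psi> (x / 4096^j)))" for j :: nat
    proof (rule parabola_null)
      show "antimono_on {0<..} (\<lambda>x. 4096^j * \<psi> (x / 4096^j))"
        using antimono_on_rescale[OF anti, of "1 / 4096^j" "4096^j"] by simp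
      \<comment> \<open>Rescaling shifts the condensed series by j and multiplies it by
        4096^(3j).\<close>
      have eq: "4096^(n+j) * (4096^j * \<psi> (4096^(n+j) / 4096^j))\<^sup>2 = 4096^j * (4096^j)\<^sup>2 * (4096^n * (\<psi> (4096^n))\<^sup>2)" for n
        by (simp add: power_add power_mult_distrib)
      have "summable (\<lambda>n. 4096^(n+j) * (4096^j * \<psi> (4096^(n+j) / 4096^j))\<^sup>2)"
        unfolding eq by (rule summable_mult[OF s])
      then show "summable (\<lambda>n. 4096^n * (4096^j * \<psi> (4096^n / 4096^j))\<^sup>2)"
        by (subst (asm) summable_iff_shift)
    qed
    then have Z: "negligible Z" unfolding Z_def by (intro negligible_countable_Union) auto
    have "Q \<inter> simul_approximable \<psi> \<inter> Q \<subseteq> F \<union> \<phi> ` (D \<inter> Z)"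
    proof
      fix y assume y: "y \<in> Q \<inter> simul_approximable \<psi> \<inter> Q"
      show "y \<in> F \<union> \<phi> ` (D \<inter> Z)"
      proof (cases "y \<in> F")
        case False
        then obtain t where t: "t \<in> D" "y = \<phi> t" using y Q by blast
        have "\<exists>j::nat. pt t (t\<^sup>2) \<in> simul_approximable (\<lambda>x. 4096^j * \<psi> (x / 4096^j))"
          using bwd[OF t(1)] y anti ev unfolding approximation_transfers_def t(2) by blast
        then have "t \<in> Z" by (auto simp: Z_def parabola_approximable_iff)
        then show ?thesis using t by blast
      qed auto
    qed
    then show "induced_measure Q (approximable_on Q \<psi>) = 0"
      unfolding induced_measure_def approximable_on_def by (rule image_null[OF _ Z])
  next
    assume ns: "\<not> summable (\<lambda>n. 4096^n * (\<psi> (4096^n))\<^sup>2)"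
    \<comment> \<open>The functions are rescaled in the opposite direction, so that a transfer with
      exponent j returns \<open>\<psi>\<close> itself.\<close>
    define Z where "Z = (\<Union>j::nat. - parabola_approximable (\<lambda>x. 1 / 4096^j * \<psi> (4096^j * x)))"
    have ap: "antimono_on {0<..} (\<lambda>x. 1 / 4096^j * \<psi> (4096^j * x))" for j :: nat
      by (rule antimono_on_rescale[OF anti]) auto
    have "negligible (- parabola_approximable (\<lambda>x. 1 / 4096^j * \<psi> (4096^j * x)))" for j :: nat
    proof (rule parabola_full[OF ap])
      show "0 < 1 / 4096^j * \<psi> (4096^j * x)" if "x > 0" for x using pos that by simp
      show "\<not> summable (\<lambda>n. 4096^n * (1 / 4096^j * \<psi> (4096^j * 4096^n))\<^sup>2)"
      proof
        assume s: "summable (\<lambda>n. 4096^n * (1 / 4096^j * \<psi> (4096^j * 4096^n))\<^sup>2)"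
        have eq: "4096^(n+j) * (\<psi> (4096^(n+j)))\<^sup>2 = 4096^j * (4096^j)\<^sup>2 * (4096^n * (1 / 4096^j * \<psi> (4096^j * 4096^n))\<^sup>2)" for n
          by (simp add: power_add power_mult_distrib power_divide mult.commute)
        have "summable (\<lambda>n. 4096^(n+j) * (\<psi> (4096^(n+j)))\<^sup>2)"
          unfolding eq by (rule summable_mult[OF s])
        then have "summable (\<lambda>n. 4096^n * (\<psi> (4096^n))\<^sup>2)" by (subst (asm) summable_iff_shift)
        then show False using ns by blast
      qed
    qed
    then have Z: "negligible Z" unfolding Z_def by (intro negligible_countable_Union) auto
    have "(Q - Q \<inter> simul_approximable \<psi>) \<inter> Q \<subseteq> F \<union> \<phi> ` (D \<inter> Z)"
    proof
      fix y assume y: "y \<in> (Q - Q \<inter> simul_approximable \<psi>) \<inter> Q"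
      show "y \<in> F \<union> \<phi> ` (D \<inter> Z)"
      proof (cases "y \<in> F")
        case False
        then obtain t where t: "t \<in> D" "y = \<phi> t" using y Q by blast
        have "t \<in> Z"
        proof (rule ccontr)
          assume "t \<notin> Z"
          then have tj: "pt t (t\<^sup>2) \<in> simul_approximable (\<lambda>x. 1 / 4096^j * \<psi> (4096^j * x))" for j :: nat
            by (auto simp: Z_def parabola_approximable_iff)
          \<comment> \<open>The function to be transferred is built from j, so j must be available
            before it. The common bound \<open>\<psi>\<close> 1, valid for all rescaled functions,
            makes this possible.\<close>
          obtain j :: nat where j: "\<And>\<psi>'. antimono_on {0<..} \<psi>' \<Longrightarrow> (\<forall>\<^sub>F x in at_top. \<psi>' x \<le> \<psi> 1) \<Longrightarrow>
            pt t (t\<^sup>2) \<in> simul_approximable \<psi>' \<Longrightarrow> y \<in> simul_approximable (\<lambda>x. 4096^j * \<psi>' (x / 4096^j))"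
            using fwd[OF t(1)] unfolding approximation_transfers_def t(2) by blast
          have "\<forall>\<^sub>F x in at_top. 1 / 4096^j * \<psi> (4096^j * x) \<le> \<psi> 1"
          proof (rule eventually_mono[OF eventually_ge_at_top[of 1]])
            fix x :: real assume x: "x \<ge> 1"
            have one: "(1::real) \<le> 4096^j" by simp
            have "1 * 1 \<le> 4096^j * x" using x one by (intro mult_mono) auto
            then have "\<psi> (4096^j * x) \<le> \<psi> 1" using anti by (auto simp: monotone_on_def)
            then have "1 / 4096^j * \<psi> (4096^j * x) \<le> 1 * \<psi> 1"
              using pos[of 1] pos[of "4096^j * x"] x by (intro mult_mono) auto
            then show "1 / 4096^j * \<psi> (4096^j * x) \<le> \<psi> 1" by simp
          qed
          from j[OF ap this tj] have "y \<in> simul_approximable \<psi>" by simp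
          then show False using y by blast
        qed
        then show ?thesis using t by blast
      qed auto
    qed
    then show "induced_measure Q (Q - approximable_on Q \<psi>) = 0"
      unfolding induced_measure_def approximable_on_def by (rule image_null[OF _ Z])
  qed
qed

lemma rational_projective_transfers':
  fixes a0 a1 a2 b0 b1 b2 c0 c1 c2 :: real
  assumes "{a0, a1, a2, b0, b1, b2, c0, c1, c2} \<subseteq> \<rat>"
    and "a0 + a1 * y$1 + a2 * y$2 \<noteq> 0"
    and "(a0 + a1 * y$1 + a2 * y$2) * y'$1 = b0 + b1 * y$1 + b2 * y$2"
    and "(a0 + a1 * y$1 + a2 * y$2) * y'$2 = c0 + c1 * y$1 + c2 * y$2"
  shows "approximation_transfers y y'"
proof (rule rational_projective_transfers[of "\<lambda>i k. [[a0, a1, a2], [b0, b1, b2], [c0, c1, c2]] ! i ! k"])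
  show "[[a0, a1, a2], [b0, b1, b2], [c0, c1, c2]] ! i ! k \<in> \<rat>" if "i < 3" "k < 3" for i k
    using assms(1) that by (auto simp: less_Suc_eq numeral_3_eq_3)
qed (use assms in \<open>simp_all add: numeral_2_eq_2\<close>)

lemma affine_transfers:
  fixes A :: "real^2^2" and b x :: "real^2"
  assumes A: "invertible A" "\<And>i j. A$i$j \<in> \<rat>" and b: "\<And>i. b$i \<in> \<rat>"
  shows "approximation_transfers x (A *v x + b)" "approximation_transfers (A *v x + b) x"
proof -
  have v: "(A *v x + b)$1 = A$1$1 * x$1 + A$1$2 * x$2 + b$1" "(A *v x + b)$2 = A$2$1 * x$1 + A$2$2 * x$2 + b$2"
    by (simp_all add: matrix_vector_mult_def sum_2)
  show "approximation_transfers x (A *v x + b)"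
    by (rule rational_projective_transfers'[of 1 0 0 "b$1" "A$1$1" "A$1$2" "b$2" "A$2$1" "A$2$2"])
       (use A b in \<open>simp_all add: v del: vector_add_component\<close>)
  define \<Delta> where "\<Delta> = A$1$1 * A$2$2 - A$1$2 * A$2$1"
  have \<Delta>: "\<Delta> \<noteq> 0" using A(1) by (simp add: invertible_det_nz det_2 \<Delta>_def)
  have \<Delta>r: "\<Delta> \<in> \<rat>" unfolding \<Delta>_def using A by (intro Rats_diff Rats_mult) auto
  show "approximation_transfers (A *v x + b) x"
  \<comment> \<open>Cramer's rule, with the determinant as constant denominator.\<close>
  proof (rule rational_projective_transfers'[of \<Delta> 0 0
         "A$1$2 * b$2 - A$2$2 * b$1" "A$2$2" "- A$1$2" "A$2$1 * b$1 - A$1$1 * b$2" "- A$2$1" "A$1$1"])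
    show "{\<Delta>, 0, 0, A$1$2 * b$2 - A$2$2 * b$1, A$2$2, - A$1$2, A$2$1 * b$1 - A$1$1 * b$2, - A$2$1, A$1$1} \<subseteq> \<rat>"
      using A b \<Delta>r by simp
    show "\<Delta> + 0 * (A *v x + b)$1 + 0 * (A *v x + b)$2 \<noteq> 0" using \<Delta> by simp
    show "(\<Delta> + 0 * (A *v x + b)$1 + 0 * (A *v x + b)$2) * x$1
      = A$1$2 * b$2 - A$2$2 * b$1 + A$2$2 * (A *v x + b)$1 + - A$1$2 * (A *v x + b)$2"
      unfolding v \<Delta>_def by (simp add: algebra_simps)
    show "(\<Delta> + 0 * (A *v x + b)$1 + 0 * (A *v x + b)$2) * x$2
      = A$2$1 * b$1 - A$1$1 * b$2 + - A$2$1 * (A *v x + b)$1 + A$1$1 * (A *v x + b)$2"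
      unfolding v \<Delta>_def by (simp add: algebra_simps)
  qed
qed

lemma differentiable_pt:
  assumes "f differentiable (at t)" "g differentiable (at t)"
  shows "(\<lambda>t::real. pt (f t) (g t)) differentiable (at t)"
  unfolding pt_def using assms by (intro differentiable_add differentiable_scaleR) auto

text \<open>Each standard conic is the parabola \<open>(1 : t : t\<^sup>2)\<close> up to a rational projective map, a
  finite set of points and the exclusion of some parameters.\<close>

lemma conic_parametrization:
  assumes "C \<in> {unit_circle, unit_hyperbola, unit_parabola}"
  obtains \<gamma> :: "real \<Rightarrow> real^2" and D F where "C \<subseteq> F \<union> \<gamma> ` D" "finite F"
    "\<And>t. t \<in> D \<Longrightarrow> \<gamma> differentiable (at t)"
    "\<And>t. t \<in> D \<Longrightarrow> approximation_transfers (pt t (t\<^sup>2)) (\<gamma> t)"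
    "\<And>t. t \<in> D \<Longrightarrow> approximation_transfers (\<gamma> t) (pt t (t\<^sup>2))"
proof -
  consider "C = unit_circle" | "C = unit_hyperbola" | "C = unit_parabola" using assms by blast
  then show thesis
  proof cases
    case 1
    \<comment> \<open>Stereographic parametrization (1 + t^2 : 1 - t^2 : 2t) from (-1, 0), the only
      point it misses.\<close>
    define \<gamma> where "\<gamma> = (\<lambda>t::real. pt ((1 - t\<^sup>2) / (1 + t\<^sup>2)) (2 * t / (1 + t\<^sup>2)))"
    have nz: "1 + t\<^sup>2 \<noteq> 0" for t :: real by (simp add: add_nonneg_eq_0_iff)
    show thesis
    proof (rule that[of "{pt (-1) 0}" \<gamma> UNIV])
      show "C \<subseteq> {pt (-1) 0} \<union> \<gamma> ` UNIV"
      proof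
        fix v assume "v \<in> C"
        then have v: "(v$1)\<^sup>2 + (v$2)\<^sup>2 = 1" by (simp add: 1 unit_circle_def)
        show "v \<in> {pt (-1) 0} \<union> \<gamma> ` UNIV"
        proof (cases "v$1 = -1")
          case True
          then have "v$2 = 0" using v by simp
          then show ?thesis using True pt_eta[of v] by auto
        next
          case False
          define t where "t = v$2 / (1 + v$1)"
          have p: "1 + v$1 \<noteq> 0" using False by linarith
          have "(v$2)\<^sup>2 = (1 + v$1) * (1 - v$1)" using v by (simp add: algebra_simps power2_eq_square)
          then have t2: "t\<^sup>2 = (1 - v$1) / (1 + v$1)" using p by (simp add: t_def power_divide power2_eq_square)
          have "1 + t\<^sup>2 = 2 / (1 + v$1)" "1 - t\<^sup>2 = 2 * v$1 / (1 + v$1)" unfolding t2 using p by (simp_all add: field_simps)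
          then have "\<gamma> t = v" using p pt_eta[of v] by (simp add: \<gamma>_def t_def)
          then show ?thesis by blast
        qed
      qed
      show "\<gamma> differentiable (at t)" for t
        unfolding \<gamma>_def using nz by (intro differentiable_pt derivative_intros) auto
      show "approximation_transfers (pt t (t\<^sup>2)) (\<gamma> t)" for t
        by (rule rational_projective_transfers'[of 1 0 1 1 0 "-1" 0 2 0]) (use nz[of t] in \<open>simp_all add: \<gamma>_def\<close>)
      \<comment> \<open>At (x, y) on the circle, t = y/(1 + x) and t^2 = (1 - x)/(1 + x).\<close>
      show "approximation_transfers (\<gamma> t) (pt t (t\<^sup>2))" for t
        by (rule rational_projective_transfers'[of 1 1 0 0 0 1 1 "-1" 0])
           (use nz[of t] in \<open>simp_all add: \<gamma>_def field_simps power2_eq_square\<close>)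
    qed auto
  next
    case 2
    \<comment> \<open>The parameter is t = x + y, so that 1/t = x - y; both branches are reached by
      the two signs of t.\<close>
    define \<gamma> where "\<gamma> = (\<lambda>t::real. pt ((t\<^sup>2 + 1) / (2 * t)) ((t\<^sup>2 - 1) / (2 * t)))"
    show thesis
    proof (rule that[of "{}" \<gamma> "- {0}"])
      show "C \<subseteq> {} \<union> \<gamma> ` (- {0})"
      proof
        fix v assume "v \<in> C"
        then have v: "(v$1 + v$2) * (v$1 - v$2) = 1" by (simp add: 2 unit_hyperbola_def algebra_simps power2_eq_square)
        define t where "t = v$1 + v$2"
        have t0: "t \<noteq> 0" using v by (auto simp: t_def)
        have ti: "v$1 - v$2 = 1 / t" using v t0 by (simp add: t_def field_simps)
        have "(t\<^sup>2 + 1) / (2 * t) = (t + 1 / t) / 2" "(t\<^sup>2 - 1) / (2 * t) = (t - 1 / t) / 2"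
          using t0 by (simp_all add: field_simps power2_eq_square)
        moreover have "(t + 1 / t) / 2 = v$1" "(t - 1 / t) / 2 = v$2"
          unfolding ti[symmetric] by (simp_all add: t_def)
        ultimately have "\<gamma> t = v" using pt_eta[of v] by (simp add: \<gamma>_def)
        then show "v \<in> {} \<union> \<gamma> ` (- {0})" using t0 by blast
      qed
      show "\<gamma> differentiable (at t)" if "t \<in> - {0}" for t
        unfolding \<gamma>_def using that by (intro differentiable_pt derivative_intros) auto
      show "approximation_transfers (pt t (t\<^sup>2)) (\<gamma> t)" if "t \<in> - {0}" for t
        by (rule rational_projective_transfers'[of 0 2 0 1 0 1 "-1" 0 1]) (use that in \<open>simp_all add: \<gamma>_def\<close>)
      \<comment> \<open>The denominator x - y equals 1/t, which turns the numerators into 1 and x +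
        y = t.\<close>
      show "approximation_transfers (\<gamma> t) (pt t (t\<^sup>2))" if "t \<in> - {0}" for t
        by (rule rational_projective_transfers'[of 0 1 "-1" 1 0 0 0 1 1])
           (use that in \<open>simp_all add: \<gamma>_def field_simps power2_eq_square\<close>)
    qed auto
  next
    case 3
    show thesis
    proof (rule that[of "{}" "\<lambda>t. pt t (t\<^sup>2)" UNIV])
      show "C \<subseteq> {} \<union> (\<lambda>t. pt t (t\<^sup>2)) ` UNIV"
        unfolding 3 unit_parabola_def by (auto simp: image_iff) (metis pt_eta)
      show "(\<lambda>t. pt t (t\<^sup>2)) differentiable (at t)" for t
        by (intro differentiable_pt derivative_intros)
      show "approximation_transfers (pt t (t\<^sup>2)) (pt t (t\<^sup>2))" for t
        by (rule rational_projective_transfers'[of 1 0 0 0 1 0 0 0 1]) simp_all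
      then show "approximation_transfers (pt t (t\<^sup>2)) (pt t (t\<^sup>2))" for t .
    qed auto
  qed
qed

theorem theorem2:
  fixes \<psi> :: "real \<Rightarrow> real" and Q :: "(real^2) set"
  assumes "approximating_function \<psi>"
    and "nondegenerate_rational_quadric Q"
  shows "(summable (\<lambda>h::nat. (\<psi> (real (Suc h)))\<^sup>2) \<longrightarrow>
            induced_measure Q (approximable_on Q \<psi>) = 0) \<and>
         (\<not> summable (\<lambda>h::nat. (\<psi> (real (Suc h)))\<^sup>2) \<longrightarrow>
            induced_measure Q (Q - approximable_on Q \<psi>) = 0)"
proof -
  obtain T C where T: "rational_affine T" and C: "C \<in> {unit_circle, unit_hyperbola, unit_parabola}" and Q: "Q = T ` C"
    using assms(2) unfolding nondegenerate_rational_quadric_def by blast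
  obtain A :: "real^2^2" and b :: "real^2" where A: "invertible A" "\<And>i j. A$i$j \<in> \<rat>" and b: "\<And>i. b$i \<in> \<rat>"
    and T: "T = (\<lambda>x. A *v x + b)" using T unfolding rational_affine_def by blast
  obtain \<gamma> :: "real \<Rightarrow> real^2" and D F where \<gamma>: "C \<subseteq> F \<union> \<gamma> ` D" "finite F"
    "\<And>t. t \<in> D \<Longrightarrow> \<gamma> differentiable (at t)"
    "\<And>t. t \<in> D \<Longrightarrow> approximation_transfers (pt t (t\<^sup>2)) (\<gamma> t)"
    "\<And>t. t \<in> D \<Longrightarrow> approximation_transfers (\<gamma> t) (pt t (t\<^sup>2))"
    by (rule conic_parametrization[OF C]) (rule that; assumption)
  show ?thesis
  proof (rule parametrized_curve_zero_one[OF assms(1), where F="T ` F" and \<phi>="\<lambda>t. T (\<gamma> t)" and D=D])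
    show "Q \<subseteq> T ` F \<union> (\<lambda>t. T (\<gamma> t)) ` D" unfolding Q using \<gamma>(1) by blast
    show "(\<lambda>t. T (\<gamma> t)) differentiable (at t)" if t: "t \<in> D" for t
    proof -
      obtain \<gamma>' where "(\<gamma> has_derivative \<gamma>') (at t)" using \<gamma>(3)[OF t] unfolding differentiable_def by blast
      then have "((\<lambda>t. A *v \<gamma> t + b) has_derivative (\<lambda>h. A *v \<gamma>' h + 0)) (at t)"
        by (intro has_derivative_add bounded_linear.has_derivative[OF matrix_vector_mul_bounded_linear] has_derivative_const)
      then show ?thesis unfolding T differentiable_def by blast
    qed
    show "approximation_transfers (pt t (t\<^sup>2)) (T (\<gamma> t))" if "t \<in> D" for t
      unfolding T by (rule approximation_transfers_trans[OF \<gamma>(4)[OF that] affine_transfers(1)[OF A b]])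
    show "approximation_transfers (T (\<gamma> t)) (pt t (t\<^sup>2))" if "t \<in> D" for t
      unfolding T by (rule approximation_transfers_trans[OF affine_transfers(2)[OF A b] \<gamma>(5)[OF that]])
  qed (use \<gamma>(2) in simp)
qed

end
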